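(* Suppose $G_\phi$ is a free-by-cyclic group $F_r\rtimes_\phi\mathbb{Z}=\langle F_r,t\mid txt^{-1}=\phi(x),\ x\in F_r\rangle$, where $F_r$ is a free group of finite rank $r$ and $\phi$ is an automorphism of $F_r$. Then a two-generator subgroup of $G_\phi$ is either free of rank $2$, or an undistorted (finitely generated free)-by-cyclic sub-mapping torus subgroup of $G_\phi$.
   Context: A two-generator subgroup is a subgroup that can be generated by two elements. A finitely generated subgroup $H\le G_\phi$ is a sub-mapping torus of $G_\phi$ if there exist $u\in F_r$, an integer $m\ge 1$ and a nontrivial finitely generated subgroup $V\le F_r$ such that, with $s=ut^m$, one has $H=\langle s,V\rangle$ and $sVs^{-1}\le V$. A finitely generated subgroup of a finitely generated group is undistorted if its inclusion is a quasi-isometric embedding with respect to word metrics. A (finitely generated free)-by-cyclic group is a group of the form $V\rtimes\mathbb{Z}$ with $V$ a finitely generated free group.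
   Formalization: The two-generator subgroup is additionally assumed not to be cyclic; for cyclic subgroups (for example the trivial subgroup or ⟨t⟩) the claim is false, since they are neither free of rank 2 nor sub-mapping tori. *)

theory Defs
  imports "HOL-Algebra.Algebra"
begin

section \<open>Free groups of finite rank\<close>

text \<open>
  A letter \<open>(x, True)\<close> stands for the generator \<open>x\<close>, and \<open>(x, False)\<close> for its inverse.
  Elements of the free group are the freely reduced words; \<open>push a w\<close> multiplies a reduced
  word \<open>w\<close> by the letter \<open>a\<close> on the left, cancelling if necessary.
\<close>

definition inv_letter :: "'a \<times> bool \<Rightarrow> 'a \<times> bool" where
  "inv_letter a = (fst a, \<not> snd a)"

definition reduced :: "('a \<times> bool) list \<Rightarrow> bool" where
  "reduced w \<longleftrightarrow> successively (\<lambda>a b. b \<noteq> inv_letter a) w"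

fun push :: "'a \<times> bool \<Rightarrow> ('a \<times> bool) list \<Rightarrow> ('a \<times> bool) list" where
  "push a [] = [a]"
| "push a (b # w) = (if b = inv_letter a then w else a # b # w)"

definition free_group :: "'a set \<Rightarrow> ('a \<times> bool) list monoid" where
  "free_group S = \<lparr>carrier = {w. reduced w \<and> fst ` set w \<subseteq> S}, monoid.mult = foldr push, one = []\<rparr>"

definition free_of_rank :: "('a, 'b) monoid_scheme \<Rightarrow> nat \<Rightarrow> bool" where
  "free_of_rank G r \<longleftrightarrow> group G \<and> G \<cong> free_group {..<r}"

lemma inv_letter_inv_letter [simp]: "inv_letter (inv_letter a) = a"
  and fst_inv_letter [simp]: "fst (inv_letter a) = fst a"
  and inv_letter_eq_iff [simp]: "inv_letter a = inv_letter b \<longleftrightarrow> a = b"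
  by (auto simp: inv_letter_def prod_eq_iff)

lemma reduced_simps [simp]:
  "reduced []" "reduced [a]" "reduced (a # b # w) \<longleftrightarrow> b \<noteq> inv_letter a \<and> reduced (b # w)"
  by (auto simp: reduced_def)

lemma reduced_ConsD: "reduced (a # w) \<Longrightarrow> reduced w"
  by (cases w) auto

lemma push_eq_Cons: "reduced (a # w) \<Longrightarrow> push a w = a # w"
  by (cases w) auto

lemma reduced_push: "reduced w \<Longrightarrow> reduced (push a w)"
  by (cases w) (auto dest: reduced_ConsD)

lemma push_inv_letter: "reduced w \<Longrightarrow> push (inv_letter a) (push a w) = w"
  by (cases w) (auto simp: push_eq_Cons)

lemma reduced_foldr_push: "reduced w \<Longrightarrow> reduced (foldr push u w)"
  by (induction u) (auto simp: reduced_push)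

lemma letters_push: "fst a \<in> S \<Longrightarrow> fst ` set w \<subseteq> S \<Longrightarrow> fst ` set (push a w) \<subseteq> S"
  by (cases w) auto

lemma letters_foldr_push:
  "fst ` set u \<subseteq> S \<Longrightarrow> fst ` set w \<subseteq> S \<Longrightarrow> fst ` set (foldr push u w) \<subseteq> S"
  by (induction u) (simp_all add: letters_push)

lemma foldr_push_push:
  assumes "reduced w"
  shows "foldr push (push a u) w = push a (foldr push u w)"
proof (cases u)
  case (Cons b v)
  then show ?thesis
    using push_inv_letter[OF reduced_foldr_push[OF assms], of "inv_letter a" v] by auto
qed auto

lemma foldr_push_assoc:
  "reduced w \<Longrightarrow> foldr push (foldr push u v) w = foldr push u (foldr push v w)"
  by (induction u) (auto simp: foldr_push_push)

lemma foldr_push_Nil: "reduced w \<Longrightarrow> foldr push w [] = w"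
proof (induction w)
  case (Cons a w)
  then have "foldr push w [] = w" using reduced_ConsD by blast
  then show ?case using Cons.prems by (simp add: push_eq_Cons)
qed simp

lemma foldr_push_inverse:
  "reduced u \<Longrightarrow> foldr push (rev (map inv_letter w)) (foldr push w u) = u"
  by (induction w arbitrary: u) (auto simp: push_inv_letter reduced_foldr_push)

theorem group_free_group: "group (free_group S)"
proof (rule groupI)
  fix u v w assume "u \<in> carrier (free_group S)" "v \<in> carrier (free_group S)"
    "w \<in> carrier (free_group S)"
  then show "u \<otimes>\<^bsub>free_group S\<^esub> v \<in> carrier (free_group S)"
    and "u \<otimes>\<^bsub>free_group S\<^esub> v \<otimes>\<^bsub>free_group S\<^esub> w
      = u \<otimes>\<^bsub>free_group S\<^esub> (v \<otimes>\<^bsub>free_group S\<^esub> w)"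
    by (simp_all add: free_group_def reduced_foldr_push foldr_push_assoc letters_foldr_push)
next
  fix w assume w: "w \<in> carrier (free_group S)"
  let ?v = "foldr push (rev (map inv_letter w)) []"
  have "?v \<otimes>\<^bsub>free_group S\<^esub> w = \<one>\<^bsub>free_group S\<^esub>"
    using w foldr_push_inverse[of "[]" w]
    by (simp add: free_group_def foldr_push_assoc foldr_push_Nil)
  moreover have "?v \<in> carrier (free_group S)"
    using w by (simp add: free_group_def reduced_foldr_push letters_foldr_push image_image)
  ultimately show "\<exists>v\<in>carrier (free_group S). v \<otimes>\<^bsub>free_group S\<^esub> w = \<one>\<^bsub>free_group S\<^esub>"
    by blast
qed (auto simp: free_group_def)

definition eval_letter :: "('b, 'c) monoid_scheme \<Rightarrow> ('a \<Rightarrow> 'b) \<Rightarrow> 'a \<times> bool \<Rightarrow> 'b" where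
  "eval_letter G f a = (if snd a then f (fst a) else inv\<^bsub>G\<^esub> f (fst a))"

definition eval_word :: "('b, 'c) monoid_scheme \<Rightarrow> ('a \<Rightarrow> 'b) \<Rightarrow> ('a \<times> bool) list \<Rightarrow> 'b" where
  "eval_word G f w = foldr (\<lambda>a g. eval_letter G f a \<otimes>\<^bsub>G\<^esub> g) w \<one>\<^bsub>G\<^esub>"

lemma eval_word_simps [simp]:
  "eval_word G f [] = \<one>\<^bsub>G\<^esub>"
  "eval_word G f (a # w) = eval_letter G f a \<otimes>\<^bsub>G\<^esub> eval_word G f w"
  by (auto simp: eval_word_def)

context group
begin

lemma eval_letter_closed: "f \<in> S \<rightarrow> carrier G \<Longrightarrow> fst a \<in> S \<Longrightarrow> eval_letter G f a \<in> carrier G"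
  by (auto simp: eval_letter_def)

lemma eval_word_closed:
  "f \<in> S \<rightarrow> carrier G \<Longrightarrow> fst ` set w \<subseteq> S \<Longrightarrow> eval_word G f w \<in> carrier G"
  by (induction w) (auto simp: eval_letter_closed)

lemma eval_letter_inv_letter:
  "f \<in> S \<rightarrow> carrier G \<Longrightarrow> fst a \<in> S \<Longrightarrow> eval_letter G f (inv_letter a) = inv (eval_letter G f a)"
  by (auto simp: eval_letter_def inv_letter_def Pi_iff)

lemma eval_word_push:
  assumes "f \<in> S \<rightarrow> carrier G" "fst a \<in> S" "fst ` set w \<subseteq> S"
  shows "eval_word G f (push a w) = eval_letter G f a \<otimes> eval_word G f w"
proof (cases w)
  case (Cons b v)
  moreover have "eval_letter G f a \<otimes> (inv (eval_letter G f a) \<otimes> eval_word G f v) = eval_word G f v"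
    using assms Cons by (simp add: eval_letter_closed eval_word_closed flip: m_assoc)
  ultimately show ?thesis using assms by (auto simp: eval_letter_inv_letter)
qed auto

lemma eval_word_foldr_push:
  assumes "f \<in> S \<rightarrow> carrier G" "fst ` set u \<subseteq> S" "fst ` set w \<subseteq> S"
  shows "eval_word G f (foldr push u w) = eval_word G f u \<otimes> eval_word G f w"
  using assms(2)
proof (induction u)
  case (Cons a u)
  have "fst ` set (foldr push u w) \<subseteq> S"
    using assms Cons.prems by (simp add: letters_foldr_push)
  then show ?case
    using Cons assms
    by (simp add: eval_word_push[OF assms(1)] eval_letter_closed eval_word_closed m_assoc)
qed (use assms in \<open>simp add: eval_word_closed\<close>)

lemma eval_word_hom: "f \<in> S \<rightarrow> carrier G \<Longrightarrow> eval_word G f \<in> hom (free_group S) G"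
  by (auto simp: hom_def free_group_def eval_word_closed eval_word_foldr_push)

lemma hom_free_group_eq_eval_word:
  assumes "f \<in> S \<rightarrow> carrier G" and h: "h \<in> hom (free_group S) G"
    and gen: "\<And>x. x \<in> S \<Longrightarrow> h [(x, True)] = f x"
    and "w \<in> carrier (free_group S)"
  shows "h w = eval_word G f w"
  using assms(4)
proof (induction w)
  interpret F: group "free_group S" by (rule group_free_group)
  interpret H: group_hom "free_group S" G h
    using h by unfold_locales
  {
    case Nil
    show ?case using H.hom_one by (simp add: free_group_def)
  next
    case (Cons a w)
    obtain x b where a: "a = (x, b)" by (cases a)
    have w: "w \<in> carrier (free_group S)" and x: "x \<in> S"
      using Cons.prems a by (auto simp: free_group_def dest: reduced_ConsD)
    have L: "[(x, c)] \<in> carrier (free_group S)" for c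
      using x by (simp add: free_group_def)
    have "[(x, False)] \<otimes>\<^bsub>free_group S\<^esub> [(x, True)] = \<one>\<^bsub>free_group S\<^esub>"
      by (simp add: free_group_def inv_letter_def)
    then have "[(x, False)] = inv\<^bsub>free_group S\<^esub> [(x, True)]"
      using F.inv_equality L by metis
    then have "h [a] = eval_letter G f a"
      using gen[OF x] L by (auto simp: a eval_letter_def)
    moreover have "a # w = [a] \<otimes>\<^bsub>free_group S\<^esub> w"
      using Cons.prems by (simp add: free_group_def push_eq_Cons)
    ultimately show ?case
      using Cons.IH[OF w] H.hom_mult[OF L w] a by (metis eval_word_simps(2))
  }
qed

end

section \<open>Semidirect products and mapping tori\<close>

definition semidirect_product ::
    "('a, 'c) monoid_scheme \<Rightarrow> ('b, 'd) monoid_scheme \<Rightarrow> ('b \<Rightarrow> 'a \<Rightarrow> 'a) \<Rightarrow> ('a \<times> 'b) monoid" where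
  "semidirect_product N Q \<theta> =
     \<lparr>carrier = carrier N \<times> carrier Q,
      monoid.mult = (\<lambda>(x, p) (y, q). (x \<otimes>\<^bsub>N\<^esub> \<theta> p y, p \<otimes>\<^bsub>Q\<^esub> q)),
      one = (\<one>\<^bsub>N\<^esub>, \<one>\<^bsub>Q\<^esub>)\<rparr>"

definition mapping_torus :: "('a, 'b) monoid_scheme \<Rightarrow> ('a \<Rightarrow> 'a) \<Rightarrow> ('a \<times> int) monoid" where
  "mapping_torus F \<phi> = semidirect_product F integer_group (\<lambda>n. \<phi> [^]\<^bsub>AutoGroup F\<^esub> n)"

definition fibre :: "('a, 'b) monoid_scheme \<Rightarrow> 'a \<Rightarrow> 'a \<times> int" where
  "fibre F x = (x, 0)"

definition stable_letter :: "('a, 'b) monoid_scheme \<Rightarrow> 'a \<times> int" where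
  "stable_letter F = (\<one>\<^bsub>F\<^esub>, 1)"

text \<open>\<open>V \<rtimes> \<int>\<close> with \<open>V\<close> free of finite rank, where \<open>\<int>\<close> acts on \<open>V\<close> by an arbitrary homomorphism.\<close>

definition fg_free_by_cyclic :: "('a, 'b) monoid_scheme \<Rightarrow> bool" where
  "fg_free_by_cyclic H \<longleftrightarrow> group H \<and>
     (\<exists>(k::nat) \<theta>. \<theta> \<in> hom integer_group (AutoGroup (free_group {..<k})) \<and>
        H \<cong> semidirect_product (free_group {..<k}) integer_group \<theta>)"

lemma carrier_AutoGroup: "carrier (AutoGroup N) = auto N"
  and mult_AutoGroup_apply:
    "f \<in> auto N \<Longrightarrow> g \<in> auto N \<Longrightarrow> x \<in> carrier N \<Longrightarrow> (f \<otimes>\<^bsub>AutoGroup N\<^esub> g) x = f (g x)"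
  and one_AutoGroup_apply: "x \<in> carrier N \<Longrightarrow> \<one>\<^bsub>AutoGroup N\<^esub> x = x"
  by (auto simp: AutoGroup_def BijGroup_def auto_def compose_def)

theorem group_semidirect_product:
  assumes "group N" "group Q" and \<theta>: "\<theta> \<in> hom Q (AutoGroup N)"
  shows "group (semidirect_product N Q \<theta>)"
proof -
  interpret N: group N by fact
  interpret Q: group Q by fact
  interpret A: group "AutoGroup N" by (rule N.AutoGroup)
  interpret \<theta>: group_hom Q "AutoGroup N" \<theta> using \<theta> by unfold_locales
  have auto: "\<theta> p \<in> auto N" if "p \<in> carrier Q" for p
    using that \<theta>.hom_closed by (simp add: carrier_AutoGroup)
  have closed: "\<theta> p x \<in> carrier N" if "p \<in> carrier Q" "x \<in> carrier N" for p x
    using auto[OF that(1)] that(2) by (auto simp: auto_def hom_def)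
  have dist: "\<theta> p (x \<otimes>\<^bsub>N\<^esub> y) = \<theta> p x \<otimes>\<^bsub>N\<^esub> \<theta> p y"
    if "p \<in> carrier Q" "x \<in> carrier N" "y \<in> carrier N" for p x y
    using auto[OF that(1)] that(2,3) by (auto simp: auto_def hom_def)
  have comp: "\<theta> (p \<otimes>\<^bsub>Q\<^esub> q) x = \<theta> p (\<theta> q x)"
    if "p \<in> carrier Q" "q \<in> carrier Q" "x \<in> carrier N" for p q x
    using that auto by (simp add: mult_AutoGroup_apply)
  have one: "\<theta> \<one>\<^bsub>Q\<^esub> x = x" if "x \<in> carrier N" for x
    using that by (simp add: one_AutoGroup_apply)
  have linv: "\<exists>z\<in>carrier N. \<exists>q\<in>carrier Q. z \<otimes>\<^bsub>N\<^esub> \<theta> q x = \<one>\<^bsub>N\<^esub> \<and> q \<otimes>\<^bsub>Q\<^esub> p = \<one>\<^bsub>Q\<^esub>"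
    if "x \<in> carrier N" "p \<in> carrier Q" for x p
    using that closed[of "inv\<^bsub>Q\<^esub> p" x]
    by (intro bexI[of _ "inv\<^bsub>N\<^esub> \<theta> (inv\<^bsub>Q\<^esub> p) x"] bexI[of _ "inv\<^bsub>Q\<^esub> p"])
      (simp_all del: \<theta>.hom_inv)
  show ?thesis
    by (rule groupI)
      (use linv in \<open>auto simp: semidirect_product_def closed dist comp one N.m_assoc Q.m_assoc
        simp del: \<theta>.hom_mult \<theta>.hom_one\<close>)
qed

context
  fixes F :: "('a, 'b) monoid_scheme" and \<phi>
  assumes F: "group F" and \<phi>: "\<phi> \<in> carrier (AutoGroup F)"
begin

interpretation F: group F by (rule F)
interpretation A: group "AutoGroup F" by (rule F.AutoGroup)

lemma hom_int_pow_AutoGroup: "(\<lambda>n. \<phi> [^]\<^bsub>AutoGroup F\<^esub> n) \<in> hom integer_group (AutoGroup F)"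
  using \<phi> by (auto simp: hom_def A.int_pow_mult)

lemma group_mapping_torus: "group (mapping_torus F \<phi>)"
  unfolding mapping_torus_def
  by (intro group_semidirect_product F group_integer_group hom_int_pow_AutoGroup)

lemma fibre_hom: "fibre F \<in> hom F (mapping_torus F \<phi>)"
  by (auto simp: hom_def fibre_def mapping_torus_def semidirect_product_def one_AutoGroup_apply)

lemma stable_letter_conj:
  assumes "x \<in> carrier F"
  shows "stable_letter F \<otimes>\<^bsub>mapping_torus F \<phi>\<^esub> fibre F x \<otimes>\<^bsub>mapping_torus F \<phi>\<^esub>
           inv\<^bsub>mapping_torus F \<phi>\<^esub> stable_letter F = fibre F (\<phi> x)"
proof -
  interpret G: group "mapping_torus F \<phi>" by (rule group_mapping_torus)
  have \<phi>x: "\<phi> x \<in> carrier F" and \<phi>1: "\<phi> \<one>\<^bsub>F\<^esub> = \<one>\<^bsub>F\<^esub>"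
    using \<phi> assms F hom_one[of \<phi> F F] by (auto simp: carrier_AutoGroup auto_def hom_def)
  have "stable_letter F \<otimes>\<^bsub>mapping_torus F \<phi>\<^esub> fibre F x
      = fibre F (\<phi> x) \<otimes>\<^bsub>mapping_torus F \<phi>\<^esub> stable_letter F"
    using \<phi> assms \<phi>x A.int_pow_1
    by (simp add: stable_letter_def fibre_def mapping_torus_def semidirect_product_def
        one_AutoGroup_apply)
  moreover have "stable_letter F \<in> carrier (mapping_torus F \<phi>)"
    "fibre F (\<phi> x) \<in> carrier (mapping_torus F \<phi>)"
    using \<phi>x by (auto simp: stable_letter_def fibre_def mapping_torus_def semidirect_product_def)
  ultimately show ?thesis by (simp add: G.m_assoc)
qed

end

section \<open>Generation and sub-mapping tori\<close>

definition finitely_generated :: "('a, 'b) monoid_scheme \<Rightarrow> bool" where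
  "finitely_generated G \<longleftrightarrow> (\<exists>S \<subseteq> carrier G. finite S \<and> generate G S = carrier G)"

definition two_generator_subgroup :: "'a set \<Rightarrow> ('a, 'b) monoid_scheme \<Rightarrow> bool" where
  "two_generator_subgroup H G \<longleftrightarrow> (\<exists>a\<in>carrier G. \<exists>b\<in>carrier G. H = generate G {a, b})"

definition sub_mapping_torus ::
    "('a, 'b) monoid_scheme \<Rightarrow> ('a \<Rightarrow> 'a) \<Rightarrow> ('a \<times> int) set \<Rightarrow> bool" where
  "sub_mapping_torus F \<phi> H \<longleftrightarrow>
     (let G = mapping_torus F \<phi> in
       subgroup H G \<and> finitely_generated (G\<lparr>carrier := H\<rparr>) \<and>
       (\<exists>u\<in>carrier F. \<exists>m::nat. m \<ge> 1 \<and>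
         (\<exists>V. subgroup V F \<and> finitely_generated (F\<lparr>carrier := V\<rparr>) \<and> V \<noteq> {\<one>\<^bsub>F\<^esub>} \<and>
           (let s = fibre F u \<otimes>\<^bsub>G\<^esub> stable_letter F [^]\<^bsub>G\<^esub> m in
             H = generate G (insert s (fibre F ` V)) \<and>
             (\<forall>v\<in>V. s \<otimes>\<^bsub>G\<^esub> fibre F v \<otimes>\<^bsub>G\<^esub> inv\<^bsub>G\<^esub> s \<in> fibre F ` V)))))"

section \<open>Word metrics and distortion\<close>

definition word_length :: "('a, 'b) monoid_scheme \<Rightarrow> 'a set \<Rightarrow> 'a \<Rightarrow> nat" where
  "word_length G S g =
     (LEAST n. \<exists>ws. length ws = n \<and> set ws \<subseteq> S \<union> m_inv G ` S \<and> foldr (monoid.mult G) ws \<one>\<^bsub>G\<^esub> = g)"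

definition word_metric :: "('a, 'b) monoid_scheme \<Rightarrow> 'a set \<Rightarrow> 'a \<Rightarrow> 'a \<Rightarrow> real" where
  "word_metric G S g h = real (word_length G S (inv\<^bsub>G\<^esub> g \<otimes>\<^bsub>G\<^esub> h))"

definition quasi_isometric_embedding ::
    "'a set \<Rightarrow> ('a \<Rightarrow> 'a \<Rightarrow> real) \<Rightarrow> ('b \<Rightarrow> 'b \<Rightarrow> real) \<Rightarrow> ('a \<Rightarrow> 'b) \<Rightarrow> bool" where
  "quasi_isometric_embedding A dA dB f \<longleftrightarrow>
     (\<exists>K C. K \<ge> 1 \<and> C \<ge> 0 \<and>
       (\<forall>x\<in>A. \<forall>y\<in>A. dA x y / K - C \<le> dB (f x) (f y) \<and> dB (f x) (f y) \<le> K * dA x y + C))"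

text \<open>
  All finite generating sets are considered; since changing the generating set changes a word
  metric only up to bi-Lipschitz equivalence, asking for one choice would be equivalent.
\<close>

definition undistorted :: "'a set \<Rightarrow> ('a, 'b) monoid_scheme \<Rightarrow> bool" where
  "undistorted H G \<longleftrightarrow>
     group G \<and> finitely_generated G \<and> subgroup H G \<and> finitely_generated (G\<lparr>carrier := H\<rparr>) \<and>
     (\<forall>S T. finite S \<and> S \<subseteq> carrier G \<and> generate G S = carrier G \<and>
            finite T \<and> T \<subseteq> H \<and> generate (G\<lparr>carrier := H\<rparr>) T = H \<longrightarrow>
        quasi_isometric_embedding H (word_metric (G\<lparr>carrier := H\<rparr>) T) (word_metric G S) (\<lambda>x. x))"

end

theory Submission
  imports Defs
begin

text \<open>
  Let \<open>G\<close> be the mapping torus, \<open>p : G \<rightarrow> \<int>\<close> the exponent of the stable letter, and identify \<open>F\<close>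
  with the kernel of \<open>p\<close>.  The Euclidean algorithm on the pair \<open>(p a, p b)\<close>, carried out by Nielsen
  moves, turns the two generators of \<open>H\<close> into \<open>s\<close> and \<open>x\<close> with \<open>p x = 0\<close> and \<open>p s \<ge> 0\<close>
  (\<open>euclid_on_generating_pair\<close>).  If \<open>p s = 0\<close>, then \<open>H\<close> is a subgroup of a free group, hence
  free; it needs at most two generators and is not cyclic, so its rank is two.

  If \<open>p s > 0\<close>, then \<open>K = H \<inter> F\<close> is generated by the translates \<open>x\<^sub>i = s\<^sup>i x s\<^sup>-\<^sup>i\<close>, and \<open>H\<close> is the
  semidirect product of \<open>K\<close> and \<open>\<langle>s\<rangle>\<close> (\<open>generate_pair_normal_form\<close>).  By the Nielsen-Schreier
  theorem \<open>K\<close> is free on some basis, possibly an infinite one.  The dichotomy is whether this basis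
  is finite.

  Suppose that it is infinite.  The homology of \<open>K\<close> with coefficients in the field with two
  elements is a cyclic module over the Laurent polynomials in \<open>s\<close>, and being infinite-dimensional it
  is free.  Dually, homomorphisms \<open>K \<rightarrow> \<int>/2\<close> take all patterns of values on any window of
  consecutive \<open>x\<^sub>i\<close>.  Hence \<open>n\<close> consecutive translates generate a free group of rank at least \<open>n\<close>,
  and since free groups of finite rank are Hopfian, they are a basis of it.  So all the \<open>x\<^sub>i\<close>
  together are a free family (\<open>translates_free_if_infinite_rank\<close>), and therefore \<open>s\<close> and \<open>x\<close>
  generate a free group of rank two (\<open>free_pair_of_free_translates\<close>).

  Suppose that it is finite.  Then \<open>K\<close> is finitely generated and normalised by \<open>s\<close>, so \<open>H\<close> is at once
  a sub-mapping torus and (finitely generated free)-by-cyclic.  It is undistorted because it is a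
  coarse Lipschitz retract of \<open>G\<close>: write an element of \<open>G\<close> as \<open>s\<^sup>i f t\<^sup>j\<close> with \<open>f \<in> F\<close> and
  \<open>0 \<le> j < p s\<close>, and send it to \<open>s\<^sup>i \<pi> f\<close>, where \<open>\<pi>\<close> is a nearest-point projection of the Cayley tree
  of \<open>F\<close> onto \<open>K\<close>.  Steps in the fibre move the image a bounded amount because \<open>\<pi>\<close> is coarsely
  Lipschitz.  Steps along \<open>t\<close> do so because conjugation by \<open>s\<close> is a quasi-isometry of the tree that
  preserves \<open>K\<close>, and such a map commutes with the projection up to a bounded error
  (\<open>bounded_projection_difference\<close>).
\<close>

section \<open>Free families\<close>

text \<open>
  A basis of the subgroup that it generates.  Families are used instead of sets because the bases below
  come with indices that matter: edges of a coset graph, and exponents of a stable letter.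
\<close>

definition free_family :: "('b, 'c) monoid_scheme \<Rightarrow> 'a set \<Rightarrow> ('a \<Rightarrow> 'b) \<Rightarrow> bool" where
  "free_family G I f \<longleftrightarrow>
     f \<in> I \<rightarrow> carrier G \<and> inj_on (eval_word G f) (carrier (free_group I))"

lemma in_carrier_free_group [simp]:
    "w \<in> carrier (free_group S) \<longleftrightarrow> reduced w \<and> fst ` set w \<subseteq> S"
  and mult_free_group [simp]: "u \<otimes>\<^bsub>free_group S\<^esub> v = foldr push u v"
  and one_free_group [simp]: "\<one>\<^bsub>free_group S\<^esub> = []"
  by (auto simp: free_group_def)

lemma reduced_appendD1: "reduced (u @ v) \<Longrightarrow> reduced u"
  and reduced_appendD2: "reduced (u @ v) \<Longrightarrow> reduced v"
  by (auto simp: reduced_def successively_append_iff)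

lemma inv_free_group_letter:
  "fst a \<in> S \<Longrightarrow> inv\<^bsub>free_group S\<^esub> [a] = [inv_letter a]"
proof -
  interpret R: group "free_group S" by (rule group_free_group)
  show "fst a \<in> S \<Longrightarrow> inv\<^bsub>free_group S\<^esub> [a] = [inv_letter a]"
    by (rule R.inv_equality) auto
qed

lemma eval_word_cong:
  "(\<And>i. i \<in> fst ` set w \<Longrightarrow> f i = g i) \<Longrightarrow> eval_word G f w = eval_word G g w"
  by (induction w) (auto simp: eval_letter_def)

lemma eval_word_map_letters:
  "eval_word G f (map (apfst \<pi>) w) = eval_word G (\<lambda>i. f (\<pi> i)) w"
  by (induction w) (auto simp: eval_letter_def)

lemma eval_word_free_group_generators:
  assumes "w \<in> carrier (free_group S)"
  shows "eval_word (free_group S) (\<lambda>x. [(x, True)]) w = w"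
proof -
  interpret R: group "free_group S" by (rule group_free_group)
  show ?thesis
    using R.hom_free_group_eq_eval_word[of "\<lambda>x. [(x, True)]" S "\<lambda>w. w" w] assms
    by (simp add: hom_def)
qed

context group
begin

lemma inv_mult_cancel:
  assumes "x \<in> carrier G" "y \<in> carrier G"
  shows "inv x \<otimes> (x \<otimes> y) = y" "x \<otimes> (inv x \<otimes> y) = y"
  using assms by (simp_all flip: m_assoc)

lemma eval_word_in_subgroup:
  assumes K: "subgroup K G" and "f \<in> I \<rightarrow> K" "fst ` set w \<subseteq> I"
  shows "eval_word G f w \<in> K"
  using assms(3)
  by (induction w)
    (use assms(2) in \<open>auto simp: eval_letter_def intro!: subgroup.one_closed[OF K]
      subgroup.m_closed[OF K] subgroup.m_inv_closed[OF K]\<close>)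

lemma eval_word_image:
  assumes f: "f \<in> I \<rightarrow> carrier G"
  shows "eval_word G f ` carrier (free_group I) = generate G (f ` I)" (is "?E = ?K")
proof
  have fI: "f ` I \<subseteq> carrier G" using f by auto
  have "f \<in> I \<rightarrow> ?K" by (auto intro: generate.incl)
  then show "?E \<subseteq> ?K"
    using eval_word_in_subgroup[OF generate_is_subgroup[OF fI]] by auto
  interpret R: group "free_group I" by (rule group_free_group)
  interpret E: group_hom "free_group I" G "eval_word G f"
    using eval_word_hom[OF f] by unfold_locales
  have "f i \<in> ?E" if "i \<in> I" for i
    using that f by (intro image_eqI[of _ _ "[(i, True)]"]) (auto simp: eval_letter_def Pi_iff)
  then show "?K \<subseteq> ?E"
    by (intro generate_subgroup_incl E.img_is_subgroup) auto
qed

lemma free_family_iff_kernel: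
  "free_family G I f \<longleftrightarrow> f \<in> I \<rightarrow> carrier G \<and>
     (\<forall>w. reduced w \<and> fst ` set w \<subseteq> I \<and> eval_word G f w = \<one> \<longrightarrow> w = [])"
proof (cases "f \<in> I \<rightarrow> carrier G")
  case True
  interpret R: group "free_group I" by (rule group_free_group)
  interpret E: group_hom "free_group I" G "eval_word G f"
    using eval_word_hom[OF True] by unfold_locales
  show ?thesis
    using True E.inj_on_one_iff by (auto simp: free_family_def)
qed (simp add: free_family_def)

text \<open>
  Homomorphisms out of a subgroup \<open>K\<close> are taken on \<open>G\<close> with its carrier restricted to \<open>K\<close>, while words
  are evaluated in \<open>G\<close> itself, so that the many subgroups below share one evaluation map.
\<close>

lemma hom_subgroup_eval_word:
  assumes K: "subgroup K G" and Q: "group Q" and h: "h \<in> hom (G\<lparr>carrier := K\<rparr>) Q"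
    and y: "y \<in> J \<rightarrow> K" and w: "fst ` set w \<subseteq> J"
  shows "h (eval_word G y w) = eval_word Q (\<lambda>j. h (y j)) w"
proof -
  interpret Q: group Q by fact
  interpret h: group_hom "G\<lparr>carrier := K\<rparr>" Q h
    using h K by (simp add: group_hom_def group_hom_axioms_def Q subgroup_imp_group)
  have inv: "h (inv k) = inv\<^bsub>Q\<^esub> h k" if "k \<in> K" for k
    using h.hom_inv[of k] that K by (simp add: m_inv_consistent)
  show ?thesis
    using w
  proof (induction w)
    case Nil
    then show ?case using h.hom_one by simp
  next
    case (Cons a w)
    have a: "eval_letter G y a \<in> K"
      using Cons.prems y by (auto simp: eval_letter_def intro!: subgroup.m_inv_closed[OF K])
    have w: "eval_word G y w \<in> K"
      using Cons.prems y by (intro eval_word_in_subgroup[OF K, of _ J]) auto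
    have "y (fst a) \<in> K" using Cons.prems y by auto
    then have "h (eval_letter G y a) = eval_letter Q (\<lambda>j. h (y j)) a"
      by (simp add: eval_letter_def inv)
    then show ?case
      using Cons h.hom_mult[of "eval_letter G y a" "eval_word G y w"] a w by simp
  qed
qed

lemma hom_eval_word:
  assumes "group Q" "h \<in> hom G Q" "y \<in> J \<rightarrow> carrier G" "fst ` set w \<subseteq> J"
  shows "h (eval_word G y w) = eval_word Q (\<lambda>j. h (y j)) w"
  using hom_subgroup_eval_word[OF subgroup_self, of Q h y J w] assms by simp

lemma free_family_inj_hom:
  assumes "group Q" "h \<in> hom G Q" "inj_on h (carrier G)" "free_family G I f"
  shows "free_family Q I (\<lambda>i. h (f i))"
proof -
  have f: "f \<in> I \<rightarrow> carrier G" and inj: "inj_on (eval_word G f) (carrier (free_group I))"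
    using assms(4) by (auto simp: free_family_def)
  have "inj_on (h \<circ> eval_word G f) (carrier (free_group I))"
    using inj assms(3) eval_word_image[OF f] generate_incl[of "f ` I"] f
    by (intro comp_inj_on) (auto intro: inj_on_subset)
  then have "inj_on (eval_word Q (\<lambda>i. h (f i))) (carrier (free_group I))"
    by (rule inj_on_cong[THEN iffD1, rotated]) (auto simp: hom_eval_word[OF assms(1,2) f])
  then show ?thesis
    using f assms(2) by (auto simp: free_family_def hom_def)
qed

lemma free_family_reindex:
  assumes "free_family G I f" and \<pi>: "inj_on \<pi> I'" "\<pi> ` I' \<subseteq> I"
  shows "free_family G I' (\<lambda>i. f (\<pi> i))"
  unfolding free_family_iff_kernel
proof (intro conjI allI impI)
  show "(\<lambda>i. f (\<pi> i)) \<in> I' \<rightarrow> carrier G" using assms by (auto simp: free_family_def)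
  fix w assume w: "reduced w \<and> fst ` set w \<subseteq> I' \<and> eval_word G (\<lambda>i. f (\<pi> i)) w = \<one>"
  have "reduced (map (apfst \<pi>) w)" if "reduced w" "fst ` set w \<subseteq> I'" for w :: "('d \<times> bool) list"
    using that
  proof (induction w rule: induct_list012)
    case (3 a b w)
    then have "fst a \<in> I'" "fst b \<in> I'" by auto
    then have "\<pi> (fst b) = \<pi> (fst a) \<longleftrightarrow> fst b = fst a"
      using \<pi>(1) by (auto dest: inj_onD)
    then have "apfst \<pi> b = inv_letter (apfst \<pi> a) \<longleftrightarrow> b = inv_letter a"
      by (auto simp: inv_letter_def prod_eq_iff)
    then show ?case using 3 by auto
  qed auto
  moreover have "fst ` set (map (apfst \<pi>) w) \<subseteq> I" using w \<pi> by force
  ultimately have "map (apfst \<pi>) w = []"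
    using assms(1) w unfolding free_family_iff_kernel eval_word_map_letters[symmetric] by blast
  then show "w = []" by simp
qed

text \<open>
  The universal property of free groups, for the subgroup generated by a free family.
\<close>

lemma free_family_extends_to_hom:
  assumes f: "free_family G I f" and Q: "group Q" and q: "q \<in> I \<rightarrow> carrier Q"
  shows "\<exists>h \<in> hom (G\<lparr>carrier := generate G (f ` I)\<rparr>) Q. \<forall>i\<in>I. h (f i) = q i"
proof -
  interpret Q: group Q by fact
  interpret R: group "free_group I" by (rule group_free_group)
  let ?W = "carrier (free_group I)" let ?e = "eval_word G f"
  have fI: "f \<in> I \<rightarrow> carrier G" and inj: "inj_on ?e ?W"
    using f by (auto simp: free_family_def)
  define h where "h = eval_word Q q \<circ> inv_into ?W ?e"
  have h: "h (?e w) = eval_word Q q w" if "w \<in> ?W" for w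
    using inj that unfolding h_def o_def by (subst inv_into_f_f) auto
  have "h \<in> hom (G\<lparr>carrier := generate G (f ` I)\<rparr>) Q"
  proof (rule homI)
    fix k assume "k \<in> carrier (G\<lparr>carrier := generate G (f ` I)\<rparr>)"
    then obtain w where "w \<in> ?W" "k = ?e w" unfolding eval_word_image[OF fI, symmetric] by auto
    then show "h k \<in> carrier Q" using h Q.eval_word_closed[OF q] by auto
  next
    fix k k'
    assume "k \<in> carrier (G\<lparr>carrier := generate G (f ` I)\<rparr>)"
      "k' \<in> carrier (G\<lparr>carrier := generate G (f ` I)\<rparr>)"
    then obtain w w' where w: "w \<in> ?W" "k = ?e w" "w' \<in> ?W" "k' = ?e w'"
      unfolding eval_word_image[OF fI, symmetric] by auto
    have "k \<otimes> k' = ?e (w \<otimes>\<^bsub>free_group I\<^esub> w')"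
      using w eval_word_hom[OF fI] by (simp add: hom_def)
    then have "h (k \<otimes> k') = eval_word Q q (w \<otimes>\<^bsub>free_group I\<^esub> w')"
      using h w R.m_closed by metis
    also have "\<dots> = h k \<otimes>\<^bsub>Q\<^esub> h k'"
      using w h Q.eval_word_hom[OF q] by (simp add: hom_def)
    finally show "h (k \<otimes>\<^bsub>G\<lparr>carrier := generate G (f ` I)\<rparr>\<^esub> k') = h k \<otimes>\<^bsub>Q\<^esub> h k'" by simp
  qed
  moreover have "h (f i) = q i" if "i \<in> I" for i
  proof -
    have "f i = ?e [(i, True)]" "q i = eval_word Q q [(i, True)]"
      using that fI q by (auto simp: eval_letter_def Pi_iff)
    then show ?thesis using h[of "[(i, True)]"] that by simp
  qed
  ultimately show ?thesis by blast
qed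

lemma free_family_free_of_rank:
  fixes k :: nat
  assumes "free_family G {..<k} f"
  shows "free_of_rank (G\<lparr>carrier := generate G (f ` {..<k})\<rparr>) k"
proof -
  let ?K = "generate G (f ` {..<k})"
  have f: "f \<in> {..<k} \<rightarrow> carrier G" and inj: "inj_on (eval_word G f) (carrier (free_group {..<k}))"
    using assms by (auto simp: free_family_def)
  have K: "subgroup ?K G" using f by (intro generate_is_subgroup) auto
  interpret K: group "G\<lparr>carrier := ?K\<rparr>" by (rule subgroup_imp_group[OF K])
  have "eval_word G f \<in> iso (free_group {..<k}) (G\<lparr>carrier := ?K\<rparr>)"
    using eval_word_hom[OF f] eval_word_image[OF f] inj
    by (auto simp: iso_def hom_def bij_betw_def)
  then show ?thesis
    unfolding free_of_rank_def
    using K.group_axioms group.iso_sym[OF group_free_group] by (auto simp: is_iso_def)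
qed

end

section \<open>Residual finiteness and the Hopf property\<close>

text \<open>
  In a finite set the domain and the range of a partial injection have complements of equal size.
\<close>

lemma partial_injection_extends:
  assumes "finite W" "D \<subseteq> W" "g ` D \<subseteq> W" "inj_on g D"
  shows "\<exists>\<sigma> \<in> Bij W. \<forall>u\<in>D. \<sigma> u = g u"
proof -
  have "card (W - D) = card (W - g ` D)"
    using assms by (simp add: card_Diff_subset finite_subset card_image)
  then obtain k where k: "bij_betw k (W - D) (W - g ` D)"
    using assms(1) finite_same_card_bij[of "W - D" "W - g ` D"] by auto
  define \<sigma> where "\<sigma> = (\<lambda>u\<in>W. if u \<in> D then g u else k u)"
  have "bij_betw (\<lambda>u. if u \<in> D then g u else k u) (D \<union> (W - D)) (g ` D \<union> (W - g ` D))"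
    using assms k by (intro bij_betw_disjoint_Un) (auto simp: bij_betw_def)
  moreover have "D \<union> (W - D) = W" "g ` D \<union> (W - g ` D) = W" using assms by auto
  ultimately have "\<sigma> \<in> Bij W"
    by (auto simp: Bij_def \<sigma>_def)
  moreover have "\<forall>u\<in>D. \<sigma> u = g u" using assms by (auto simp: \<sigma>_def)
  ultimately show ?thesis by blast
qed

lemma mult_BijGroup_apply:
  "f \<in> Bij W \<Longrightarrow> g \<in> Bij W \<Longrightarrow> u \<in> W \<Longrightarrow> (f \<otimes>\<^bsub>BijGroup W\<^esub> g) u = f (g u)"
  by (simp add: BijGroup_def compose_def)

lemma finite_words_bounded:
  "finite J \<Longrightarrow> finite {u :: ('a \<times> bool) list. fst ` set u \<subseteq> J \<and> length u \<le> n}"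
  by (rule finite_subset[OF _ finite_lists_length_le[of "J \<times> UNIV" n]]) force+

text \<open>
  Let \<open>W\<close> be the ball of reduced words of length at most that of \<open>w\<close>.  Left multiplication by a
  generator is a partial injection of \<open>W\<close>; any extension of it to a permutation gives an action on
  \<open>W\<close> under which \<open>w\<close> carries the empty word, suffix by suffix, to \<open>w\<close> itself.
\<close>

lemma free_group_residually_finite:
  fixes w :: "('a \<times> bool) list"
  assumes J: "finite J" and w: "reduced w" "fst ` set w \<subseteq> J" "w \<noteq> []"
  shows "\<exists>(Q :: (('a \<times> bool) list \<Rightarrow> ('a \<times> bool) list) monoid) q.
    group Q \<and> finite (carrier Q) \<and> q \<in> J \<rightarrow> carrier Q \<and> eval_word Q q w \<noteq> \<one>\<^bsub>Q\<^esub>"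
proof -
  define W where "W = {u. reduced u \<and> fst ` set u \<subseteq> J \<and> length u \<le> length w}"
  define D where "D x = {u \<in> W. push (x, True) u \<in> W}" for x
  have finW: "finite W"
    by (rule finite_subset[OF _ finite_words_bounded[OF J, of "length w"]]) (auto simp: W_def)
  have "\<exists>\<sigma> \<in> Bij W. \<forall>u\<in>D x. \<sigma> u = push (x, True) u" for x
  proof (rule partial_injection_extends[OF finW])
    show "inj_on (push (x, True)) (D x)"
      by (rule inj_on_inverseI[of _ "push (inv_letter (x, True))"])
        (auto simp: D_def W_def push_inv_letter)
  qed (auto simp: D_def)
  then obtain q where q: "\<And>x. q x \<in> Bij W" "\<And>x u. u \<in> D x \<Longrightarrow> q x u = push (x, True) u"
    by metis
  let ?Q = "BijGroup W"
  interpret Q: group ?Q by (rule group_BijGroup)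
  have carr: "carrier ?Q = Bij W" by (simp add: BijGroup_def)
  have qJ: "q \<in> J \<rightarrow> carrier ?Q" using q by (simp add: carr)
  have letter: "eval_letter ?Q q a v = a # v" if "a # v \<in> W" for a v
  proof -
    have v: "v \<in> W" using that by (auto simp: W_def dest: reduced_ConsD)
    obtain x b where a: "a = (x, b)" by (cases a)
    show ?thesis
    proof (cases b)
      case True
      have "push (x, True) v = a # v" using that True a by (simp add: W_def push_eq_Cons)
      then show ?thesis
        using q(2)[of v x] v that a True by (auto simp: D_def eval_letter_def)
    next
      case False
      have "push (x, True) (a # v) = v" using a False by (simp add: inv_letter_def)
      then have "q x (a # v) = v" using q(2)[of "a # v" x] that v by (auto simp: D_def)
      then have "inv_into W (q x) v = a # v"
        using that q(1)[of x] by (auto simp: Bij_def bij_betw_def intro!: inv_into_f_eq)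
      then show ?thesis
        using a False v by (simp add: eval_letter_def inv_BijGroup[OF q(1)])
    qed
  qed
  have "eval_word ?Q q v [] = v" if "v \<in> W" for v
    using that
  proof (induction v)
    case Nil
    then show ?case by (simp add: BijGroup_def)
  next
    case (Cons a v)
    have v: "v \<in> W" and a: "fst a \<in> J"
      using Cons.prems by (auto simp: W_def dest: reduced_ConsD)
    have "eval_letter ?Q q a \<in> Bij W" "eval_word ?Q q v \<in> Bij W"
      using Q.eval_letter_closed[OF qJ a] Q.eval_word_closed[OF qJ, of v] v
      unfolding carr by (simp_all add: W_def)
    moreover have "[] \<in> W" by (simp add: W_def)
    ultimately have "eval_word ?Q q (a # v) [] = eval_letter ?Q q a (eval_word ?Q q v [])"
      by (simp only: eval_word_simps mult_BijGroup_apply)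
    then show ?case using Cons.IH[OF v] letter[OF Cons.prems] by simp
  qed
  then have "eval_word ?Q q w [] = w" using w by (simp add: W_def)
  moreover have "\<one>\<^bsub>?Q\<^esub> [] = []" by (simp add: BijGroup_def W_def)
  ultimately have "eval_word ?Q q w \<noteq> \<one>\<^bsub>?Q\<^esub>" using w(3) by metis
  moreover have "finite (carrier ?Q)"
    unfolding carr
    by (rule finite_subset[OF _ finite_PiE[OF finW, of "\<lambda>_. W"]])
      (auto simp: Bij_def PiE_def bij_betw_def finW)
  ultimately show ?thesis using qJ Q.group_axioms by blast
qed

text \<open>
  This counting argument underlies both the invariance of rank and the Hopf property.  Choosing for
  every pattern on \<open>A\<close> a function that realises it and recording its values on \<open>B\<close> gives an injection
  from patterns on \<open>A\<close> to patterns on \<open>B\<close>.  If the two index sets have the same size, it is onto.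
\<close>

lemma pattern_count:
  assumes fin: "finite A" "finite B" "finite C"
    and realise: "\<And>e. e \<in> A \<rightarrow> C \<Longrightarrow> \<exists>h\<in>\<H>. \<forall>i\<in>A. h (a i) = e i"
    and determine: "\<And>h h'. h \<in> \<H> \<Longrightarrow> h' \<in> \<H> \<Longrightarrow> \<forall>j\<in>B. h (b j) = h' (b j) \<Longrightarrow>
          \<forall>i\<in>A. h (a i) = h' (a i)"
    and val: "\<And>h j. h \<in> \<H> \<Longrightarrow> j \<in> B \<Longrightarrow> h (b j) \<in> C"
  shows "card C \<ge> 2 \<Longrightarrow> card A \<le> card B"
    and "card A = card B \<Longrightarrow> e \<in> B \<rightarrow> C \<Longrightarrow> \<exists>h\<in>\<H>. \<forall>j\<in>B. h (b j) = e j"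
proof -
  have "\<forall>e \<in> A \<rightarrow>\<^sub>E C. \<exists>h\<in>\<H>. \<forall>i\<in>A. h (a i) = e i" using realise by (simp add: PiE_def)
  then obtain h where h: "\<And>e. e \<in> A \<rightarrow>\<^sub>E C \<Longrightarrow> h e \<in> \<H> \<and> (\<forall>i\<in>A. h e (a i) = e i)"
    by metis
  define \<Theta> where "\<Theta> e = (\<lambda>j\<in>B. h e (b j))" for e
  have sub: "\<Theta> ` (A \<rightarrow>\<^sub>E C) \<subseteq> B \<rightarrow>\<^sub>E C" using h val by (auto simp: \<Theta>_def)
  have inj: "inj_on \<Theta> (A \<rightarrow>\<^sub>E C)"
  proof (rule inj_onI)
    fix e e' assume e: "e \<in> A \<rightarrow>\<^sub>E C" "e' \<in> A \<rightarrow>\<^sub>E C" "\<Theta> e = \<Theta> e'"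
    have "h e (b j) = h e' (b j)" if "j \<in> B" for j
      using fun_cong[OF e(3), of j] that by (simp add: \<Theta>_def)
    then have "\<forall>i\<in>A. h e (a i) = h e' (a i)" using determine h e by blast
    then show "e = e'" using h e by (intro PiE_ext[OF e(1,2)]) auto
  qed
  have finB: "finite (B \<rightarrow>\<^sub>E C)" using fin by (simp add: finite_PiE)
  have cards: "card (A \<rightarrow>\<^sub>E C) = card C ^ card A" "card (B \<rightarrow>\<^sub>E C) = card C ^ card B"
    using fin by (simp_all add: card_PiE)
  have "card (A \<rightarrow>\<^sub>E C) \<le> card (B \<rightarrow>\<^sub>E C)" by (rule card_inj_on_le[OF inj sub finB])
  then show "card C \<ge> 2 \<Longrightarrow> card A \<le> card B"
    unfolding cards using power_le_imp_le_exp by force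
  assume AB: "card A = card B" and e: "e \<in> B \<rightarrow> C"
  have "\<Theta> ` (A \<rightarrow>\<^sub>E C) = B \<rightarrow>\<^sub>E C"
    by (rule card_subset_eq[OF finB sub]) (simp add: card_image[OF inj] cards AB)
  moreover have "restrict e B \<in> B \<rightarrow>\<^sub>E C" using e by auto
  ultimately obtain e' where e': "e' \<in> A \<rightarrow>\<^sub>E C" "\<Theta> e' = restrict e B" by (metis imageE)
  have "h e' (b j) = e j" if "j \<in> B" for j
    using fun_cong[OF e'(2), of j] that by (simp add: \<Theta>_def)
  then show "\<exists>h\<in>\<H>. \<forall>j\<in>B. h (b j) = e j" using h[OF e'(1)] by blast
qed

text \<open>
  The group of order two, written on truth values: patterns of homomorphisms are then just predicates.
\<close>

definition Z2 :: "bool monoid" where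
  "Z2 = \<lparr>carrier = UNIV, monoid.mult = (\<noteq>), one = False\<rparr>"

lemma Z2_simps [simp]: "carrier Z2 = UNIV" "p \<otimes>\<^bsub>Z2\<^esub> q = (p \<noteq> q)" "\<one>\<^bsub>Z2\<^esub> = False"
  by (auto simp: Z2_def)

lemma group_Z2: "group Z2"
  by (rule groupI) auto

lemma hom_Z2_sum: "h \<in> hom G Z2 \<Longrightarrow> h' \<in> hom G Z2 \<Longrightarrow> (\<lambda>g. h g \<noteq> h' g) \<in> hom G Z2"
  by (auto simp: hom_def)

context group
begin

lemma homs_agree_on_generate:
  assumes y: "y \<in> J \<rightarrow> carrier G" and Q: "group Q"
    and h: "h \<in> hom (G\<lparr>carrier := generate G (y ` J)\<rparr>) Q"
      "h' \<in> hom (G\<lparr>carrier := generate G (y ` J)\<rparr>) Q"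
    and eq: "\<forall>j\<in>J. h (y j) = h' (y j)" and k: "k \<in> generate G (y ` J)"
  shows "h k = h' k"
proof -
  have L: "subgroup (generate G (y ` J)) G" using y by (intro generate_is_subgroup) auto
  have yL: "y \<in> J \<rightarrow> generate G (y ` J)" by (auto intro: generate.incl)
  obtain w where w: "fst ` set w \<subseteq> J" "k = eval_word G y w"
    using k unfolding eval_word_image[OF y, symmetric] by auto
  have "eval_word Q (\<lambda>j. h (y j)) w = eval_word Q (\<lambda>j. h' (y j)) w"
    using w eq by (intro eval_word_cong) auto
  then show ?thesis
    using hom_subgroup_eval_word[OF L Q _ yL w(1)] h w(2) by simp
qed

lemma free_family_realises:
  assumes f: "free_family G I f" and Q: "group Q" and "I\<^sub>0 \<subseteq> I" and "e \<in> I\<^sub>0 \<rightarrow> carrier Q"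
  shows "\<exists>h \<in> hom (G\<lparr>carrier := generate G (f ` I)\<rparr>) Q. \<forall>i\<in>I\<^sub>0. h (f i) = e i"
proof -
  have "(\<lambda>i. if i \<in> I\<^sub>0 then e i else \<one>\<^bsub>Q\<^esub>) \<in> I \<rightarrow> carrier Q"
    using assms(4) monoid.one_closed[OF group.is_monoid[OF Q]] by auto
  from free_family_extends_to_hom[OF f Q this] obtain h
    where "h \<in> hom (G\<lparr>carrier := generate G (f ` I)\<rparr>) Q"
      "\<forall>i\<in>I. h (f i) = (if i \<in> I\<^sub>0 then e i else \<one>\<^bsub>Q\<^esub>)" by blast
  then show ?thesis using assms(3) by (intro bexI[of _ h]) auto
qed

text \<open>
  Homomorphisms to the group of order two can be prescribed on the basis and are determined on the
  generators.
\<close>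

lemma free_family_card_le:
  assumes f: "free_family G I f" and y: "y \<in> J \<rightarrow> carrier G" "finite J"
    and gen: "generate G (f ` I) = generate G (y ` J)"
    and I0: "I\<^sub>0 \<subseteq> I" "finite I\<^sub>0"
  shows "card I\<^sub>0 \<le> card J"
proof (rule pattern_count(1)[where C = "UNIV :: bool set" and a = f and b = y
      and \<H> = "hom (G\<lparr>carrier := generate G (y ` J)\<rparr>) Z2"])
  fix e :: "_ \<Rightarrow> bool" assume "e \<in> I\<^sub>0 \<rightarrow> UNIV"
  then show "\<exists>h \<in> hom (G\<lparr>carrier := generate G (y ` J)\<rparr>) Z2. \<forall>i\<in>I\<^sub>0. h (f i) = e i"
    using free_family_realises[OF f group_Z2 I0(1), of e] by (simp add: gen)
next
  fix h h' assume h: "h \<in> hom (G\<lparr>carrier := generate G (y ` J)\<rparr>) Z2"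
    "h' \<in> hom (G\<lparr>carrier := generate G (y ` J)\<rparr>) Z2" "\<forall>j\<in>J. h (y j) = h' (y j)"
  show "\<forall>i\<in>I\<^sub>0. h (f i) = h' (f i)"
  proof
    fix i assume "i \<in> I\<^sub>0"
    then have "f i \<in> generate G (y ` J)"
      unfolding gen[symmetric] using I0 by (intro generate.incl) auto
    then show "h (f i) = h' (f i)" by (rule homs_agree_on_generate[OF y(1) group_Z2 h])
  qed
qed (simp_all add: I0 y)

text \<open>
  Generators that are no more numerous than a basis form one.  By counting, homomorphisms to any finite
  group can be prescribed on the generators \<open>y\<close> as well, so a word that is a relation among the \<open>y j\<close>
  would be a law in all finite groups, which residual finiteness excludes.
\<close>

lemma hopfian_free_family:
  fixes y :: "'j \<Rightarrow> 'a"
  assumes f: "free_family G I f" and y: "y \<in> J \<rightarrow> carrier G" "finite J"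
    and gen: "generate G (f ` I) = generate G (y ` J)"
    and I0: "I\<^sub>0 \<subseteq> I" "finite I\<^sub>0" "card I\<^sub>0 = card J"
  shows "free_family G J y"
  unfolding free_family_iff_kernel
proof (intro conjI allI impI y(1))
  fix w assume w: "reduced w \<and> fst ` set w \<subseteq> J \<and> eval_word G y w = \<one>"
  show "w = []"
  proof (rule ccontr)
    assume "w \<noteq> []"
    have "reduced w" "fst ` set w \<subseteq> J" using w by auto
    from free_group_residually_finite[OF y(2) this \<open>w \<noteq> []\<close>] obtain Q :: "(('j \<times> bool) list \<Rightarrow> ('j \<times> bool) list) monoid" and q
      where Q: "group Q" "finite (carrier Q)" and q: "q \<in> J \<rightarrow> carrier Q"
        and qw: "eval_word Q q w \<noteq> \<one>\<^bsub>Q\<^esub>"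
      by blast
    let ?L = "generate G (y ` J)" let ?H = "hom (G\<lparr>carrier := ?L\<rparr>) Q"
    have L: "subgroup ?L G" using y by (intro generate_is_subgroup) auto
    have yL: "y \<in> J \<rightarrow> ?L" by (auto intro: generate.incl)
    have "\<exists>h\<in>?H. \<forall>j\<in>J. h (y j) = q j"
    proof (rule pattern_count(2)[where C = "carrier Q" and a = f])
      show "\<exists>h\<in>?H. \<forall>i\<in>I\<^sub>0. h (f i) = e i" if "e \<in> I\<^sub>0 \<rightarrow> carrier Q" for e
        using free_family_realises[OF f Q(1) I0(1) that] by (simp add: gen)
    next
      fix h h' assume h: "h \<in> ?H" "h' \<in> ?H" "\<forall>j\<in>J. h (y j) = h' (y j)"
      show "\<forall>i\<in>I\<^sub>0. h (f i) = h' (f i)"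
      proof
        fix i assume "i \<in> I\<^sub>0"
        then have "f i \<in> ?L" unfolding gen[symmetric] using I0 by (intro generate.incl) auto
        then show "h (f i) = h' (f i)" by (rule homs_agree_on_generate[OF y(1) Q(1) h])
      qed
    next
      show "h (y j) \<in> carrier Q" if "h \<in> ?H" "j \<in> J" for h j
        using that yL by (auto simp: hom_def)
    qed (simp_all add: I0 y Q q)
    then obtain h where h: "h \<in> ?H" "\<forall>j\<in>J. h (y j) = q j" by blast
    have "h \<one> = \<one>\<^bsub>Q\<^esub>"
      using hom_one[OF h(1) subgroup_imp_group[OF L] Q(1)] by simp
    moreover have "h (eval_word G y w) = eval_word Q (\<lambda>j. h (y j)) w"
      using w by (intro hom_subgroup_eval_word[OF L Q(1) h(1) yL]) simp
    moreover have "eval_word Q (\<lambda>j. h (y j)) w = eval_word Q q w"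
      using w h(2) by (intro eval_word_cong) auto
    ultimately show False using qw w by simp
  qed
qed

end

section \<open>The Nielsen-Schreier theorem\<close>

text \<open>
  Only the length-lexicographic order that this induces on words matters; \<open>coset_rep\<close> picks its least
  element in a left coset.  This choice makes the set of representatives closed under suffixes, that is,
  a Schreier transversal.
\<close>

definition letter_order :: "(('a::wellorder \<times> bool) \<times> ('a \<times> bool)) set" where
  "letter_order = {(x, y). x < y} <*lex*> {(False, True)}"

lemma wf_lenlex_letter_order: "wf (lenlex letter_order)"
  unfolding letter_order_def by (intro wf_lenlex wf_lex_prod wf) (auto simp: wf_def)

lemma total_lenlex_letter_order: "total (lenlex letter_order)"
  by (rule total_lenlex) (auto simp: total_on_def letter_order_def)

lemma push_lenlex:
  assumes "(u, p) \<in> lenlex r"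
  shows "(push a u, a # p) \<in> lenlex r"
proof (cases "push a u = a # u")
  case True
  then show ?thesis using assms by (simp add: Cons_lenlex_iff)
next
  case False
  then have "length (push a u) < length u" by (cases u) (auto split: if_splits)
  then show ?thesis using lenlex_length[OF assms] by (simp add: lenlex_conv)
qed

definition coset_rep ::
    "'a::wellorder set \<Rightarrow> ('a \<times> bool) list set \<Rightarrow> ('a \<times> bool) list \<Rightarrow> ('a \<times> bool) list" where
  "coset_rep S K g =
    (SOME t. t \<in> g <#\<^bsub>free_group S\<^esub> K \<and>
       (\<forall>u. (u, t) \<in> lenlex letter_order \<longrightarrow> u \<notin> g <#\<^bsub>free_group S\<^esub> K))"

context
  fixes S :: "'a::wellorder set" and K
  assumes K: "subgroup K (free_group S)"
begin

interpretation R: group "free_group S" by (rule group_free_group)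

declare mult_free_group [simp del] in_carrier_free_group [simp del]

abbreviation rep where "rep \<equiv> coset_rep S K"
abbreviation mulF (infixr "\<bullet>" 70) where "u \<bullet> v \<equiv> u \<otimes>\<^bsub>free_group S\<^esub> v"
abbreviation invF where "invF \<equiv> m_inv (free_group S)"
abbreviation car where "car \<equiv> carrier (free_group S)"

lemma letter_in_car: "fst a \<in> S \<Longrightarrow> [a] \<in> car"
  by (simp add: in_carrier_free_group)

lemma Nil_in_car [simp]: "[] \<in> car"
  by (simp add: in_carrier_free_group)

lemma coset_rep_least:
  assumes "g \<in> car"
  shows "rep g \<in> g <#\<^bsub>free_group S\<^esub> K"
    and "(u, rep g) \<in> lenlex letter_order \<Longrightarrow> u \<notin> g <#\<^bsub>free_group S\<^esub> K"
proof -
  have "g \<in> g <#\<^bsub>free_group S\<^esub> K"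
    using assms subgroup.one_closed[OF K] R.r_one[OF assms] unfolding l_coset_def by force
  then have "\<exists>t. t \<in> g <#\<^bsub>free_group S\<^esub> K \<and>
       (\<forall>u. (u, t) \<in> lenlex letter_order \<longrightarrow> u \<notin> g <#\<^bsub>free_group S\<^esub> K)"
    using wfE_min[OF wf_lenlex_letter_order] by metis
  from someI_ex[OF this, folded coset_rep_def]
  show "rep g \<in> g <#\<^bsub>free_group S\<^esub> K"
    and "(u, rep g) \<in> lenlex letter_order \<Longrightarrow> u \<notin> g <#\<^bsub>free_group S\<^esub> K" by auto
qed

lemma coset_rep_closed [simp]: "g \<in> car \<Longrightarrow> rep g \<in> car"
  using coset_rep_least(1) R.l_coset_carrier[OF _ _ K] by blast

lemma coset_rep_eqI:
  assumes "g \<in> car" "h \<in> g <#\<^bsub>free_group S\<^esub> K"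
  shows "rep h = rep g"
  using R.l_repr_independence[OF assms(2,1) K] by (simp add: coset_rep_def)

lemma coset_rep_mult_right: "g \<in> car \<Longrightarrow> k \<in> K \<Longrightarrow> rep (g \<bullet> k) = rep g"
  by (rule coset_rep_eqI) (auto simp: l_coset_def)

lemma coset_rep_decompose:
  assumes "g \<in> car"
  obtains k where "k \<in> K" "rep g = g \<bullet> k"
  using coset_rep_least(1)[OF assms] by (auto simp: l_coset_def)

lemma coset_rep_mult_left [simp]:
  assumes "g \<in> car" "a \<in> car"
  shows "rep (a \<bullet> rep g) = rep (a \<bullet> g)"
proof -
  obtain k where k: "k \<in> K" "rep g = g \<bullet> k" using coset_rep_decompose[OF assms(1)] .
  then have "a \<bullet> rep g = (a \<bullet> g) \<bullet> k"
    using assms subgroup.mem_carrier[OF K] by (simp add: R.m_assoc)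
  then show ?thesis using coset_rep_mult_right[of "a \<bullet> g" k] k assms by simp
qed

lemma coset_rep_idem [simp]: "g \<in> car \<Longrightarrow> rep (rep g) = rep g"
  by (rule coset_rep_eqI[OF _ coset_rep_least(1)])

text \<open>
  Replacing the tail \<open>p\<close> by a smaller element of its coset would make \<open>a # p\<close> smaller in its own.
\<close>

lemma coset_rep_Cons:
  assumes g: "g \<in> car" and t: "rep g = a # p"
  shows "p \<in> car" "rep p = p" "fst a \<in> S" "rep g = [a] \<bullet> p"
proof -
  have ap: "a # p \<in> car" using coset_rep_closed[OF g] t by simp
  then show p: "p \<in> car" and a: "fst a \<in> S"
    by (auto simp: in_carrier_free_group dest: reduced_ConsD)
  show app: "rep g = [a] \<bullet> p"
    using ap t by (simp add: mult_free_group in_carrier_free_group push_eq_Cons)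
  have min: "u \<notin> p <#\<^bsub>free_group S\<^esub> K" if "(u, p) \<in> lenlex letter_order" for u
  proof
    assume "u \<in> p <#\<^bsub>free_group S\<^esub> K"
    then obtain k where k: "k \<in> K" "u = p \<bullet> k" by (auto simp: l_coset_def)
    obtain k' where k': "k' \<in> K" "rep g = g \<bullet> k'" using coset_rep_decompose[OF g] .
    have "push a u = [a] \<bullet> u" by (simp add: mult_free_group)
    also have "\<dots> = rep g \<bullet> k"
      using k p letter_in_car[OF a] subgroup.mem_carrier[OF K] by (simp add: app R.m_assoc)
    also have "\<dots> = g \<bullet> (k' \<bullet> k)"
      using k k' g subgroup.mem_carrier[OF K] by (simp add: R.m_assoc)
    finally have "push a u \<in> g <#\<^bsub>free_group S\<^esub> K"
      using k k' subgroup.m_closed[OF K] by (auto simp: l_coset_def)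
    then show False
      using coset_rep_least(2)[OF g, of "push a u"] push_lenlex[OF that, of a] t by simp
  qed
  have "p \<in> p <#\<^bsub>free_group S\<^esub> K"
    using subgroup.one_closed[OF K] R.r_one[OF p] unfolding l_coset_def by force
  then have "(p, rep p) \<notin> lenlex letter_order" using coset_rep_least(2)[OF p] by blast
  moreover have "(rep p, p) \<notin> lenlex letter_order" using min coset_rep_least(1)[OF p] by blast
  ultimately show "rep p = p"
    using total_lenlex_letter_order by (metis UNIV_I total_on_def)
qed

lemma coset_rep_of_subgroup: "k \<in> K \<Longrightarrow> rep k = []"
proof -
  have "[] \<in> [] <#\<^bsub>free_group S\<^esub> K"
    using subgroup.one_closed[OF K] R.r_one[OF Nil_in_car] unfolding l_coset_def by force
  then have "([], rep []) \<notin> lenlex letter_order" using coset_rep_least(2)[OF Nil_in_car] by blast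
  then have "rep [] = []" by simp
  moreover assume k: "k \<in> K"
  then have "k = [] \<bullet> k" by (simp add: mult_free_group)
  ultimately show ?thesis using coset_rep_mult_right[OF Nil_in_car k] by simp
qed

text \<open>
  The letter \<open>a\<close> labels an edge of the coset graph from the coset of \<open>t\<close> to that of \<open>a t\<close>.  The label is
  the element of \<open>K\<close> picked up when the edge is crossed: down the spanning tree, over the edge, and back.
  Edges of the tree have trivial label; the others, taken in the positive direction, index the basis.
\<close>

definition schreier_label :: "'a \<times> bool \<Rightarrow> ('a \<times> bool) list \<Rightarrow> ('a \<times> bool) list" where
  "schreier_label a t = invF (rep ([a] \<bullet> t)) \<bullet> [a] \<bullet> t"

definition schreier_gen :: "('a \<times> bool) list \<times> 'a \<Rightarrow> ('a \<times> bool) list" where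
  "schreier_gen p = schreier_label (snd p, True) (fst p)"

definition schreier_index :: "(('a \<times> bool) list \<times> 'a) set" where
  "schreier_index = {p. fst p \<in> rep ` car \<and> snd p \<in> S \<and> schreier_gen p \<noteq> []}"

abbreviation FI where "FI \<equiv> free_group schreier_index"

definition rewrite_edge :: "('a \<times> bool) list \<times> 'a \<Rightarrow> ((('a \<times> bool) list \<times> 'a) \<times> bool) list" where
  "rewrite_edge p = (if p \<in> schreier_index then [(p, True)] else [])"

definition rewrite_letter where
  "rewrite_letter a t =
     (if snd a then rewrite_edge (t, fst a) else inv\<^bsub>FI\<^esub> rewrite_edge (rep ([a] \<bullet> t), fst a))"

text \<open>
  The Reidemeister-Schreier rewriting process: \<open>rewrite w g\<close> reads the word \<open>w\<close> from right to left as a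
  path in the coset graph that starts at the coset of \<open>g\<close>, and records the basis elements crossed.
  On \<open>K\<close>, started at the trivial coset, it is a homomorphism inverse to evaluation at the Schreier
  generators, which is what proves them free.
\<close>

fun rewrite :: "('a \<times> bool) list \<Rightarrow> ('a \<times> bool) list \<Rightarrow> ((('a \<times> bool) list \<times> 'a) \<times> bool) list" where
  "rewrite [] g = []"
| "rewrite (a # w) g = rewrite_letter a (rep (foldr push w g)) \<otimes>\<^bsub>FI\<^esub> rewrite w g"

interpretation FI: group FI by (rule group_free_group)

lemma foldr_push_in_car: "fst ` set w \<subseteq> S \<Longrightarrow> g \<in> car \<Longrightarrow> foldr push w g \<in> car"
  by (simp add: in_carrier_free_group reduced_foldr_push letters_foldr_push)

lemma rewrite_edge_closed [simp]: "rewrite_edge p \<in> carrier FI"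
  by (simp add: rewrite_edge_def in_carrier_free_group)

lemma rewrite_letter_closed [simp]: "rewrite_letter a t \<in> carrier FI"
  by (simp add: rewrite_letter_def)

lemma rewrite_closed [simp]: "rewrite w g \<in> carrier FI"
  by (induction w) (simp_all add: in_carrier_free_group[of "[]"])

lemma letter_cancel:
  assumes "fst a \<in> S" "g \<in> car"
  shows "[a] \<bullet> [inv_letter a] \<bullet> g = g" "[inv_letter a] \<bullet> [a] \<bullet> g = g"
proof -
  have "[inv_letter a] = invF [a]" using inv_free_group_letter[OF assms(1)] by simp
  then show "[a] \<bullet> [inv_letter a] \<bullet> g = g" "[inv_letter a] \<bullet> [a] \<bullet> g = g"
    using assms letter_in_car[OF assms(1)] by (simp_all flip: R.m_assoc)
qed

lemma schreier_label_closed: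
  assumes "fst a \<in> S" "t \<in> car"
  shows "schreier_label a t \<in> car"
  using assms letter_in_car[OF assms(1)] by (simp add: schreier_label_def)

lemma schreier_label_inverse:
  assumes a: "fst a \<in> S" and t: "t \<in> car" "rep t = t"
  shows "schreier_label (inv_letter a) (rep ([a] \<bullet> t)) = invF (schreier_label a t)"
proof -
  have l: "[a] \<in> car" "[inv_letter a] \<in> car" using letter_in_car a by auto
  have "rep ([inv_letter a] \<bullet> rep ([a] \<bullet> t)) = t"
    using l t letter_cancel[OF a t(1)] by simp
  moreover have "invF [a] = [inv_letter a]" using inv_free_group_letter[OF a] .
  ultimately show ?thesis
    using l t unfolding schreier_label_def by (simp add: R.inv_mult_group R.m_assoc)
qed

lemma schreier_label_False:
  assumes "x \<in> S" "t \<in> car" "rep t = t"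
  shows "schreier_gen (rep ([(x, False)] \<bullet> t), x) = invF (schreier_label (x, False) t)"
  using schreier_label_inverse[of "(x, False)" t] assms
  by (simp add: schreier_gen_def inv_letter_def)

lemma rewrite_letter_trivial:
  assumes a: "fst a \<in> S" and t: "t \<in> car" "rep t = t" and triv: "schreier_label a t = []"
  shows "rewrite_letter a t = []"
proof -
  have [simp]: "invF [] = []" "inv\<^bsub>FI\<^esub> [] = []" using R.inv_one FI.inv_one by simp_all
  have not_index: "schreier_gen p = [] \<Longrightarrow> p \<notin> schreier_index" for p
    by (simp add: schreier_index_def)
  obtain x b where ab: "a = (x, b)" by (cases a)
  show ?thesis
  proof (cases b)
    case True
    then show ?thesis
      using triv not_index[of "(t, x)"]
      by (simp add: ab rewrite_letter_def rewrite_edge_def schreier_gen_def)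
  next
    case False
    then show ?thesis
      using triv schreier_label_False[of x t] a t not_index[of "(rep ([a] \<bullet> t), x)"]
      by (simp add: ab rewrite_letter_def rewrite_edge_def)
  qed
qed

lemma rewrite_letter_cancel:
  assumes a: "fst a \<in> S" and t: "t \<in> car" "rep t = t"
  shows "rewrite_letter a (rep ([inv_letter a] \<bullet> t)) \<otimes>\<^bsub>FI\<^esub> rewrite_letter (inv_letter a) t = []"
proof -
  have l: "[a] \<in> car" "[inv_letter a] \<in> car" using letter_in_car a by auto
  have return: "rep ([a] \<bullet> rep ([inv_letter a] \<bullet> t)) = t"
    using l t letter_cancel[OF a t(1)] by simp
  show ?thesis
    using return FI.r_inv[OF rewrite_edge_closed] FI.l_inv[OF rewrite_edge_closed]
    by (cases "snd a") (simp_all add: rewrite_letter_def inv_letter_def)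
qed

lemma rewrite_push:
  assumes a: "fst a \<in> S" and w: "fst ` set w \<subseteq> S" and g: "g \<in> car"
  shows "rewrite (push a w) g = rewrite_letter a (rep (foldr push w g)) \<otimes>\<^bsub>FI\<^esub> rewrite w g"
proof (cases "\<exists>v. w = inv_letter a # v")
  case True
  then obtain v where v: "w = inv_letter a # v" by blast
  have vg: "foldr push v g \<in> car" using w v g foldr_push_in_car by auto
  have l: "[inv_letter a] \<in> car" using letter_in_car a by auto
  have "rep (foldr push w g) = rep ([inv_letter a] \<bullet> rep (foldr push v g))"
    using vg l by (simp add: v) (simp add: mult_free_group)
  then have "rewrite_letter a (rep (foldr push w g)) \<otimes>\<^bsub>FI\<^esub>
      rewrite_letter (inv_letter a) (rep (foldr push v g)) = []"
    using rewrite_letter_cancel[OF a coset_rep_closed[OF vg]] vg by simp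
  then have "rewrite_letter a (rep (foldr push w g)) \<otimes>\<^bsub>FI\<^esub> rewrite w g = rewrite v g"
    using FI.l_one[OF rewrite_closed, of v g] by (simp add: v flip: FI.m_assoc)
  then show ?thesis by (simp add: v)
next
  case False
  then have "push a w = a # w" by (cases w) auto
  then show ?thesis by simp
qed

text \<open>
  Paths concatenate: after \<open>v\<close> has been read from \<open>g\<close>, the path of \<open>u\<close> starts at \<open>v g\<close>.
\<close>

lemma rewrite_mult:
  assumes u: "fst ` set u \<subseteq> S" and v: "fst ` set v \<subseteq> S" and g: "g \<in> car"
  shows "rewrite (foldr push u v) g = rewrite u (foldr push v g) \<otimes>\<^bsub>FI\<^esub> rewrite v g"
  using u
proof (induction u)
  case Nil
  then show ?case using FI.l_one[OF rewrite_closed] by simp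
next
  case (Cons a u)
  have "reduced g" using g by (simp add: in_carrier_free_group)
  then have "foldr push (foldr push u v) g = foldr push u (foldr push v g)"
    by (rule foldr_push_assoc)
  then show ?case
    using Cons rewrite_push[of a "foldr push u v" g] letters_foldr_push[of u S v] v g
    by (simp add: FI.m_assoc)
qed

lemma rewrite_coset_rep:
  assumes "fst ` set w \<subseteq> S" "g \<in> car"
  shows "rewrite w (rep g) = rewrite w g"
  using assms(1)
proof (induction w)
  case (Cons a w)
  have "rep (foldr push w (rep g)) = rep (foldr push w g)"
    using Cons.prems
  proof (induction w)
    case (Cons b w)
    have l: "[b] \<in> car" using Cons.prems letter_in_car by auto
    have push: "push b u = [b] \<bullet> u" for u by (simp add: mult_free_group)
    have w: "foldr push w g \<in> car" "foldr push w (rep g) \<in> car"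
      using Cons.prems assms foldr_push_in_car by auto
    have "rep (foldr push w (rep g)) = rep (foldr push w g)" using Cons by simp
    from arg_cong[OF this, of "\<lambda>u. rep ([b] \<bullet> u)"]
    have "rep ([b] \<bullet> foldr push w (rep g)) = rep ([b] \<bullet> foldr push w g)"
      using w l by simp
    then show ?case by (simp add: push)
  qed (use assms in simp)
  then show ?case using Cons by simp
qed simp

lemma schreier_gen_closed: "schreier_gen \<in> schreier_index \<rightarrow> car"
  by (auto simp: schreier_index_def schreier_gen_def intro!: schreier_label_closed)

lemma eval_rewrite_letter:
  assumes a: "fst a \<in> S" and t: "t \<in> car" "rep t = t"
  shows "eval_word (free_group S) schreier_gen (rewrite_letter a t) = schreier_label a t"
proof -
  interpret E: group_hom FI "free_group S" "eval_word (free_group S) schreier_gen"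
    using R.eval_word_hom[OF schreier_gen_closed] by unfold_locales
  have edge: "eval_word (free_group S) schreier_gen (rewrite_edge p) = schreier_gen p"
    if "fst p \<in> rep ` car" "snd p \<in> S" for p
  proof -
    have "schreier_gen p \<in> car"
      using that by (auto simp: schreier_gen_def intro!: schreier_label_closed)
    then show ?thesis
      using that R.r_one by (auto simp: rewrite_edge_def eval_letter_def schreier_index_def)
  qed
  obtain x b where ab: "a = (x, b)" by (cases a)
  have l: "[a] \<in> car" using letter_in_car a by auto
  show ?thesis
  proof (cases b)
    case True
    have "t \<in> rep ` car" using t by force
    then show ?thesis
      using True edge[of "(t, x)"] a by (simp add: ab rewrite_letter_def schreier_gen_def)
  next
    case False
    have "rep ([a] \<bullet> t) \<in> rep ` car" using l t by auto
    then have "eval_word (free_group S) schreier_gen (rewrite_letter a t)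
        = invF (schreier_gen (rep ([a] \<bullet> t), x))"
      using False edge[of "(rep ([a] \<bullet> t), x)"] a E.hom_inv[OF rewrite_edge_closed]
      by (simp add: ab rewrite_letter_def)
    then show ?thesis
      using schreier_label_False[of x t] schreier_label_closed[OF a t(1)] a t False
      by (simp add: ab)
  qed
qed

text \<open>
  The labels along the path telescope.  For \<open>w \<in> K\<close> the representative is empty and the value is \<open>w\<close>.
\<close>

lemma eval_rewrite:
  assumes "w \<in> car"
  shows "eval_word (free_group S) schreier_gen (rewrite w []) = invF (rep w) \<bullet> w"
  using assms
proof (induction w)
  case Nil
  have "rep [] = []" using coset_rep_of_subgroup subgroup.one_closed[OF K] by simp
  then show ?case using R.l_inv[OF Nil_in_car] by simp
next
  interpret E: group_hom FI "free_group S" "eval_word (free_group S) schreier_gen"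
    using R.eval_word_hom[OF schreier_gen_closed] by unfold_locales
  case (Cons a w)
  have w: "w \<in> car" and a: "fst a \<in> S" and aw: "a # w = [a] \<bullet> w" and red: "reduced w"
    using Cons.prems
    by (auto simp: in_carrier_free_group mult_free_group push_eq_Cons dest: reduced_ConsD)
  have l: "[a] \<in> car" using letter_in_car a by auto
  have "eval_word (free_group S) schreier_gen (rewrite (a # w) [])
      = schreier_label a (rep w) \<bullet> (invF (rep w) \<bullet> w)"
    using eval_rewrite_letter[OF a, of "rep w"] Cons.IH[OF w] w
    by (simp add: foldr_push_Nil[OF red])
  also have "\<dots> = invF (rep (a # w)) \<bullet> [a] \<bullet> rep w \<bullet> invF (rep w) \<bullet> w"
    unfolding schreier_label_def using w l by (simp add: aw R.m_assoc)
  also have "rep w \<bullet> invF (rep w) \<bullet> w = w"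
    using w R.l_one[OF w] by (simp flip: R.m_assoc)
  also have "[a] \<bullet> w = a # w" by (rule aw[symmetric])
  finally show ?case .
qed

text \<open>
  By closure under suffixes, the path of a representative runs inside the spanning tree.
\<close>

lemma rewrite_coset_rep_trivial:
  assumes "t \<in> car" "rep t = t"
  shows "rewrite t [] = []"
  using assms
proof (induction t)
  case (Cons a p)
  note c = coset_rep_Cons[OF Cons.prems]
  have "reduced p" using c(1) by (simp add: in_carrier_free_group)
  moreover have "schreier_label a p = []"
    using R.l_inv[OF Cons.prems(1)] c(4) Cons.prems by (simp add: schreier_label_def)
  ultimately show ?case
    using Cons.IH[OF c(1,2)] rewrite_letter_trivial[OF c(3,1,2)] c(2)
    by (simp add: foldr_push_Nil mult_free_group)
qed simp

text \<open>
  The path of a Schreier generator runs through the tree except for the one edge that it belongs to.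
\<close>

lemma rewrite_schreier_gen:
  assumes p: "p \<in> schreier_index"
  shows "rewrite (schreier_gen p) [] = [(p, True)]"
proof -
  obtain t x where tx: "p = (t, x)" by (cases p)
  have t: "t \<in> car" "rep t = t" and x: "x \<in> S" using p by (auto simp: schreier_index_def tx)
  let ?a = "(x, True)"
  have l: "[?a] \<in> car" using letter_in_car x by auto
  define t' where "t' = rep ([?a] \<bullet> t)"
  have t': "t' \<in> car" "rep t' = t'" using l t by (simp_all add: t'_def)
  have S: "fst ` set u \<subseteq> S" and foldr: "foldr push u [] = u" if "u \<in> car" for u
    using that by (auto simp: in_carrier_free_group foldr_push_Nil)
  have it': "invF t' \<in> car" using t' by simp
  have at: "[?a] \<bullet> t \<in> car" using l t by simp
  have "rewrite (invF t' \<bullet> t') [] = rewrite (invF t') t' \<otimes>\<^bsub>FI\<^esub> rewrite t' []"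
    using rewrite_mult[OF S[OF it'] S[OF t'(1)] Nil_in_car]
    by (simp add: mult_free_group foldr[OF t'(1)])
  then have "rewrite (invF t') t' = []"
    using rewrite_coset_rep_trivial[OF t'] FI.r_one[OF rewrite_closed] t' by simp
  then have 1: "rewrite (invF t') ([?a] \<bullet> t) = []"
    using rewrite_coset_rep[OF S[OF it'] at] by (simp add: t'_def)
  have "rewrite ([?a] \<bullet> t) [] = rewrite_letter ?a t"
    using rewrite_push[of ?a t "[]"] x S[OF t(1)] foldr[OF t(1)] t rewrite_coset_rep_trivial[OF t]
      FI.r_one[OF rewrite_letter_closed] by (simp add: mult_free_group)
  also have "\<dots> = [(p, True)]" using p by (simp add: rewrite_letter_def rewrite_edge_def tx)
  finally have 2: "rewrite ([?a] \<bullet> t) [] = [(p, True)]" .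
  have "schreier_gen p = invF t' \<bullet> ([?a] \<bullet> t)"
    by (simp add: schreier_gen_def schreier_label_def t'_def tx)
  then have "rewrite (schreier_gen p) [] = rewrite (invF t') ([?a] \<bullet> t) \<otimes>\<^bsub>FI\<^esub> rewrite ([?a] \<bullet> t) []"
    using rewrite_mult[OF S[OF it'] S[OF at] Nil_in_car] foldr[OF at]
    by (simp add: mult_free_group)
  then show ?thesis unfolding 1 2 by (simp add: mult_free_group)
qed

lemma schreier_gen_in_subgroup: "schreier_gen \<in> schreier_index \<rightarrow> K"
proof
  fix p assume p: "p \<in> schreier_index"
  then have g: "fst p \<in> car" "[(snd p, True)] \<in> car"
    by (auto simp: schreier_index_def intro!: letter_in_car)
  let ?g = "[(snd p, True)] \<bullet> fst p"
  have gc: "?g \<in> car" using g by simp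
  then obtain k where k: "k \<in> K" "rep ?g = ?g \<bullet> k" by (rule coset_rep_decompose)
  have kc: "k \<in> car" using k subgroup.mem_carrier[OF K] by simp
  have "schreier_gen p = invF (?g \<bullet> k) \<bullet> ?g"
    by (simp only: schreier_gen_def schreier_label_def k(2))
  also have "\<dots> = invF k \<bullet> (invF ?g \<bullet> ?g)"
    using gc kc by (simp only: R.inv_mult_group R.m_assoc R.inv_closed R.m_closed)
  also have "\<dots> = invF k" using gc kc R.r_one[of "invF k"] by simp
  finally show "schreier_gen p \<in> K" using subgroup.m_inv_closed[OF K k(1)] by simp
qed

text \<open>
  Evaluation followed by rewriting is an endomorphism of the free group on the index set that fixes
  the generators, hence the identity; so evaluation is injective.
\<close>

lemma schreier_generators_free: "free_family (free_group S) schreier_index schreier_gen"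
  unfolding R.free_family_iff_kernel
proof (intro conjI allI impI schreier_gen_closed)
  let ?e = "eval_word (free_group S) schreier_gen"
  fix w assume w: "reduced w \<and> fst ` set w \<subseteq> schreier_index \<and> ?e w = \<one>\<^bsub>free_group S\<^esub>"
  have eK: "?e u \<in> K" if "u \<in> carrier FI" for u
    using R.eval_word_in_subgroup[OF K schreier_gen_in_subgroup] that
    by (simp add: in_carrier_free_group)
  have "(\<lambda>u. rewrite (?e u) []) \<in> hom FI FI"
  proof (rule homI)
    fix u v assume u: "u \<in> carrier FI" and v: "v \<in> carrier FI"
    have S: "fst ` set (?e u) \<subseteq> S" "fst ` set (?e v) \<subseteq> S" and red: "foldr push (?e v) [] = ?e v"
      using subgroup.mem_carrier[OF K eK] u v by (auto simp: in_carrier_free_group foldr_push_Nil)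
    have "rewrite (?e u \<bullet> ?e v) [] = rewrite (?e u) (?e v) \<otimes>\<^bsub>FI\<^esub> rewrite (?e v) []"
      using rewrite_mult[OF S Nil_in_car] red by (simp add: mult_free_group)
    moreover have "rewrite (?e u) (?e v) = rewrite (?e u) []"
      using rewrite_coset_rep[OF S(1) subgroup.mem_carrier[OF K eK[OF v]]]
        coset_rep_of_subgroup[OF eK[OF v]] by simp
    ultimately show "rewrite (?e (u \<otimes>\<^bsub>FI\<^esub> v)) [] = rewrite (?e u) [] \<otimes>\<^bsub>FI\<^esub> rewrite (?e v) []"
      using R.eval_word_hom[OF schreier_gen_closed] u v by (simp add: hom_def)
  qed simp
  moreover have "rewrite (?e [(p, True)]) [] = [(p, True)]" if "p \<in> schreier_index" for p
  proof -
    have "?e [(p, True)] = schreier_gen p"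
      using that schreier_gen_closed R.r_one by (auto simp: eval_letter_def Pi_iff)
    then show ?thesis using rewrite_schreier_gen[OF that] by simp
  qed
  moreover have wFI: "w \<in> carrier FI" using w by (simp add: in_carrier_free_group)
  moreover have "(\<lambda>p. [(p, True)]) \<in> schreier_index \<rightarrow> carrier FI"
    by (auto simp: in_carrier_free_group)
  ultimately have "rewrite (?e w) [] = eval_word FI (\<lambda>p. [(p, True)]) w"
    by (intro FI.hom_free_group_eq_eval_word)
  also have "\<dots> = w" by (rule eval_word_free_group_generators[OF wFI])
  finally show "w = []" using w by simp
qed

lemma schreier_generators_generate: "generate (free_group S) (schreier_gen ` schreier_index) = K"
proof
  show "generate (free_group S) (schreier_gen ` schreier_index) \<subseteq> K"
    using schreier_gen_in_subgroup by (intro R.generate_subgroup_incl[OF _ K]) auto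
  show "K \<subseteq> generate (free_group S) (schreier_gen ` schreier_index)"
  proof
    fix k assume k: "k \<in> K"
    have "k = eval_word (free_group S) schreier_gen (rewrite k [])"
      using eval_rewrite[OF subgroup.mem_carrier[OF K k]] coset_rep_of_subgroup[OF k]
        R.inv_one by (simp add: mult_free_group)
    then show "k \<in> generate (free_group S) (schreier_gen ` schreier_index)"
      unfolding R.eval_word_image[OF schreier_gen_closed, symmetric]
      using rewrite_closed by blast
  qed
qed

end

text \<open>
  The basis may be infinite; the dichotomy in the main theorem depends on which case occurs.
\<close>

theorem Nielsen_Schreier:
  fixes S :: "'a::wellorder set"
  assumes "subgroup K (free_group S)"
  shows "\<exists>(I :: (('a \<times> bool) list \<times> 'a) set) f.
    free_family (free_group S) I f \<and> generate (free_group S) (f ` I) = K"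
  using schreier_generators_free[OF assms] schreier_generators_generate[OF assms] by blast

lemma (in group) subgroups_of_embedded_free_group:
  fixes S :: "'s::wellorder set"
  assumes j: "j \<in> hom (free_group S) G" "inj_on j (carrier (free_group S))"
    and L: "subgroup L G" "L \<subseteq> j ` carrier (free_group S)"
  shows "\<exists>(I :: (('s \<times> bool) list \<times> 's) set) f. free_family G I f \<and> generate G (f ` I) = L"
proof -
  let ?R = "free_group S"
  note [simp del] = mult_free_group in_carrier_free_group
  interpret R: group ?R by (rule group_free_group)
  interpret j: group_hom ?R G j using j by unfold_locales
  let ?L = "{w \<in> carrier ?R. j w \<in> L}"
  have "subgroup ?L ?R"
    by (rule R.subgroupI)
      (use L in \<open>auto simp: subgroup.m_closed subgroup.m_inv_closed subgroup.one_closed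
        intro!: exI[of _ "\<one>\<^bsub>?R\<^esub>"] simp del: one_free_group\<close>)
  then obtain I :: "(('s \<times> bool) list \<times> 's) set" and f
    where f: "free_family ?R I f" "generate ?R (f ` I) = ?L"
    using Nielsen_Schreier by blast
  have "free_family G I (\<lambda>i. j (f i))"
    by (rule R.free_family_inj_hom[OF is_group j f(1)])
  moreover have "generate G ((\<lambda>i. j (f i)) ` I) = j ` ?L"
    using j.generate_img[of "f ` I"] f by (auto simp: free_family_def image_image)
  moreover have "j ` ?L = L" using L(2) by auto
  ultimately show ?thesis by metis
qed

section \<open>Generating pairs and conjugates by a stable letter\<close>

context group
begin

lemma conjugation_hom: "c \<in> carrier G \<Longrightarrow> (\<lambda>k. c \<otimes> k \<otimes> inv c) \<in> hom G G"
proof (rule homI)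
  fix k l assume "c \<in> carrier G" "k \<in> carrier G" "l \<in> carrier G"
  then show "c \<otimes> (k \<otimes> l) \<otimes> inv c = c \<otimes> k \<otimes> inv c \<otimes> (c \<otimes> l \<otimes> inv c)"
    by (simp add: m_assoc inv_solve_left)
qed simp

lemma conj_translate:
  fixes i n :: int
  assumes "s \<in> carrier G" "x \<in> carrier G"
  shows "s [^] n \<otimes> (s [^] i \<otimes> x \<otimes> inv (s [^] i)) \<otimes> inv (s [^] n)
    = s [^] (i + n) \<otimes> x \<otimes> inv (s [^] (i + n))"
  using assms by (simp add: add.commute[of i] int_pow_mult inv_mult_group m_assoc)

lemma conj_generate_translates:
  fixes n :: int
  assumes s: "s \<in> carrier G" and x: "x \<in> carrier G"
  defines "y \<equiv> \<lambda>i::int. s [^] i \<otimes> x \<otimes> inv (s [^] i)"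
  assumes k: "k \<in> generate G (range y)"
  shows "s [^] n \<otimes> k \<otimes> inv (s [^] n) \<in> generate G (range y)"
proof -
  interpret c: group_hom G G "\<lambda>k. s [^] n \<otimes> k \<otimes> inv (s [^] n)"
    using conjugation_hom[of "s [^] n"] s by unfold_locales auto
  have "range y \<subseteq> carrier G" using s x by (auto simp: y_def)
  note img = c.generate_img[OF this]
  have "(\<lambda>k. s [^] n \<otimes> k \<otimes> inv (s [^] n)) ` range y \<subseteq> range y"
    unfolding y_def using conj_translate[OF s x, of n] by blast
  from mono_generate[OF this]
  have "(\<lambda>k. s [^] n \<otimes> k \<otimes> inv (s [^] n)) ` generate G (range y) \<subseteq> generate G (range y)"
    unfolding img .
  then show ?thesis using k by blast
qed

text \<open>
  The shift on translates is induced by an endomorphism of the subgroup that they generate.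
\<close>

lemma conjugation_shifts_translates:
  fixes n :: int
  assumes s: "s \<in> carrier G" and x: "x \<in> carrier G"
  defines "y \<equiv> \<lambda>i::int. s [^] i \<otimes> x \<otimes> inv (s [^] i)"
  shows "\<exists>\<sigma> \<in> hom (G\<lparr>carrier := generate G (range y)\<rparr>) (G\<lparr>carrier := generate G (range y)\<rparr>).
    \<forall>i. \<sigma> (y i) = y (i + n)"
proof (intro bexI[of _ "\<lambda>k. s [^] n \<otimes> k \<otimes> inv (s [^] n)"] allI)
  let ?c = "\<lambda>k. s [^] n \<otimes> k \<otimes> inv (s [^] n)"
  show "?c (y i) = y (i + n)" for i unfolding y_def by (rule conj_translate[OF s x])
  have yc: "range y \<subseteq> carrier G" using s x by (auto simp: y_def)
  have "s [^] n \<in> carrier G" using s by simp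
  from hom_mult[OF conjugation_hom[OF this]]
  show "?c \<in> hom (G\<lparr>carrier := generate G (range y)\<rparr>) (G\<lparr>carrier := generate G (range y)\<rparr>)"
    using conj_generate_translates[OF s x, of _ n] generate_in_carrier[OF yc]
    by (intro homI) (simp_all add: y_def)
qed

text \<open>
  Powers of \<open>s\<close> can be moved to the right past translates of \<open>x\<close>, at the cost of shifting them.
\<close>

lemma generate_pair_normal_form:
  assumes s: "s \<in> carrier G" and x: "x \<in> carrier G"
  defines "y \<equiv> \<lambda>i::int. s [^] i \<otimes> x \<otimes> inv (s [^] i)"
  shows "generate G {s, x} = {k \<otimes> s [^] n | k n. k \<in> generate G (range y) \<and> n \<in> (UNIV :: int set)}"
    (is "_ = ?N")
proof
  let ?K = "generate G (range y)"
  have K: "subgroup ?K G" using s x by (intro generate_is_subgroup) (auto simp: y_def)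
  have conj: "s [^] n \<otimes> k \<otimes> inv (s [^] n) \<in> ?K" if "k \<in> ?K" for k and n :: int
    using conj_generate_translates[OF s x] that unfolding y_def by blast
  note Kc = subgroup.mem_carrier[OF K]
  have "subgroup ?N G"
  proof (rule subgroupI)
    show "?N \<subseteq> carrier G" using Kc s by auto
    show "?N \<noteq> {}" using subgroup.one_closed[OF K] by blast
  next
    fix g assume "g \<in> ?N"
    then obtain k and n :: int where k: "k \<in> ?K" and g: "g = k \<otimes> s [^] n" by blast
    have "inv g = (s [^] (- n) \<otimes> inv k \<otimes> inv (s [^] (- n))) \<otimes> s [^] (- n)"
      using Kc[OF k] s by (simp add: g inv_mult_group int_pow_neg m_assoc)
    then show "inv g \<in> ?N" using conj[OF subgroup.m_inv_closed[OF K k]] by blast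
  next
    fix g g' assume "g \<in> ?N" "g' \<in> ?N"
    then obtain k k' and n n' :: int where k: "k \<in> ?K" "k' \<in> ?K"
      and g: "g = k \<otimes> s [^] n" "g' = k' \<otimes> s [^] n'" by blast
    have "g \<otimes> g' = k \<otimes> (s [^] n \<otimes> k' \<otimes> inv (s [^] n)) \<otimes> s [^] (n + n')"
      using Kc[OF k(1)] Kc[OF k(2)] s
      by (simp add: g m_assoc int_pow_mult) (simp flip: m_assoc)
    then show "g \<otimes> g' \<in> ?N" using subgroup.m_closed[OF K k(1) conj[OF k(2)]] by blast
  qed
  moreover have "s = \<one> \<otimes> s [^] (1::int)" using s by simp
  moreover have "x = y 0 \<otimes> s [^] (0::int)" using s x by (simp add: y_def)
  ultimately show "generate G {s, x} \<subseteq> ?N"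
    using subgroup.one_closed[OF K] generate.incl[of "y 0" "range y" G]
    by (intro generate_subgroup_incl) blast+
  have H: "subgroup (generate G {s, x}) G" using s x by (intro generate_is_subgroup) auto
  have sH: "s [^] n \<in> generate G {s, x}" for n :: int
    using subgroup_int_pow_closed[OF H] generate.incl[of s "{s, x}" G] by simp
  have "range y \<subseteq> generate G {s, x}"
    using sH generate.incl[of x "{s, x}" G]
    by (auto simp: y_def intro!: subgroup.m_closed[OF H] subgroup.m_inv_closed[OF H])
  then have "?K \<subseteq> generate G {s, x}" by (rule generate_subgroup_incl[OF _ H])
  then show "?N \<subseteq> generate G {s, x}" using sH subgroup.m_closed[OF H] by auto
qed

text \<open>
  Apply the normal form inside the free group on two letters: a word \<open>w\<close> is \<open>u(b\<^sub>i) a\<^sup>n\<close> with \<open>u\<close> a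
  reduced word in the translates \<open>b\<^sub>i = a\<^sup>i b a\<^sup>-\<^sup>i\<close>.  If the value of \<open>w\<close> in \<open>G\<close> is trivial, then \<open>p\<close>
  forces \<open>n = 0\<close>, and freeness of the translates of \<open>x\<close> forces \<open>u\<close>, and so \<open>w\<close>, to be empty.
\<close>

lemma free_pair_of_free_translates:
  assumes s: "s \<in> carrier G" and x: "x \<in> carrier G"
    and p: "p \<in> hom G integer_group" "p x = 0" "p s \<noteq> 0"
    and free: "free_family G UNIV (\<lambda>i::int. s [^] i \<otimes> x \<otimes> inv (s [^] i))"
  shows "free_family G {..<2::nat} (\<lambda>i. if i = 0 then s else x)"
  unfolding free_family_iff_kernel
proof (intro conjI allI impI)
  let ?f = "\<lambda>i::nat. if i = 0 then s else x"
  show f: "?f \<in> {..<2} \<rightarrow> carrier G" using s x by auto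
  fix w assume w: "reduced w \<and> fst ` set w \<subseteq> {..<2} \<and> eval_word G ?f w = \<one>"
  let ?R = "free_group {..<2::nat}"
  interpret R: group ?R by (rule group_free_group)
  interpret E: group_hom ?R G "eval_word G ?f" using eval_word_hom[OF f] by unfold_locales
  interpret p: group_hom G integer_group p
    using p by (simp add: group_hom_def group_hom_axioms_def is_group)
  define a b where "a = [(0::nat, True)]" and "b = [(1::nat, True)]"
  have ab: "a \<in> carrier ?R" "b \<in> carrier ?R" by (auto simp: a_def b_def)
  have Eab: "eval_word G ?f a = s" "eval_word G ?f b = x"
    using s x by (simp_all add: a_def b_def eval_letter_def)
  define Y where "Y i = a [^]\<^bsub>?R\<^esub> i \<otimes>\<^bsub>?R\<^esub> b \<otimes>\<^bsub>?R\<^esub> inv\<^bsub>?R\<^esub> (a [^]\<^bsub>?R\<^esub> i)" for i :: int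
  have Y: "Y \<in> UNIV \<rightarrow> carrier ?R" using ab by (auto simp: Y_def simp del: mult_free_group in_carrier_free_group)
  have EY: "eval_word G ?f (Y i) = s [^] i \<otimes> x \<otimes> inv (s [^] i)" for i
    using ab Eab by (simp add: Y_def E.hom_int_pow del: mult_free_group in_carrier_free_group)
  have wR: "w \<in> carrier ?R" using w by simp
  have gen: "generate ?R {a, b} = carrier ?R"
  proof -
    have "(\<lambda>x. [(x, True)]) ` {..<2::nat} = {a, b}"
      by (auto simp: a_def b_def numeral_2_eq_2 lessThan_Suc)
    moreover have "eval_word ?R (\<lambda>x. [(x, True)]) ` carrier ?R = carrier ?R"
      by (rule trans[OF image_cong[OF refl eval_word_free_group_generators] image_ident])
    moreover have "(\<lambda>x. [(x, True)]) \<in> {..<2::nat} \<rightarrow> carrier ?R" by auto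
    ultimately show ?thesis using R.eval_word_image by metis
  qed
  have "w \<in> generate ?R {a, b}" using gen wR by simp
  then obtain k and n :: int where k: "k \<in> generate ?R (range Y)" and wk: "w = k \<otimes>\<^bsub>?R\<^esub> a [^]\<^bsub>?R\<^esub> n"
    unfolding R.generate_pair_normal_form[OF ab] Y_def by blast
  obtain u where u: "reduced u" and ku: "k = eval_word ?R Y u"
    using k unfolding R.eval_word_image[OF Y, symmetric] by auto
  let ?y = "\<lambda>i::int. s [^] i \<otimes> x \<otimes> inv (s [^] i)"
  have kR: "k \<in> carrier ?R" unfolding ku by (rule R.eval_word_closed[OF Y]) simp
  have Ek: "eval_word G ?f k = eval_word G ?y u"
    unfolding ku using R.hom_eval_word[OF is_group E.homh Y] by (simp add: EY)
  have yc: "?y \<in> UNIV \<rightarrow> carrier G" using s x by auto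
  have Ekc: "eval_word G ?y u \<in> carrier G" by (rule eval_word_closed[OF yc]) simp
  have one: "\<one> = eval_word G ?y u \<otimes> s [^] n"
    using w wk Ek kR ab E.hom_mult[OF kR R.int_pow_closed[OF ab(1)]]
    by (simp add: E.hom_int_pow Eab del: mult_free_group in_carrier_free_group)
  have "p (eval_word G ?y u) = eval_word integer_group (\<lambda>i. p (?y i)) u"
    using hom_eval_word[OF group_integer_group p(1) yc] by simp
  also have "\<dots> = 0"
  proof -
    have "p (?y i) = 0" for i using s x p by (simp del: int_pow_closed add: int_pow_closed)
    then show ?thesis by (induction u) (auto simp: eval_letter_def)
  qed
  finally have "n * p s = 0"
    using arg_cong[OF one, of p] Ekc s by (simp add: p.hom_int_pow)
  then have n: "n = 0" using p by simp
  then have "eval_word G ?y u = \<one>" using one Ekc s by simp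
  then have "u = []" using free u unfolding free_family_iff_kernel by simp
  then show "w = []" using wk ku n by simp
qed

lemma generate_pair_eqI:
  assumes "a \<in> carrier G" "b \<in> carrier G"
    and "a' \<in> generate G {a, b}" "b' \<in> generate G {a, b}"
    and "a \<in> generate G {a', b'}" "b \<in> generate G {a', b'}"
  shows "generate G {a, b} = generate G {a', b'}"
proof -
  have H: "subgroup (generate G {a, b}) G" using assms by (intro generate_is_subgroup) auto
  have "{a', b'} \<subseteq> carrier G" using subgroup.subset[OF H] assms by auto
  then have "subgroup (generate G {a', b'}) G" by (rule generate_is_subgroup)
  then show ?thesis using assms H by (intro equalityI generate_subgroup_incl) auto
qed

text \<open>
  Replace \<open>(a, b)\<close> by \<open>(b, a b\<^sup>-\<^sup>q)\<close> with \<open>q\<close> the integer quotient of \<open>p a\<close> by \<open>p b\<close>, until \<open>p b = 0\<close>.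
\<close>

lemma euclid_on_generating_pair:
  assumes p: "p \<in> hom G integer_group" and ab: "a \<in> carrier G" "b \<in> carrier G"
  shows "\<exists>s\<in>carrier G. \<exists>x\<in>carrier G. generate G {a, b} = generate G {s, x} \<and> p x = 0 \<and> p s \<ge> 0"
  using ab
proof (induction "nat \<bar>p b\<bar>" arbitrary: a b rule: less_induct)
  case less
  interpret p: group_hom G integer_group p
    using p by (simp add: group_hom_def group_hom_axioms_def is_group)
  note ab = less.prems
  show ?case
  proof (cases "p b = 0")
    case True
    show ?thesis
    proof (cases "p a \<ge> 0")
      case False
      have "generate G {a, b} = generate G {inv a, b}"
      proof (rule generate_pair_eqI[OF ab])
        have "inv (inv a) \<in> generate G {inv a, b}" by (rule generate.inv) simp
        then show "a \<in> generate G {inv a, b}" using ab by simp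
      qed (auto intro: generate.incl generate.inv)
      then show ?thesis using ab True False
        by (intro bexI[of _ "inv a"] bexI[of _ b]) (auto simp: p.hom_inv)
    qed (use ab True in auto)
  next
    case False
    define q where "q = p a div p b"
    define c where "c = a \<otimes> b [^] (- q)"
    have c: "c \<in> carrier G" using ab by (simp add: c_def)
    have pc: "p c = p a mod p b"
      using ab by (simp add: c_def p.hom_int_pow q_def minus_mult_div_eq_mod mult.commute)
    have "\<bar>p c\<bar> < \<bar>p b\<bar>" using False by (simp add: pc abs_mod_less)
    then have "nat \<bar>p c\<bar> < nat \<bar>p b\<bar>" by simp
    from less.hyps[OF this ab(2) c]
    obtain s x where sx: "s \<in> carrier G" "x \<in> carrier G" "generate G {b, c} = generate G {s, x}"
      "p x = 0" "p s \<ge> 0" by blast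
    have pow: "b [^] k \<in> generate G {u, b}" if "u \<in> carrier G" for u and k :: int
      using subgroup_int_pow_closed[OF generate_is_subgroup[of "{u, b}"]] that ab
      by (simp add: generate.incl)
    have "generate G {a, b} = generate G {b, c}"
    proof (rule generate_pair_eqI[OF ab])
      show "c \<in> generate G {a, b}" unfolding c_def
        using pow[OF ab(1)] by (auto intro: generate.eng generate.incl)
      have "a = c \<otimes> b [^] q" using ab by (simp add: c_def m_assoc flip: int_pow_mult)
      moreover have "c \<otimes> b [^] q \<in> generate G {c, b}"
        using pow[OF c] by (auto intro: generate.eng generate.incl)
      ultimately show "a \<in> generate G {b, c}" by (simp add: insert_commute)
    qed (auto intro: generate.incl)
    then show ?thesis using sx by auto
  qed
qed

end

section \<open>Independence of translates in an infinitely generated kernel\<close>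

context group
begin

text \<open>
  Here \<open>x\<close> is a bi-infinite sequence whose shifts extend to endomorphisms of the group \<open>K\<close> that it
  generates, and \<open>K\<close> is free of infinite rank.  Suppose that
  every homomorphism to the group of order two that vanishes on \<open>n\<close> consecutive terms also vanishes on
  the two adjacent ones.  Then these homomorphisms are determined by their values on \<open>n\<close> terms, and
  there are too few of them for an infinite basis.  So patterns on windows can be extended one term at a
  time, and every pattern occurs.  By counting, a window generates a subgroup whose rank is at least its
  length, and the Hopf property applies.
\<close>

lemma translates_free_if_infinite_rank:
  fixes x :: "int \<Rightarrow> 'a" and f :: "'i \<Rightarrow> 'a"
  assumes x: "x \<in> UNIV \<rightarrow> carrier G"
  defines "K \<equiv> generate G (range x)"
  assumes shift: "\<And>n::int. \<exists>\<sigma> \<in> hom (G\<lparr>carrier := K\<rparr>) (G\<lparr>carrier := K\<rparr>). \<forall>i. \<sigma> (x i) = x (i + n)"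
    and subgroups_free: "\<And>L. subgroup L G \<Longrightarrow> L \<subseteq> K \<Longrightarrow>
      \<exists>(I :: 'i set) f. free_family G I f \<and> generate G (f ` I) = L"
    and f: "free_family G I f" "generate G (f ` I) = K" "infinite I"
  shows "free_family G UNIV x"
proof -
  let ?H = "hom (G\<lparr>carrier := K\<rparr>) Z2"
  have xK: "x i \<in> K" for i by (auto simp: K_def intro: generate.incl)
  have shift_hom: "\<exists>h'\<in>?H. \<forall>i. h' (x i) = h (x (i + n))" if h: "h \<in> ?H" for h n
  proof -
    obtain \<sigma> where \<sigma>: "\<sigma> \<in> hom (G\<lparr>carrier := K\<rparr>) (G\<lparr>carrier := K\<rparr>)" "\<forall>i. \<sigma> (x i) = x (i + n)"
      using shift by blast
    have "(\<lambda>k. h (\<sigma> k)) \<in> ?H" using \<sigma>(1) h by (auto simp: hom_def Pi_iff)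
    then show ?thesis using \<sigma>(2) by (intro bexI[of _ "\<lambda>k. h (\<sigma> k)"]) auto
  qed
  have zero_right: "\<forall>i\<ge>0. \<not> h (x i)"
    if "\<And>d. d \<in> ?H \<Longrightarrow> \<forall>i\<in>{0..<int n}. \<not> d (x i) \<Longrightarrow> \<not> d (x (int n))"
      and h: "h \<in> ?H" "\<forall>i\<in>{0..<int n}. \<not> h (x i)" for n h
  proof -
    have upto: "\<forall>i\<in>{0..<int n + int m}. \<not> h (x i)" for m
    proof (induction m)
      case (Suc m)
      obtain h' where h': "h' \<in> ?H" "\<forall>i. h' (x i) = h (x (i + int m))" using shift_hom[OF h(1)] by blast
      have "\<not> h' (x (int n))" using Suc h' by (intro that(1)) auto
      then have "\<not> h (x (int n + int m))" using h' by simp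
      moreover have "i \<in> {0..<int n + int m} \<or> i = int n + int m" if "i \<in> {0..<int n + int (Suc m)}" for i
        using that by auto
      ultimately show ?case using Suc by metis
    qed (use h in simp)
    have "\<not> h (x i)" if "i \<ge> 0" for i using upto[of "nat i + 1"] that by auto
    then show ?thesis by blast
  qed
  have zero_left: "\<forall>i<int n. \<not> h (x i)"
    if "\<And>d. d \<in> ?H \<Longrightarrow> \<forall>i\<in>{1..int n}. \<not> d (x i) \<Longrightarrow> \<not> d (x 0)"
      and h: "h \<in> ?H" "\<forall>i\<in>{0..<int n}. \<not> h (x i)" for n h
  proof -
    have upto: "\<forall>i\<in>{- int m..<int n}. \<not> h (x i)" for m
    proof (induction m)
      case (Suc m)
      obtain h' where h': "h' \<in> ?H" "\<forall>i. h' (x i) = h (x (i + (- int m - 1)))"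
        using shift_hom[OF h(1)] by blast
      have "\<not> h' (x 0)" using Suc h' by (intro that(1)) auto
      then have "\<not> h (x (- int m - 1))" using h' by simp
      moreover have "i \<in> {- int m..<int n} \<or> i = - int m - 1" if "i \<in> {- int (Suc m)..<int n}" for i
        using that by auto
      ultimately show ?case using Suc by metis
    qed (use h in simp)
    have "\<not> h (x i)" if "i < int n" for i using upto[of "nat (- i)"] that by auto
    then show ?thesis by blast
  qed
  have window: "\<exists>h\<in>?H. \<forall>i\<in>{0..<int n}. h (x i) = e i" for n and e :: "int \<Rightarrow> bool"
  proof (induction n arbitrary: e)
    case 0
    have "(\<lambda>_. False) \<in> ?H" by (auto simp: hom_def)
    then show ?case by auto
  next
    case (Suc n)
    \<comment> \<open>A homomorphism \<open>d\<close> that vanishes on the window except at one end corrects the value there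
      without disturbing the others.  If there is none at either end, vanishing on \<open>n\<close> consecutive terms
      propagates in both directions.\<close>
    consider (right) d where "d \<in> ?H" "\<forall>i\<in>{0..<int n}. \<not> d (x i)" "d (x (int n))"
      | (left) d where "d \<in> ?H" "\<forall>i\<in>{1..int n}. \<not> d (x i)" "d (x 0)"
      | (none) "\<And>d. d \<in> ?H \<Longrightarrow> \<forall>i\<in>{0..<int n}. \<not> d (x i) \<Longrightarrow> \<not> d (x (int n))"
          "\<And>d. d \<in> ?H \<Longrightarrow> \<forall>i\<in>{1..int n}. \<not> d (x i) \<Longrightarrow> \<not> d (x 0)"
      by blast
    then show ?case
    proof cases
      case right
      obtain h where h: "h \<in> ?H" "\<forall>i\<in>{0..<int n}. h (x i) = e i" using Suc.IH by blast
      have split: "i \<in> {0..<int n} \<or> i = int n" if "i \<in> {0..<int (Suc n)}" for i using that by auto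
      show ?thesis
      proof (cases "h (x (int n)) = e (int n)")
        case True
        then show ?thesis using h split by metis
      next
        case False
        then have "\<forall>i\<in>{0..<int (Suc n)}. (h (x i) \<noteq> d (x i)) = e i" using h right split by metis
        then show ?thesis using hom_Z2_sum[OF h(1) right(1)] by (intro bexI)
      qed
    next
      case left
      obtain h\<^sub>0 where h0: "h\<^sub>0 \<in> ?H" "\<forall>i\<in>{0..<int n}. h\<^sub>0 (x i) = e (i + 1)"
        using Suc.IH[of "\<lambda>i. e (i + 1)"] by blast
      obtain h where h: "h \<in> ?H" "\<forall>i. h (x i) = h\<^sub>0 (x (i + (- 1)))" using shift_hom[OF h0(1)] by blast
      have he: "\<forall>i\<in>{1..int n}. h (x i) = e i" using h h0 by auto
      have split: "i \<in> {1..int n} \<or> i = 0" if "i \<in> {0..<int (Suc n)}" for i using that by auto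
      show ?thesis
      proof (cases "h (x 0) = e 0")
        case True
        then show ?thesis using h(1) he split by metis
      next
        case False
        then have "\<forall>i\<in>{0..<int (Suc n)}. (h (x i) \<noteq> d (x i)) = e i" using he left split by metis
        then show ?thesis using hom_Z2_sum[OF h(1) left(1)] by (intro bexI)
      qed
    next
      case none
      obtain I0 where I0: "I0 \<subseteq> I" "finite I0" "card I0 = Suc n"
        using infinite_arbitrarily_large[OF f(3)] by blast
      have fK: "f i \<in> K" if "i \<in> I0" for i
        using that I0 by (auto simp flip: f(2) intro!: generate.incl)
      have "card I0 \<le> card {0..<int n}"
      proof (rule pattern_count(1)[where C = "UNIV :: bool set" and a = f and b = x and \<H> = ?H])
        show "\<exists>h\<in>?H. \<forall>i\<in>I0. h (f i) = e i" for e
          using free_family_realises[OF f(1) group_Z2 I0(1), of e] by (simp add: f(2))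
      next
        fix h h' assume h: "h \<in> ?H" "h' \<in> ?H" and eq: "\<forall>i\<in>{0..<int n}. h (x i) = h' (x i)"
        let ?d = "\<lambda>k. h k \<noteq> h' k"
        have d: "?d \<in> ?H" "\<forall>i\<in>{0..<int n}. \<not> ?d (x i)" using hom_Z2_sum[OF h] eq by auto
        have "\<forall>i\<ge>0. \<not> ?d (x i)"
          by (rule zero_right[where n = n and h = ?d, OF _ d]) (fact none(1))
        moreover have "\<forall>i<int n. \<not> ?d (x i)"
          by (rule zero_left[where n = n and h = ?d, OF _ d]) (fact none(2))
        ultimately have "h (x i) = h' (x i)" for i by (cases "i < int n") auto
        then have "h k = h' k" if "k \<in> K" for k
          using homs_agree_on_generate[OF x group_Z2, of h h' k] h that unfolding K_def by blast
        then show "\<forall>i\<in>I0. h (f i) = h' (f i)" using fK by blast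
      qed (simp_all add: I0)
      then show ?thesis using I0 by simp
    qed
  qed
  show ?thesis
    unfolding free_family_iff_kernel
  proof (intro conjI allI impI x)
    fix w assume w: "reduced w \<and> fst ` set w \<subseteq> UNIV \<and> eval_word G x w = \<one>"
    obtain N :: nat where N: "\<forall>i\<in>fst ` set w. \<bar>i\<bar> < int N"
    proof -
      have "finite (fst ` set w)" by simp
      then have "\<exists>N::nat. \<forall>i\<in>fst ` set w. \<bar>i\<bar> < int N"
      proof (induction rule: finite_induct)
        case (insert i A)
        then obtain N :: nat where "\<forall>i\<in>A. \<bar>i\<bar> < int N" by blast
        then show ?case by (intro exI[of _ "N + nat \<bar>i\<bar> + 1"]) force
      qed simp
      then show ?thesis using that by blast
    qed
    define J where "J = {- int N..<int N}"
    have xJ: "x \<in> J \<rightarrow> carrier G" using x by auto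
    let ?L = "generate G (x ` J)"
    have L: "subgroup ?L G" using x by (intro generate_is_subgroup) auto
    have LK: "?L \<subseteq> K" unfolding K_def by (intro mono_generate) auto
    obtain I' :: "'i set" and f' where f': "free_family G I' f'" "generate G (f' ` I') = ?L"
      using subgroups_free[OF L LK] by blast
    have f'c: "f' \<in> I' \<rightarrow> carrier G" using f'(1) by (simp add: free_family_def)
    let ?HL = "hom (G\<lparr>carrier := ?L\<rparr>) Z2"
    have patterns: "\<exists>h\<in>?HL. \<forall>i\<in>J. h (x i) = e i" for e
    proof -
      obtain h where h: "h \<in> ?H" "\<forall>i\<in>{0..<int (2 * N)}. h (x i) = e (i - int N)"
        using window[of "2 * N" "\<lambda>i. e (i - int N)"] by blast
      obtain h' where h': "h' \<in> ?H" "\<forall>i. h' (x i) = h (x (i + int N))" using shift_hom[OF h(1)] by blast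
      have "h' \<in> ?HL" using h'(1) LK by (auto simp: hom_def)
      moreover have "\<forall>i\<in>J. h' (x i) = e i" using h h' by (auto simp: J_def)
      ultimately show ?thesis by blast
    qed
    have "\<exists>I0\<subseteq>I'. finite I0 \<and> card I0 = card J"
    proof (cases "finite I'")
      case True
      have "card J \<le> card I'"
      proof (rule pattern_count(1)[where C = "UNIV :: bool set" and a = x and b = f' and \<H> = ?HL])
        fix h h' assume h: "h \<in> ?HL" "h' \<in> ?HL" and eq: "\<forall>j\<in>I'. h (f' j) = h' (f' j)"
        show "\<forall>i\<in>J. h (x i) = h' (x i)"
        proof
          fix i assume "i \<in> J"
          then have "x i \<in> generate G (f' ` I')" unfolding f'(2) by (auto intro: generate.incl)
          then show "h (x i) = h' (x i)"
            using homs_agree_on_generate[OF f'c group_Z2 _ _ eq] h by (simp add: f'(2))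
        qed
      qed (use patterns True in \<open>simp_all add: J_def\<close>)
      then show ?thesis using True obtain_subset_with_card_n by metis
    next
      case False
      then show ?thesis using infinite_arbitrarily_large by blast
    qed
    then obtain I0 where I0: "I0 \<subseteq> I'" "finite I0" "card I0 = card J" by blast
    have "free_family G J x"
      using hopfian_free_family[OF f'(1) xJ _ f'(2) I0] by (simp add: J_def)
    moreover have "fst ` set w \<subseteq> J" using N by (auto simp: J_def) (metis abs_less_iff fst_conv image_eqI less_imp_le minus_less_iff)+
    ultimately show "w = []" using w unfolding free_family_iff_kernel by blast
  qed
qed

end

section \<open>Coarse projections onto subgroups of free groups\<close>

lemma foldr_push_append: "reduced (u @ v) \<Longrightarrow> foldr push u v = u @ v"
proof (induction u)
  case (Cons a u)
  then show ?case using reduced_ConsD[of a "u @ v"] push_eq_Cons[of a "u @ v"] by simp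
qed simp

lemma length_foldr_push: "length (foldr push u v) \<le> length u + length v"
proof (induction u)
  case (Cons a u)
  have "length (push a w) \<le> Suc (length w)" for w :: "('a \<times> bool) list" by (cases w) auto
  from this[of "foldr push u v"] show ?case using Cons by simp
qed simp

lemma foldr_push_cancellation:
  assumes "reduced k"
  shows "\<exists>a c b. k = a @ c \<and> r = rev (map inv_letter c) @ b \<and> foldr push k r = a @ b"
  using assms
proof (induction k)
  case (Cons x k)
  then obtain a c b where abc: "k = a @ c" "r = rev (map inv_letter c) @ b" "foldr push k r = a @ b"
    using reduced_ConsD by blast
  show ?case
  proof (cases a)
    case Nil
    show ?thesis
    proof (cases "\<exists>b'. b = inv_letter x # b'")
      case True
      then obtain b' where "b = inv_letter x # b'" by blast
      then show ?thesis using abc Nil by (intro exI[of _ "[]"] exI[of _ "x # c"] exI[of _ b']) simp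
    next
      case False
      then have "push x b = x # b" by (cases b) auto
      then show ?thesis using abc Nil by (intro exI[of _ "[x]"] exI[of _ c] exI[of _ b]) simp
    qed
  next
    case (Cons y a')
    then have "y \<noteq> inv_letter x" using Cons.prems abc by simp
    then show ?thesis using abc Cons by (intro exI[of _ "x # a"] exI[of _ c] exI[of _ b]) simp
  qed
qed simp

text \<open>
  A prefix of the reduced form of \<open>u w\<close> comes from a prefix of \<open>u\<close> or from all of \<open>u\<close> and a prefix of \<open>w\<close>,
  because cancellation only removes letters where the two words meet.
\<close>

lemma prefix_of_product:
  assumes "foldr push u w = a @ b"
  shows "(\<exists>u' u''. u = u' @ u'' \<and> a = foldr push u' []) \<or>
    (\<exists>q q'. w = q @ q' \<and> a = foldr push u q)"
  using assms
proof (induction u arbitrary: a b)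
  case (Cons x u)
  have step: ?case if "foldr push u w = c @ d" "a = push x c" for c d
    using Cons.IH[OF that(1)] that(2)
    by (metis append_Cons foldr_Cons o_apply)
  show ?case
  proof (cases "\<exists>v. foldr push u w = inv_letter x # v")
    case True
    then obtain v where v: "foldr push u w = inv_letter x # v" by blast
    then show ?thesis using step[of "inv_letter x # a" b] Cons.prems by simp
  next
    case False
    then have eq: "x # foldr push u w = a @ b" using Cons.prems by (cases "foldr push u w") auto
    show ?thesis
    proof (cases a)
      case Nil
      then show ?thesis by (intro disjI1 exI[of _ "[]"] exI[of _ "x # u"]) simp
    next
      case (Cons y c)
      then have "foldr push u w = c @ b" "a = push x c" using eq False by (cases c; auto)+
      then show ?thesis by (rule step)
    qed
  qed
qed auto

text \<open>
  In the Cayley tree, the geodesic from the identity to a product is contained in the path that runs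
  through the partial products.  So each of its vertices \<open>a\<close> is within distance \<open>C\<close> of a partial product,
  \<open>C\<close> being a bound for the lengths of the factors, the last of which is \<open>z\<close>.
\<close>

lemma eval_word_prefix:
  fixes S :: "'s set"
  assumes f: "f \<in> I \<rightarrow> carrier (free_group S)" and z: "z \<in> carrier (free_group S)" "length z \<le> C"
    and letters: "\<And>a. fst a \<in> I \<Longrightarrow> length (eval_letter (free_group S) f a) \<le> C"
    and w: "fst ` set w \<subseteq> I" and ab: "foldr push (eval_word (free_group S) f w) z = a @ b"
  shows "\<exists>w' w'' e. w = w' @ w'' \<and> e \<in> carrier (free_group S) \<and> length e \<le> C \<and>
    a = foldr push (eval_word (free_group S) f w') e"
  using w ab
proof (induction w arbitrary: a b)
  case Nil
  then have "reduced a" "fst ` set a \<subseteq> S" "length a \<le> C"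
    using z by (auto dest: reduced_appendD1)
  then show ?case by simp
next
  interpret R: group "free_group S" by (rule group_free_group)
  case (Cons x w)
  let ?x = "eval_letter (free_group S) f x" and ?e = "eval_word (free_group S) f"
  have x: "?x \<in> carrier (free_group S)" and ew: "?e w \<in> carrier (free_group S)"
    using R.eval_letter_closed[OF f] R.eval_word_closed[OF f] Cons.prems by auto
  have red: "reduced z" "reduced ?x" using z x by auto
  have "foldr push ?x (foldr push (?e w) z) = a @ b"
    using Cons.prems red by (simp add: foldr_push_assoc)
  from prefix_of_product[OF this] show ?case
  proof (elim disjE exE conjE)
    fix u' u'' assume u: "?x = u' @ u''" and a: "a = foldr push u' []"
    have "reduced u'" using u red reduced_appendD1 by metis
    then have "a = u'" by (simp add: a foldr_push_Nil)
    moreover have "fst ` set u' \<subseteq> S" using x unfolding u by auto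
    moreover have "length u' \<le> C" using letters[of x] Cons.prems u by simp
    ultimately show ?thesis
      using \<open>reduced u'\<close> by (intro exI[of _ "[]"] exI[of _ "x # w"] exI[of _ u']) simp
  next
    fix q q' assume q: "foldr push (?e w) z = q @ q'" and a: "a = foldr push ?x q"
    obtain w' w'' e where e: "w = w' @ w''" "e \<in> carrier (free_group S)" "length e \<le> C"
      "q = foldr push (?e w') e"
      using Cons.IH[OF _ q] Cons.prems by auto
    have "a = foldr push (?e (x # w')) e"
      using e by (simp add: a foldr_push_assoc)
    then show ?thesis using e by (intro exI[of _ "x # w'"] exI[of _ w''] exI[of _ e]) simp
  qed
qed

lemma finite_free_group_ball:
  "finite S \<Longrightarrow> finite {w \<in> carrier (free_group S). length w \<le> n}"
  by (rule finite_subset[OF _ finite_words_bounded[of S n]]) auto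

definition shortest_in_coset :: "'s set \<Rightarrow> ('s \<times> bool) list set \<Rightarrow> ('s \<times> bool) list \<Rightarrow> bool" where
  "shortest_in_coset S K r \<longleftrightarrow> r \<in> carrier (free_group S) \<and> (\<forall>k\<in>K. length r \<le> length (foldr push k r))"

lemma bounded_on_finite:
  assumes "finite A" shows "\<exists>C::nat. \<forall>x\<in>A. g x \<le> C"
  using finite_imageI[OF assms, of g] by (meson Max_ge imageI)

text \<open>
  The partial products of a word in generators of the subgroup lie in the subgroup.
\<close>

lemma subgroup_quasiconvex:
  fixes S :: "'s set"
  assumes B: "finite B" "B \<subseteq> carrier (free_group S)"
  shows "\<exists>C. \<forall>a c. a @ c \<in> generate (free_group S) B \<longrightarrow>
    (\<exists>v\<in>generate (free_group S) B. \<exists>e\<in>carrier (free_group S). length e \<le> C \<and> a = foldr push v e)"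
proof -
  interpret R: group "free_group S" by (rule group_free_group)
  let ?l = "eval_letter (free_group S) (\<lambda>x. x)"
  have id: "(\<lambda>x. x) \<in> B \<rightarrow> carrier (free_group S)" using B(2) by blast
  obtain C where C: "\<forall>a\<in>B \<times> UNIV. length (?l a) \<le> C"
    using bounded_on_finite[of "B \<times> (UNIV :: bool set)" "\<lambda>a. length (?l a)"] B by auto
  have gen: "eval_word (free_group S) (\<lambda>x. x) ` carrier (free_group B) = generate (free_group S) B"
    using R.eval_word_image[OF id] by simp
  show ?thesis
  proof (intro exI[of _ C] allI impI)
    fix a c assume ac: "a @ c \<in> generate (free_group S) B"
    then obtain w where w: "fst ` set w \<subseteq> B" "eval_word (free_group S) (\<lambda>x. x) w = a @ c"
      unfolding gen[symmetric] by auto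
    have "a @ c \<in> carrier (free_group S)" using R.generate_in_carrier[OF B(2) ac] .
    then have "reduced (a @ c)" by simp
    then have "foldr push (eval_word (free_group S) (\<lambda>x. x) w) [] = a @ c"
      unfolding w(2) by (rule foldr_push_Nil)
    from eval_word_prefix[OF id _ _ _ w(1) this, of C]
    obtain w' w'' e where e: "w = w' @ w''" "e \<in> carrier (free_group S)" "length e \<le> C"
      "a = foldr push (eval_word (free_group S) (\<lambda>x. x) w') e" using C by auto
    have "eval_word (free_group S) (\<lambda>x. x) w' \<in> generate (free_group S) B"
      using w(1) e(1) B(2)
      by (intro R.eval_word_in_subgroup[OF R.generate_is_subgroup[OF B(2)], of _ B])
        (auto intro: generate.incl)
    then show "\<exists>v\<in>generate (free_group S) B. \<exists>e\<in>carrier (free_group S).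
        length e \<le> C \<and> a = foldr push v e"
      using e by blast
  qed
qed

lemma inv_free_group:
  assumes "c \<in> carrier (free_group S)"
  shows "inv\<^bsub>free_group S\<^esub> c = rev (map inv_letter c)"
proof -
  interpret R: group "free_group S" by (rule group_free_group)
  have red: "reduced c" and c: "fst ` set c \<subseteq> S" using assms by auto
  have 1: "foldr push (rev (map inv_letter c)) c = []"
    using foldr_push_inverse[of "[]" c] foldr_push_Nil[OF red] by simp
  have red': "reduced (rev (map inv_letter c))"
    unfolding reduced_def successively_rev successively_map
    by (rule successively_mono[OF red[unfolded reduced_def]]) (metis inv_letter_inv_letter)
  have "rev (map inv_letter c) \<in> carrier (free_group S)"
    using red' c by (auto simp: image_image)
  then show ?thesis using assms 1 by (intro R.inv_equality) simp_all
qed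

text \<open>
  This says that an automorphism \<open>\<sigma>\<close> with \<open>\<sigma> K = K\<close> commutes with the nearest-point projection onto \<open>K\<close> up
  to a bounded error.  A shortest representative \<open>r\<close> of its coset is an element whose nearest point in
  \<open>K\<close> is the identity; the lemma bounds the point \<open>k\<close> of \<open>K\<close> nearest to \<open>\<sigma>(r) z\<close>.
  
  Writing \<open>\<sigma>(r) z = k r'\<close> with \<open>r'\<close> shortest, the geodesic from the identity to \<open>k r'\<close> passes near \<open>k\<close>,
  as \<open>K\<close> is quasiconvex.  It also stays close to the \<open>\<sigma>\<close>-image of the geodesic from the identity to \<open>r\<close>.
  So \<open>k\<close> is near \<open>\<sigma> p\<close> for a prefix \<open>p\<close> of \<open>r\<close>, whence \<open>\<tau> k \<in> K\<close> is near \<open>p\<close>.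
  As the identity is a point of \<open>K\<close> nearest to \<open>r\<close>, the prefix \<open>p\<close> must be short.
\<close>

lemma bounded_projection_difference:
  fixes S :: "'s set"
  assumes S: "finite S" and B: "finite B" "B \<subseteq> carrier (free_group S)"
  defines "K \<equiv> generate (free_group S) B"
  assumes \<sigma>: "\<sigma> \<in> hom (free_group S) (free_group S)" "\<tau> \<in> hom (free_group S) (free_group S)"
    and inverse: "\<And>w. w \<in> carrier (free_group S) \<Longrightarrow> \<sigma> (\<tau> w) = w"
      "\<And>w. w \<in> carrier (free_group S) \<Longrightarrow> \<tau> (\<sigma> w) = w"
    and \<tau>K: "\<And>k. k \<in> K \<Longrightarrow> \<tau> k \<in> K" and z: "z \<in> carrier (free_group S)"
  shows "finite {k \<in> K. \<exists>r r'. shortest_in_coset S K r \<and> shortest_in_coset S K r' \<and>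
    foldr push (\<sigma> r) z = foldr push k r'}"
proof -
  let ?R = "free_group S"
  interpret R: group ?R by (rule group_free_group)
  interpret \<sigma>: group_hom ?R ?R \<sigma> using \<sigma> by unfold_locales
  interpret \<tau>: group_hom ?R ?R \<tau> using \<sigma> by unfold_locales
  note [simp del] = mult_free_group in_carrier_free_group
  have K: "subgroup K ?R" unfolding K_def by (rule R.generate_is_subgroup[OF B(2)])
  note Kc = subgroup.mem_carrier[OF K]
  obtain C1 where C1: "\<And>a c. a @ c \<in> K \<Longrightarrow> \<exists>v\<in>K. \<exists>e\<in>carrier ?R. length e \<le> C1 \<and> a = foldr push v e"
    using subgroup_quasiconvex[OF B] unfolding K_def by blast
  define g where "g s = \<sigma> [(s, True)]" for s
  have g: "g \<in> S \<rightarrow> carrier ?R"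
    unfolding g_def by (intro Pi_I \<sigma>.hom_closed) (simp add: in_carrier_free_group)
  obtain C0 where C0: "\<forall>a\<in>S \<times> UNIV. length (eval_letter ?R g a) \<le> C0"
    using bounded_on_finite[of "S \<times> (UNIV :: bool set)" "\<lambda>a. length (eval_letter ?R g a)"] S by auto
  define C2 where "C2 = C0 + length z"
  obtain C3 where C3: "\<forall>y\<in>{w \<in> carrier ?R. length w \<le> C2 + C1}.
      length (\<tau> y) + length (inv\<^bsub>?R\<^esub> \<tau> y) \<le> C3"
    using bounded_on_finite[OF finite_free_group_ball[OF S, of "C2 + C1"],
        of "\<lambda>y. length (\<tau> y) + length (inv\<^bsub>?R\<^esub> \<tau> y)"] by blast
  have "k \<in> \<sigma> ` {w \<in> carrier ?R. length w \<le> C3 + C3}"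
    if k: "k \<in> K" and r: "shortest_in_coset S K r" and r': "shortest_in_coset S K r'"
      and eq: "foldr push (\<sigma> r) z = foldr push k r'" for k r r'
  proof -
    have rc: "r \<in> carrier ?R" "r' \<in> carrier ?R" using r r' by (auto simp: shortest_in_coset_def)
    have "reduced k" using Kc[OF k] by (simp add: in_carrier_free_group)
    then obtain a c b where abc: "k = a @ c" "r' = rev (map inv_letter c) @ b" "foldr push k r' = a @ b"
      using foldr_push_cancellation by blast
    have c: "c \<in> carrier ?R" and a: "a \<in> carrier ?R" and b: "b \<in> carrier ?R"
      using Kc[OF k] rc(2) unfolding abc
      by (auto simp: in_carrier_free_group dest: reduced_appendD1 reduced_appendD2)
    have kac: "k = a \<otimes>\<^bsub>?R\<^esub> c"
      using Kc[OF k] unfolding abc by (simp add: mult_free_group in_carrier_free_group foldr_push_append)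
    have r'cb: "r' = inv\<^bsub>?R\<^esub> c \<otimes>\<^bsub>?R\<^esub> b"
      using rc(2) unfolding abc inv_free_group[OF c]
      by (simp add: mult_free_group in_carrier_free_group foldr_push_append)
    have "a @ c \<in> K" using k abc by simp
    from C1[OF this] obtain v e where v: "v \<in> K" "e \<in> carrier ?R" "length e \<le> C1" "a = v \<otimes>\<^bsub>?R\<^esub> e"
      by (auto simp: mult_free_group)
    \<comment> \<open>The part \<open>c\<close> of \<open>r'\<close> that cancels against \<open>k\<close> is short: otherwise the point of \<open>K\<close> near the
      branching point \<open>a\<close> would provide a shorter representative of the coset of \<open>r'\<close>.\<close>
    have "length c \<le> C1"
    proof -
      have vk: "inv\<^bsub>?R\<^esub> v \<otimes>\<^bsub>?R\<^esub> k \<in> K" using v k K by (simp add: subgroup.m_closed subgroup.m_inv_closed)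
      have "(inv\<^bsub>?R\<^esub> v \<otimes>\<^bsub>?R\<^esub> k) \<otimes>\<^bsub>?R\<^esub> r' = inv\<^bsub>?R\<^esub> v \<otimes>\<^bsub>?R\<^esub> (v \<otimes>\<^bsub>?R\<^esub> (e \<otimes>\<^bsub>?R\<^esub> (c \<otimes>\<^bsub>?R\<^esub> (inv\<^bsub>?R\<^esub> c \<otimes>\<^bsub>?R\<^esub> b))))"
        using v c b Kc[OF v(1)] by (simp add: kac v(4) r'cb R.m_assoc)
      also have "\<dots> = e \<otimes>\<^bsub>?R\<^esub> b"
        using v c b Kc[OF v(1)] R.l_one[of b] R.l_one[of e] R.l_one[of "e \<otimes>\<^bsub>?R\<^esub> b"] by (simp flip: R.m_assoc)
      finally have "length r' \<le> length (e \<otimes>\<^bsub>?R\<^esub> b)"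
        using r' vk by (auto simp: shortest_in_coset_def mult_free_group)
      also have "\<dots> \<le> C1 + length b" using length_foldr_push[of e b] v by (simp add: mult_free_group)
      finally show ?thesis using abc by simp
    qed
    have rS: "fst ` set r \<subseteq> S" using rc by (simp add: in_carrier_free_group)
    have \<sigma>w: "\<sigma> w = eval_word ?R g w" if "w \<in> carrier ?R" for w
      using R.hom_free_group_eq_eval_word[OF g \<sigma>.homh _ that] by (simp add: g_def)
    have "foldr push (eval_word ?R g r) z = a @ b" using eq abc(3) \<sigma>w[OF rc(1)] by simp
    from eval_word_prefix[OF g z _ _ rS this, of C2]
    obtain p q d where d: "r = p @ q" "d \<in> carrier ?R" "length d \<le> C2" "a = eval_word ?R g p \<otimes>\<^bsub>?R\<^esub> d"
      using C0 by (auto simp: C2_def mult_free_group trans_le_add1)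
    have p: "p \<in> carrier ?R" "q \<in> carrier ?R" and rpq: "r = p \<otimes>\<^bsub>?R\<^esub> q"
      using rc(1) unfolding d
      by (auto simp: in_carrier_free_group mult_free_group foldr_push_append
        dest: reduced_appendD1 reduced_appendD2)
    define y where "y = \<tau> (d \<otimes>\<^bsub>?R\<^esub> c)"
    have y: "y \<in> carrier ?R" using d c by (simp add: y_def)
    have "length (d \<otimes>\<^bsub>?R\<^esub> c) \<le> C2 + C1"
      using length_foldr_push[of d c] d(3) \<open>length c \<le> C1\<close> by (simp add: mult_free_group)
    then have len: "length y \<le> C3" "length (inv\<^bsub>?R\<^esub> y) \<le> C3"
      using C3 d c unfolding y_def by (auto dest!: bspec[of _ _ "d \<otimes>\<^bsub>?R\<^esub> c"])
    have "k = \<sigma> p \<otimes>\<^bsub>?R\<^esub> (d \<otimes>\<^bsub>?R\<^esub> c)"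
      using kac d p c by (simp add: \<sigma>w[OF p(1), symmetric] R.m_assoc)
    then have \<tau>k: "\<tau> k = p \<otimes>\<^bsub>?R\<^esub> y" using d p c inverse(2)[OF p(1)] by (simp add: y_def)
    \<comment> \<open>Now \<open>\<tau> k\<close> is within \<open>C3\<close> of \<open>p\<close>, so translating \<open>r\<close> by its inverse replaces the prefix \<open>p\<close> by at most
      \<open>C3\<close> letters; minimality of \<open>r\<close> bounds the length of \<open>p\<close>.\<close>
    have "inv\<^bsub>?R\<^esub> p \<otimes>\<^bsub>?R\<^esub> (p \<otimes>\<^bsub>?R\<^esub> q) = q"
      using p R.l_one[OF p(2)] by (simp flip: R.m_assoc)
    then have "inv\<^bsub>?R\<^esub> \<tau> k \<otimes>\<^bsub>?R\<^esub> r = inv\<^bsub>?R\<^esub> y \<otimes>\<^bsub>?R\<^esub> q"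
      unfolding \<tau>k rpq using p y by (simp add: R.inv_mult_group R.m_assoc)
    then have "length r \<le> length (inv\<^bsub>?R\<^esub> y \<otimes>\<^bsub>?R\<^esub> q)"
      using r subgroup.m_inv_closed[OF K \<tau>K[OF k]] by (auto simp: shortest_in_coset_def mult_free_group)
    also have "\<dots> \<le> C3 + length q"
      using length_foldr_push[of "inv\<^bsub>?R\<^esub> y" q] len by (simp add: mult_free_group)
    finally have "length p \<le> C3" using d by simp
    then have "length (\<tau> k) \<le> C3 + C3"
      using length_foldr_push[of p y] len unfolding \<tau>k by (simp add: mult_free_group)
    moreover have "\<tau> k \<in> carrier ?R" "k = \<sigma> (\<tau> k)" using inverse Kc[OF k] by simp_all
    ultimately show ?thesis by blast
  qed
  then have "{k \<in> K. \<exists>r r'. shortest_in_coset S K r \<and> shortest_in_coset S K r' \<and>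
      foldr push (\<sigma> r) z = foldr push k r'} \<subseteq> \<sigma> ` {w \<in> carrier ?R. length w \<le> C3 + C3}"
    by blast
  then show ?thesis by (rule finite_subset) (intro finite_imageI finite_free_group_ball S)
qed

text \<open>
  With \<open>\<sigma>\<close> the identity, the finiteness assertion says that the projection \<open>\<pi>\<close> is coarsely Lipschitz.
  Boundedness is expressed as finiteness of a set of differences, which refers to no generating set.
\<close>

lemma free_group_coarse_projection:
  fixes S :: "'s set"
  assumes S: "finite S" and B: "finite B" "B \<subseteq> carrier (free_group S)"
  defines "K \<equiv> generate (free_group S) B"
  shows "\<exists>\<pi>. (\<forall>f\<in>carrier (free_group S). \<pi> f \<in> K) \<and> (\<forall>k\<in>K. \<pi> k = k) \<and>
    (\<forall>\<sigma> \<tau> z. \<sigma> \<in> hom (free_group S) (free_group S) \<longrightarrow> \<tau> \<in> hom (free_group S) (free_group S) \<longrightarrow>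
       (\<forall>w\<in>carrier (free_group S). \<sigma> (\<tau> w) = w \<and> \<tau> (\<sigma> w) = w) \<longrightarrow>
       (\<forall>k\<in>K. \<sigma> k \<in> K \<and> \<tau> k \<in> K) \<longrightarrow> z \<in> carrier (free_group S) \<longrightarrow>
       finite {inv\<^bsub>free_group S\<^esub> \<sigma> (\<pi> f) \<otimes>\<^bsub>free_group S\<^esub> \<pi> (\<sigma> f \<otimes>\<^bsub>free_group S\<^esub> z) |
         f. f \<in> carrier (free_group S)})"
proof -
  let ?R = "free_group S"
  interpret R: group ?R by (rule group_free_group)
  note [simp del] = mult_free_group in_carrier_free_group
  have K: "subgroup K ?R" unfolding K_def by (rule R.generate_is_subgroup[OF B(2)])
  note Kc = subgroup.mem_carrier[OF K]
  have "\<exists>v\<in>K. shortest_in_coset S K (inv\<^bsub>?R\<^esub> v \<otimes>\<^bsub>?R\<^esub> f)" if f: "f \<in> carrier ?R" for f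
  proof -
    obtain v where v: "v \<in> K" "\<And>u. u \<in> K \<Longrightarrow>
        length (inv\<^bsub>?R\<^esub> v \<otimes>\<^bsub>?R\<^esub> f) \<le> length (inv\<^bsub>?R\<^esub> u \<otimes>\<^bsub>?R\<^esub> f)"
      using ex_has_least_nat[of "\<lambda>v. v \<in> K" _ "\<lambda>v. length (inv\<^bsub>?R\<^esub> v \<otimes>\<^bsub>?R\<^esub> f)"]
        subgroup.one_closed[OF K] by blast
    have "length (inv\<^bsub>?R\<^esub> v \<otimes>\<^bsub>?R\<^esub> f) \<le> length (k \<otimes>\<^bsub>?R\<^esub> (inv\<^bsub>?R\<^esub> v \<otimes>\<^bsub>?R\<^esub> f))" if k: "k \<in> K" for k
    proof -
      have "k \<otimes>\<^bsub>?R\<^esub> (inv\<^bsub>?R\<^esub> v \<otimes>\<^bsub>?R\<^esub> f) = inv\<^bsub>?R\<^esub> (v \<otimes>\<^bsub>?R\<^esub> inv\<^bsub>?R\<^esub> k) \<otimes>\<^bsub>?R\<^esub> f"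
        using Kc[OF k] Kc[OF v(1)] f by (simp add: R.inv_mult_group R.m_assoc)
      then show ?thesis
        using v(2)[of "v \<otimes>\<^bsub>?R\<^esub> inv\<^bsub>?R\<^esub> k"] subgroup.m_closed[OF K v(1) subgroup.m_inv_closed[OF K k]] by simp
    qed
    moreover have "inv\<^bsub>?R\<^esub> v \<otimes>\<^bsub>?R\<^esub> f \<in> carrier ?R" using Kc[OF v(1)] f by simp
    ultimately show ?thesis
      unfolding shortest_in_coset_def mult_free_group[where S = S, symmetric]
      using v(1) by blast
  qed
  then obtain \<pi> where \<pi>: "\<And>f. f \<in> carrier ?R \<Longrightarrow> \<pi> f \<in> K"
      "\<And>f. f \<in> carrier ?R \<Longrightarrow> shortest_in_coset S K (inv\<^bsub>?R\<^esub> \<pi> f \<otimes>\<^bsub>?R\<^esub> f)"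
    by metis
  have "\<pi> k = k" if k: "k \<in> K" for k
  proof -
    have mem: "inv\<^bsub>?R\<^esub> k \<otimes>\<^bsub>?R\<^esub> \<pi> k \<in> K"
      using \<pi>(1)[OF Kc[OF k]] k K by (simp add: subgroup.m_closed subgroup.m_inv_closed)
    note c = Kc[OF k] Kc[OF \<pi>(1)[OF Kc[OF k]]]
    have "\<pi> k \<otimes>\<^bsub>?R\<^esub> (inv\<^bsub>?R\<^esub> \<pi> k \<otimes>\<^bsub>?R\<^esub> k) = k"
      using c R.l_one[OF c(1)] by (simp flip: R.m_assoc)
    then have "(inv\<^bsub>?R\<^esub> k \<otimes>\<^bsub>?R\<^esub> \<pi> k) \<otimes>\<^bsub>?R\<^esub> (inv\<^bsub>?R\<^esub> \<pi> k \<otimes>\<^bsub>?R\<^esub> k) = []"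
      using c by (simp add: R.m_assoc)
    then have "inv\<^bsub>?R\<^esub> \<pi> k \<otimes>\<^bsub>?R\<^esub> k = \<one>\<^bsub>?R\<^esub>"
      using \<pi>(2)[OF Kc[OF k]] mem by (auto simp: shortest_in_coset_def mult_free_group)
    then show ?thesis
      using Kc[OF k] Kc[OF \<pi>(1)[OF Kc[OF k]]] R.inv_equality R.inv_inv
      by (metis R.inv_closed)
  qed
  moreover have "finite {inv\<^bsub>?R\<^esub> \<sigma> (\<pi> f) \<otimes>\<^bsub>?R\<^esub> \<pi> (\<sigma> f \<otimes>\<^bsub>?R\<^esub> z) | f. f \<in> carrier ?R}"
    if \<sigma>: "\<sigma> \<in> hom ?R ?R" "\<tau> \<in> hom ?R ?R" "\<forall>w\<in>carrier ?R. \<sigma> (\<tau> w) = w \<and> \<tau> (\<sigma> w) = w"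
      "\<forall>k\<in>K. \<sigma> k \<in> K \<and> \<tau> k \<in> K" and z: "z \<in> carrier ?R" for \<sigma> \<tau> z
  proof (rule finite_subset)
    interpret \<sigma>: group_hom ?R ?R \<sigma> using \<sigma> by unfold_locales
    show "finite {k \<in> K. \<exists>r r'. shortest_in_coset S K r \<and> shortest_in_coset S K r' \<and>
        foldr push (\<sigma> r) z = foldr push k r'}"
      using \<sigma> z unfolding K_def by (intro bounded_projection_difference[OF S B, of \<sigma> \<tau>]) auto
    show "{inv\<^bsub>?R\<^esub> \<sigma> (\<pi> f) \<otimes>\<^bsub>?R\<^esub> \<pi> (\<sigma> f \<otimes>\<^bsub>?R\<^esub> z) | f. f \<in> carrier ?R} \<subseteq> \<dots>"
    proof clarify
      fix f assume f: "f \<in> carrier ?R"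
      let ?g = "\<sigma> f \<otimes>\<^bsub>?R\<^esub> z"
      let ?k = "inv\<^bsub>?R\<^esub> \<sigma> (\<pi> f) \<otimes>\<^bsub>?R\<^esub> \<pi> ?g" and ?r = "inv\<^bsub>?R\<^esub> \<pi> f \<otimes>\<^bsub>?R\<^esub> f"
        and ?r' = "inv\<^bsub>?R\<^esub> \<pi> ?g \<otimes>\<^bsub>?R\<^esub> ?g"
      have g: "?g \<in> carrier ?R" using f z by simp
      note c = Kc[OF \<pi>(1)[OF f]] Kc[OF \<pi>(1)[OF g]]
      have "?k \<in> K" using \<pi>(1)[OF f] \<pi>(1)[OF g] \<sigma>(4) K by (simp add: subgroup.m_closed subgroup.m_inv_closed)
      moreover have "\<sigma> ?r \<otimes>\<^bsub>?R\<^esub> z = ?k \<otimes>\<^bsub>?R\<^esub> ?r'"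
      proof -
        have "\<pi> ?g \<otimes>\<^bsub>?R\<^esub> (inv\<^bsub>?R\<^esub> \<pi> ?g \<otimes>\<^bsub>?R\<^esub> ?g) = ?g"
          using c g R.l_one[OF g] by (simp flip: R.m_assoc)
        then have "?k \<otimes>\<^bsub>?R\<^esub> ?r' = inv\<^bsub>?R\<^esub> \<sigma> (\<pi> f) \<otimes>\<^bsub>?R\<^esub> ?g"
          using c g by (simp add: R.m_assoc)
        also have "\<dots> = \<sigma> ?r \<otimes>\<^bsub>?R\<^esub> z" using c f z by (simp add: R.m_assoc)
        finally show ?thesis by simp
      qed
      ultimately show "?k \<in> K \<and> (\<exists>r r'. shortest_in_coset S K r \<and> shortest_in_coset S K r' \<and>
          foldr push (\<sigma> r) z = foldr push ?k r')"
        using \<pi>(2)[OF f] \<pi>(2)[OF g] by (auto simp: mult_free_group)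
    qed
  qed
  ultimately show ?thesis using \<pi>(1) by (intro exI[of _ \<pi>]) blast
qed

text \<open>
  The same projection for a normal subgroup \<open>N\<close> of \<open>G\<close> that is the image of a free group, with the
  automorphisms that conjugation in \<open>G\<close> induces on \<open>N\<close>.
\<close>

lemma (in group) coarse_projection:
  fixes j :: "('s \<times> bool) list \<Rightarrow> 'a"
  assumes S: "finite S" and j: "j \<in> hom (free_group S) G" "inj_on j (carrier (free_group S))"
    and N: "N = j ` carrier (free_group S)"
      "\<forall>g\<in>carrier G. \<forall>n\<in>N. g \<otimes> n \<otimes> inv g \<in> N"
    and B: "finite B" "B \<subseteq> N"
  defines "K \<equiv> generate G B"
  shows "\<exists>\<pi>. (\<forall>f\<in>N. \<pi> f \<in> K) \<and> (\<forall>k\<in>K. \<pi> k = k) \<and>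
    (\<forall>g\<in>carrier G. (\<forall>k\<in>K. g \<otimes> k \<otimes> inv g \<in> K \<and> inv g \<otimes> k \<otimes> g \<in> K) \<longrightarrow>
       (\<forall>z\<in>N. finite {inv (g \<otimes> \<pi> f \<otimes> inv g) \<otimes> \<pi> (g \<otimes> f \<otimes> inv g \<otimes> z) | f. f \<in> N}))"
proof -
  let ?R = "free_group S"
  note [simp del] = mult_free_group in_carrier_free_group
  interpret R: group ?R by (rule group_free_group)
  interpret j: group_hom ?R G j using j by unfold_locales
  have Nsub: "subgroup N G" unfolding N(1) by (rule j.img_is_subgroup)
  note Nc = subgroup.mem_carrier[OF Nsub]
  define i where "i = inv_into (carrier ?R) j"
  have i: "i n \<in> carrier ?R" "j (i n) = n" if "n \<in> N" for n
    using that unfolding N(1) i_def by (auto intro: inv_into_into f_inv_into_f)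
  have ij: "i (j w) = w" if "w \<in> carrier ?R" for w
    using that j(2) unfolding i_def by simp
  have jN: "j w \<in> N" if "w \<in> carrier ?R" for w using that N(1) by blast
  have i_mult: "i (n \<otimes> n') = i n \<otimes>\<^bsub>?R\<^esub> i n'" if "n \<in> N" "n' \<in> N" for n n'
  proof -
    have "i (j (i n \<otimes>\<^bsub>?R\<^esub> i n')) = i n \<otimes>\<^bsub>?R\<^esub> i n'" using i that by (intro ij) simp
    then show ?thesis using i that by simp
  qed
  have iB: "i ` B \<subseteq> carrier ?R" using B i by auto
  let ?K = "generate ?R (i ` B)"
  have "j ` i ` B = B" using i B by (force simp: image_image)
  then have jK: "j ` ?K = K" using j.generate_img[OF iB] by (simp add: K_def)
  have KN: "K \<subseteq> N" unfolding K_def by (rule generate_subgroup_incl[OF B(2) Nsub])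
  have iK: "i k \<in> ?K" if k: "k \<in> K" for k
  proof -
    obtain w where "w \<in> ?K" "k = j w" using k jK by blast
    then show ?thesis using ij R.generate_in_carrier[OF iB] by simp
  qed
  from free_group_coarse_projection[OF S finite_imageI[OF B(1), of i] iB] obtain \<pi>
    where \<pi>0: "\<forall>f\<in>carrier ?R. \<pi> f \<in> ?K" "\<forall>k\<in>?K. \<pi> k = k"
    and fin: "\<forall>\<sigma> \<tau> z. \<sigma> \<in> hom ?R ?R \<longrightarrow> \<tau> \<in> hom ?R ?R \<longrightarrow>
       (\<forall>w\<in>carrier ?R. \<sigma> (\<tau> w) = w \<and> \<tau> (\<sigma> w) = w) \<longrightarrow>
       (\<forall>k\<in>?K. \<sigma> k \<in> ?K \<and> \<tau> k \<in> ?K) \<longrightarrow> z \<in> carrier ?R \<longrightarrow>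
       finite {inv\<^bsub>?R\<^esub> \<sigma> (\<pi> f) \<otimes>\<^bsub>?R\<^esub> \<pi> (\<sigma> f \<otimes>\<^bsub>?R\<^esub> z) | f. f \<in> carrier ?R}"
    by (elim exE conjE) (rule that)
  have \<pi>: "\<pi> f \<in> ?K" if "f \<in> carrier ?R" for f using \<pi>0 that by blast
  have \<pi>c: "\<pi> w \<in> carrier ?R" if "w \<in> carrier ?R" for w
    using R.generate_in_carrier[OF iB \<pi>[OF that]] .
  let ?p = "\<lambda>n. j (\<pi> (i n))"
  have "finite {inv (g \<otimes> ?p f \<otimes> inv g) \<otimes> ?p (g \<otimes> f \<otimes> inv g \<otimes> z) | f. f \<in> N}"
    if g: "g \<in> carrier G" and gK: "\<forall>k\<in>K. g \<otimes> k \<otimes> inv g \<in> K \<and> inv g \<otimes> k \<otimes> g \<in> K" and z: "z \<in> N" for g z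
  proof -
    have conj: "\<And>n. n \<in> N \<Longrightarrow> g \<otimes> n \<otimes> inv g \<in> N" "\<And>n. n \<in> N \<Longrightarrow> inv g \<otimes> n \<otimes> g \<in> N"
      using bspec[OF N(2) g] bspec[OF N(2) inv_closed[OF g]] g by auto
    define \<sigma> where "\<sigma> w = i (g \<otimes> j w \<otimes> inv g)" for w
    define \<tau> where "\<tau> w = i (inv g \<otimes> j w \<otimes> g)" for w
    have hom: "(\<lambda>w. i (c \<otimes> j w \<otimes> inv c)) \<in> hom ?R ?R"
      if c: "c \<in> carrier G" "\<And>n. n \<in> N \<Longrightarrow> c \<otimes> n \<otimes> inv c \<in> N" for c
    proof (rule homI)
      fix u v assume u: "u \<in> carrier ?R" "v \<in> carrier ?R"
      have "c \<otimes> j (u \<otimes>\<^bsub>?R\<^esub> v) \<otimes> inv c = (c \<otimes> j u \<otimes> inv c) \<otimes> (c \<otimes> j v \<otimes> inv c)"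
        using hom_mult[OF conjugation_hom[OF c(1)], of "j u" "j v"] u by simp
      then show "i (c \<otimes> j (u \<otimes>\<^bsub>?R\<^esub> v) \<otimes> inv c) = i (c \<otimes> j u \<otimes> inv c) \<otimes>\<^bsub>?R\<^esub> i (c \<otimes> j v \<otimes> inv c)"
        using i_mult[OF c(2)[OF jN[OF u(1)]] c(2)[OF jN[OF u(2)]]] by simp
    qed (use i jN c in simp)
    have \<sigma>hom: "\<sigma> \<in> hom ?R ?R" unfolding \<sigma>_def using hom[OF g conj(1)] by simp
    have \<tau>hom: "\<tau> \<in> hom ?R ?R" unfolding \<tau>_def using hom[of "inv g"] conj(2) g by simp
    have cancel: "g \<otimes> (inv g \<otimes> n \<otimes> g) \<otimes> inv g = n" "inv g \<otimes> (g \<otimes> n \<otimes> inv g) \<otimes> g = n"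
      if "n \<in> carrier G" for n
    proof -
      show "g \<otimes> (inv g \<otimes> n \<otimes> g) \<otimes> inv g = n"
        using g that by (simp add: m_assoc) (simp flip: m_assoc)
      show "inv g \<otimes> (g \<otimes> n \<otimes> inv g) \<otimes> g = n"
        using g that by (simp add: m_assoc) (simp flip: m_assoc)
    qed
    have "finite {inv\<^bsub>?R\<^esub> \<sigma> (\<pi> f) \<otimes>\<^bsub>?R\<^esub> \<pi> (\<sigma> f \<otimes>\<^bsub>?R\<^esub> i z) | f. f \<in> carrier ?R}"
    proof (rule fin[rule_format, OF \<sigma>hom \<tau>hom])
      fix w assume w: "w \<in> carrier ?R"
      then show "\<sigma> (\<tau> w) = w \<and> \<tau> (\<sigma> w) = w"
        unfolding \<sigma>_def \<tau>_def using i conj jN[OF w] cancel ij by simp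
    next
      fix k assume k: "k \<in> ?K"
      then have "j k \<in> K" using jK by blast
      then show "\<sigma> k \<in> ?K \<and> \<tau> k \<in> ?K" unfolding \<sigma>_def \<tau>_def using gK iK by blast
    qed (use i z in simp)
    then have "finite (j ` {inv\<^bsub>?R\<^esub> \<sigma> (\<pi> f) \<otimes>\<^bsub>?R\<^esub> \<pi> (\<sigma> f \<otimes>\<^bsub>?R\<^esub> i z) | f. f \<in> carrier ?R})"
      by (rule finite_imageI)
    moreover have "{inv (g \<otimes> ?p f \<otimes> inv g) \<otimes> ?p (g \<otimes> f \<otimes> inv g \<otimes> z) | f. f \<in> N}
      \<subseteq> j ` {inv\<^bsub>?R\<^esub> \<sigma> (\<pi> f) \<otimes>\<^bsub>?R\<^esub> \<pi> (\<sigma> f \<otimes>\<^bsub>?R\<^esub> i z) | f. f \<in> carrier ?R}"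
    proof clarify
      fix f assume f: "f \<in> N"
      have \<sigma>c: "\<sigma> w \<in> carrier ?R" "j (\<sigma> w) = g \<otimes> j w \<otimes> inv g" if "w \<in> carrier ?R" for w
        unfolding \<sigma>_def using i conj jN[OF that] by auto
      have "i (g \<otimes> f \<otimes> inv g \<otimes> z) = \<sigma> (i f) \<otimes>\<^bsub>?R\<^esub> i z"
        unfolding \<sigma>_def using i_mult[OF conj(1)[OF f] z] i f by simp
      then have "inv (g \<otimes> ?p f \<otimes> inv g) \<otimes> ?p (g \<otimes> f \<otimes> inv g \<otimes> z)
          = j (inv\<^bsub>?R\<^esub> \<sigma> (\<pi> (i f)) \<otimes>\<^bsub>?R\<^esub> \<pi> (\<sigma> (i f) \<otimes>\<^bsub>?R\<^esub> i z))"
        using \<sigma>c \<pi>c i f z by simp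
      then show "inv (g \<otimes> ?p f \<otimes> inv g) \<otimes> ?p (g \<otimes> f \<otimes> inv g \<otimes> z)
          \<in> j ` {inv\<^bsub>?R\<^esub> \<sigma> (\<pi> f) \<otimes>\<^bsub>?R\<^esub> \<pi> (\<sigma> f \<otimes>\<^bsub>?R\<^esub> i z) | f. f \<in> carrier ?R}"
        using i(1)[OF f] by blast
    qed
    ultimately show ?thesis by (rule finite_subset[rotated])
  qed
  moreover have "?p f \<in> K" if "f \<in> N" for f using \<pi> i that jK by blast
  moreover have "?p k = k" if "k \<in> K" for k using \<pi>0(2) iK i KN that by auto
  ultimately show ?thesis by (intro exI[of _ ?p]) blast
qed

section \<open>Word metrics and coarse retractions\<close>

context group
begin

lemma foldr_mult_append:
  assumes "set us \<subseteq> carrier G" "set vs \<subseteq> carrier G"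
  shows "foldr (\<otimes>) (us @ vs) \<one> = foldr (\<otimes>) us \<one> \<otimes> foldr (\<otimes>) vs \<one>"
proof -
  have c: "foldr (\<otimes>) ws \<one> \<in> carrier G" if "set ws \<subseteq> carrier G" for ws
    using that by (induction ws) auto
  show ?thesis using assms(1) by (induction us) (use assms c in \<open>auto simp: m_assoc\<close>)
qed

lemma word_length_le:
  assumes "set ws \<subseteq> S \<union> m_inv G ` S"
  shows "word_length G S (foldr (\<otimes>) ws \<one>) \<le> length ws"
  unfolding word_length_def using assms by (intro Least_le) blast

lemma word_length_attained:
  assumes S: "S \<subseteq> carrier G" and g: "g \<in> generate G S"
  obtains ws where "set ws \<subseteq> S \<union> m_inv G ` S" "foldr (\<otimes>) ws \<one> = g" "length ws = word_length G S g"
proof -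
  let ?P = "\<lambda>g ws. set ws \<subseteq> S \<union> m_inv G ` S \<and> foldr (\<otimes>) ws \<one> = g"
  have letters: "S \<union> m_inv G ` S \<subseteq> carrier G" using S by auto
  have "\<exists>ws. ?P g ws"
    using g
  proof (induction rule: generate.induct)
    case one
    then show ?case by (intro exI[of _ "[]"]) simp
  next
    case (incl h)
    then show ?case using S by (intro exI[of _ "[h]"]) auto
  next
    case (inv h)
    then show ?case using S by (intro exI[of _ "[inv h]"]) auto
  next
    case (eng g h)
    then obtain us vs where uv: "?P g us" "?P h vs" by blast
    then have "set us \<subseteq> carrier G" "set vs \<subseteq> carrier G" using letters by (meson order_trans)+
    from foldr_mult_append[OF this] uv have "?P (g \<otimes> h) (us @ vs)" by (simp del: foldr_append)
    then show ?case by blast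
  qed
  then have "\<exists>n ws. length ws = n \<and> ?P g ws" by blast
  from LeastI_ex[OF this] show ?thesis using that unfolding word_length_def by blast
qed

lemma word_length_mult:
  assumes S: "S \<subseteq> carrier G" and g: "g \<in> generate G S" "h \<in> generate G S"
  shows "word_length G S (g \<otimes> h) \<le> word_length G S g + word_length G S h"
proof -
  obtain us where us: "set us \<subseteq> S \<union> m_inv G ` S" "foldr (\<otimes>) us \<one> = g" "length us = word_length G S g"
    using word_length_attained[OF S g(1)] .
  obtain vs where vs: "set vs \<subseteq> S \<union> m_inv G ` S" "foldr (\<otimes>) vs \<one> = h" "length vs = word_length G S h"
    using word_length_attained[OF S g(2)] .
  have "S \<union> m_inv G ` S \<subseteq> carrier G" using S by auto
  then have "set us \<subseteq> carrier G" "set vs \<subseteq> carrier G" using us(1) vs(1) by (meson order_trans)+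
  then have "foldr (\<otimes>) (us @ vs) \<one> = g \<otimes> h"
    using us(2) vs(2) by (simp only: foldr_mult_append)
  then show ?thesis using word_length_le[of "us @ vs" S] us vs by simp
qed

text \<open>
  If multiplying by a generator changes \<open>\<rho>\<close> only by finitely many elements, then \<open>\<rho>\<close> is Lipschitz.
  Both inequalities of a quasi-isometric embedding follow: with \<open>\<rho>\<close> the inclusion of a subgroup, and
  with \<open>\<rho>\<close> a coarse retraction onto it.
\<close>

lemma word_length_Lipschitz:
  assumes S: "S \<subseteq> carrier G" "finite S" and T: "T \<subseteq> carrier G"
    and \<rho>: "\<And>g. g \<in> generate G S \<Longrightarrow> \<rho> g \<in> generate G T" "\<rho> \<one> = \<one>"
    and fin: "\<And>y. y \<in> S \<union> m_inv G ` S \<Longrightarrow> finite {inv \<rho> g \<otimes> \<rho> (g \<otimes> y) | g. g \<in> generate G S}"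
  shows "\<exists>M. \<forall>g\<in>generate G S. word_length G T (\<rho> g) \<le> M * word_length G S g"
proof -
  let ?D = "\<Union>y\<in>S \<union> m_inv G ` S. {inv \<rho> g \<otimes> \<rho> (g \<otimes> y) | g. g \<in> generate G S}"
  have "finite ?D" using S fin by blast
  from bounded_on_finite[OF this, of "word_length G T"]
  obtain M where M: "\<forall>d\<in>?D. word_length G T d \<le> M" by blast
  have subS: "subgroup (generate G S) G" and subT: "subgroup (generate G T) G"
    using generate_is_subgroup S T by auto
  have letters: "S \<union> m_inv G ` S \<subseteq> generate G S" by (auto intro: generate.incl generate.inv)
  have bound: "foldr (\<otimes>) ws \<one> \<in> generate G S \<and> word_length G T (\<rho> (foldr (\<otimes>) ws \<one>)) \<le> M * length ws"
    if "set ws \<subseteq> S \<union> m_inv G ` S" for ws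
    using that
  proof (induction ws rule: rev_induct)
    case Nil
    then show ?case using \<rho>(2) word_length_le[of "[]" T] generate.one by simp
  next
    case (snoc y ws)
    let ?g = "foldr (\<otimes>) ws \<one>"
    have g: "?g \<in> generate G S" "word_length G T (\<rho> ?g) \<le> M * length ws" using snoc by auto
    have y: "y \<in> S \<union> m_inv G ` S" "y \<in> generate G S" using snoc letters by auto
    have "set ws \<subseteq> carrier G"
      by (rule order_trans[OF _ order_trans[OF letters subgroup.subset[OF subS]]])
        (use snoc.prems in simp)
    then have eq: "foldr (\<otimes>) (ws @ [y]) \<one> = ?g \<otimes> y" using subgroup.mem_carrier[OF subS y(2)] by (subst foldr_mult_append) auto
    have gy: "?g \<otimes> y \<in> generate G S" using g y by (auto intro: generate.eng)
    let ?d = "inv \<rho> ?g \<otimes> \<rho> (?g \<otimes> y)"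
    have "?d \<in> ?D" using g y by blast
    then have d: "word_length G T ?d \<le> M" using M by blast
    have \<rho>c: "\<rho> ?g \<in> generate G T" "\<rho> (?g \<otimes> y) \<in> generate G T" using \<rho> g gy by auto
    then have dT: "?d \<in> generate G T" using subT by (simp add: subgroup.m_closed subgroup.m_inv_closed)
    have "\<rho> (?g \<otimes> y) = \<rho> ?g \<otimes> ?d"
      using \<rho>c[THEN subgroup.mem_carrier[OF subT]] by (simp flip: m_assoc)
    then have "word_length G T (\<rho> (?g \<otimes> y)) \<le> word_length G T (\<rho> ?g) + word_length G T ?d"
      using word_length_mult[OF T \<rho>c(1) dT] by simp
    also have "\<dots> \<le> M * length (ws @ [y])" using g(2) d by simp
    finally show ?case using gy unfolding eq by simp
  qed
  show ?thesis
  proof (intro exI[of _ M] ballI)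
    fix g assume "g \<in> generate G S"
    from word_length_attained[OF S(1) this] obtain ws
      where "set ws \<subseteq> S \<union> m_inv G ` S" "foldr (\<otimes>) ws \<one> = g" "length ws = word_length G S g" .
    then show "word_length G T (\<rho> g) \<le> M * word_length G S g" using bound[of ws] by simp
  qed
qed

lemma word_length_subgroup:
  assumes "subgroup H G" "T \<subseteq> H"
  shows "word_length (G\<lparr>carrier := H\<rparr>) T = word_length G T"
proof -
  have "m_inv (G\<lparr>carrier := H\<rparr>) ` T = m_inv G ` T"
    using m_inv_consistent[OF assms(1)] assms(2) by (intro image_cong) auto
  then show ?thesis by (simp add: word_length_def fun_eq_iff)
qed

lemma coarse_retract_undistorted:
  assumes H: "subgroup H G" and fgG: "finitely_generated G"
    and fgH: "finitely_generated (G\<lparr>carrier := H\<rparr>)"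
    and \<rho>: "\<And>g. g \<in> carrier G \<Longrightarrow> \<rho> g \<in> H" "\<And>h. h \<in> H \<Longrightarrow> \<rho> h = h"
    and fin: "\<And>y. y \<in> carrier G \<Longrightarrow> finite {inv \<rho> g \<otimes> \<rho> (g \<otimes> y) | g. g \<in> carrier G}"
  shows "undistorted H G"
  unfolding undistorted_def
proof (intro conjI allI impI is_group fgG fgH H)
  fix S T
  assume "finite S \<and> S \<subseteq> carrier G \<and> generate G S = carrier G \<and>
    finite T \<and> T \<subseteq> H \<and> generate (G\<lparr>carrier := H\<rparr>) T = H"
  then have S: "finite S" "S \<subseteq> carrier G" "generate G S = carrier G"
    and T: "finite T" "T \<subseteq> H" "generate G T = H"
    using generate_consistent[OF _ H, of T] by auto
  have Tc: "T \<subseteq> carrier G" using T subgroup.subset[OF H] by blast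
  have "\<exists>M. \<forall>g\<in>generate G S. word_length G T (\<rho> g) \<le> M * word_length G S g"
    using S T \<rho> fin subgroup.one_closed[OF H] by (intro word_length_Lipschitz[OF S(2,1) Tc]) auto
  then obtain M where M: "\<And>g. g \<in> carrier G \<Longrightarrow> word_length G T (\<rho> g) \<le> M * word_length G S g"
    unfolding S(3) by blast
  have "\<exists>M. \<forall>g\<in>generate G T. word_length G S (id g) \<le> M * word_length G T g"
  proof (rule word_length_Lipschitz[OF Tc T(1) S(2)])
    fix y assume "y \<in> T \<union> m_inv G ` T"
    then have y: "y \<in> carrier G" using Tc by auto
    have "inv id g \<otimes> id (g \<otimes> y) = y" if "g \<in> generate G T" for g
      using y subgroup.mem_carrier[OF H] that T(3) by (simp flip: m_assoc)
    then have "{inv id g \<otimes> id (g \<otimes> y) | g. g \<in> generate G T} \<subseteq> {y}" by blast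
    then show "finite {inv id g \<otimes> id (g \<otimes> y) | g. g \<in> generate G T}"
      by (rule finite_subset) simp
  next
    show "id g \<in> generate G S" if "g \<in> generate G T" for g
      using that subgroup.mem_carrier[OF H] S T by simp
  qed simp
  then obtain M' where M': "\<And>h. h \<in> H \<Longrightarrow> word_length G S h \<le> M' * word_length G T h"
    unfolding T(3) by auto
  define C where "C = real (Suc (M + M'))"
  have C: "C \<ge> 1" "real M \<le> C" "real M' \<le> C" by (simp_all add: C_def)
  show "quasi_isometric_embedding H (word_metric (G\<lparr>carrier := H\<rparr>) T) (word_metric G S) (\<lambda>x. x)"
    unfolding quasi_isometric_embedding_def
  proof (rule exI[of _ C], rule exI[of _ "0::real"], intro conjI ballI)
    fix x y assume xy: "x \<in> H" "y \<in> H"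
    let ?h = "inv x \<otimes> y"
    have h: "?h \<in> H" "?h \<in> carrier G"
      using xy H subgroup.mem_carrier[OF H] by (simp_all add: subgroup.m_closed subgroup.m_inv_closed)
    have d: "word_metric (G\<lparr>carrier := H\<rparr>) T x y = real (word_length G T ?h)"
      "word_metric G S x y = real (word_length G S ?h)"
      using word_length_subgroup[OF H T(2)] m_inv_consistent[OF H xy(1)]
      by (simp_all add: word_metric_def)
    have "real (word_length G T ?h) \<le> real (M * word_length G S ?h)"
      using M[OF h(2)] \<rho>(2)[OF h(1)] by (intro of_nat_mono) simp
    also have "\<dots> \<le> C * real (word_length G S ?h)" using C by (simp add: mult_right_mono)
    finally show "word_metric (G\<lparr>carrier := H\<rparr>) T x y / C - 0 \<le> word_metric G S x y"
      using C unfolding d by (simp add: field_simps)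
    have "real (word_length G S ?h) \<le> real (M' * word_length G T ?h)"
      using M'[OF h(1)] by (intro of_nat_mono) simp
    also have "\<dots> \<le> C * real (word_length G T ?h)" using C by (simp add: mult_right_mono)
    finally show "word_metric G S x y \<le> C * word_metric (G\<lparr>carrier := H\<rparr>) T x y + 0"
      unfolding d by simp
  qed (use C in auto)
qed

end

text \<open>
  The coarse retraction is \<open>s\<^sup>i f t\<^sup>j \<mapsto> s\<^sup>i \<pi> f\<close> for \<open>f\<close> in the kernel of \<open>p\<close> and \<open>0 \<le> j < m\<close>.  Right
  multiplication by an element \<open>y\<close> of the kernel replaces \<open>f\<close> by \<open>f t\<^sup>j y t\<^sup>-\<^sup>j\<close>.  Right multiplication by
  \<open>t\<close> does not change \<open>f\<close>, except that at \<open>j = m - 1\<close> it completes a factor \<open>t\<^sup>m = s z\<close> with \<open>z\<close> in the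
  kernel; then \<open>i\<close> increases and \<open>f\<close> is replaced by \<open>s\<^sup>-\<^sup>1 f s z\<close>.
\<close>

lemma (in group) fibred_subgroup_undistorted:
  fixes j :: "('s \<times> bool) list \<Rightarrow> 'a" and m :: int
  assumes S: "finite S" and j: "j \<in> hom (free_group S) G" "inj_on j (carrier (free_group S))"
    and p: "p \<in> hom G integer_group" and ker: "j ` carrier (free_group S) = {g \<in> carrier G. p g = 0}"
    and t: "t \<in> carrier G" "p t = 1"
    and s: "s \<in> carrier G" "p s = m" "m \<ge> 1"
    and B: "finite B" "B \<subseteq> carrier G" "\<And>b. b \<in> B \<Longrightarrow> p b = 0"
    and conj: "\<And>(n::int) k. k \<in> generate G B \<Longrightarrow> s [^] n \<otimes> k \<otimes> inv (s [^] n) \<in> generate G B"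
    and H: "subgroup H G" "finitely_generated (G\<lparr>carrier := H\<rparr>)"
      "H = {k \<otimes> s [^] n | k n. k \<in> generate G B \<and> n \<in> (UNIV :: int set)}"
    and fgG: "finitely_generated G"
  shows "undistorted H G"
proof -
  interpret p: group_hom G integer_group p
    using p by (simp add: group_hom_def group_hom_axioms_def is_group)
  let ?K = "generate G B" and ?N = "j ` carrier (free_group S)"
  have K: "subgroup ?K G" by (rule generate_is_subgroup[OF B(2)])
  note Kc = subgroup.mem_carrier[OF K]
  have N: "subgroup ?N G"
    using p.subgroup_kernel by (simp add: ker kernel_def)
  have BN: "B \<subseteq> ?N" using B ker by auto
  have KN: "?K \<subseteq> ?N" by (rule generate_subgroup_incl[OF BN N])
  have normal: "\<forall>g\<in>carrier G. \<forall>n\<in>?N. g \<otimes> n \<otimes> inv g \<in> ?N"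
    by (auto simp: ker p.hom_inv)
  obtain \<pi> where \<pi>: "\<forall>f\<in>?N. \<pi> f \<in> ?K" "\<forall>k\<in>?K. \<pi> k = k"
    and fin: "\<forall>g\<in>carrier G. (\<forall>k\<in>?K. g \<otimes> k \<otimes> inv g \<in> ?K \<and> inv g \<otimes> k \<otimes> g \<in> ?K) \<longrightarrow>
       (\<forall>z\<in>?N. finite {inv (g \<otimes> \<pi> f \<otimes> inv g) \<otimes> \<pi> (g \<otimes> f \<otimes> inv g \<otimes> z) | f. f \<in> ?N})"
    using coarse_projection[OF S j refl normal B(1) BN]
    by (elim exE conjE) (rule that)
  have sc: "s [^] n \<in> carrier G" for n :: int using s by simp
  have tc: "t [^] n \<in> carrier G" for n :: int using t by simp
  have psn: "p (s [^] n) = n * m" "p (t [^] n) = n" for n :: int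
    using s t by (simp_all add: p.hom_int_pow)
  define f where "f g = s [^] (- (p g div m)) \<otimes> g \<otimes> t [^] (- (p g mod m))" for g
  define \<rho> where "\<rho> g = s [^] (p g div m) \<otimes> \<pi> (f g)" for g
  have fN: "f g \<in> ?N" if g: "g \<in> carrier G" for g
  proof -
    have "p (f g) = p g - (p g div m) * m - p g mod m" using g sc tc by (simp add: f_def psn)
    also have "\<dots> = 0" by (simp add: minus_div_mult_eq_mod)
    finally show ?thesis using g sc tc by (simp add: ker f_def)
  qed
  have \<pi>c: "\<pi> n \<in> carrier G" if "n \<in> ?N" for n using \<pi>(1) Kc that by blast
  have Nc: "n \<in> carrier G" if "n \<in> ?N" for n using that ker by blast
  have sH: "s [^] n \<in> H" for n :: int
  proof -
    have "\<one> \<otimes> s [^] n \<in> H" unfolding H(3) using generate.one by blast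
    then show ?thesis using sc by simp
  qed
  have KH: "?K \<subseteq> H"
  proof
    fix k assume k: "k \<in> ?K"
    have "k \<otimes> s [^] (0::int) \<in> H" unfolding H(3) using k by blast
    then show "k \<in> H" using Kc[OF k] by simp
  qed
  show ?thesis
  proof (rule coarse_retract_undistorted[OF H(1) fgG H(2), of \<rho>])
    fix g assume g: "g \<in> carrier G"
    have "\<pi> (f g) \<in> H" using \<pi>(1) fN[OF g] KH by blast
    then show "\<rho> g \<in> H" unfolding \<rho>_def by (intro subgroup.m_closed[OF H(1)] sH)
  next
    fix h assume "h \<in> H"
    then obtain k and n :: int where k: "k \<in> ?K" and h: "h = k \<otimes> s [^] n" unfolding H(3) by blast
    have "p k = 0" using k KN ker by blast
    then have ph: "p h = n * m" using h Kc[OF k] sc psn by simp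
    have "p h div m = n" "p h mod m = 0" using s(3) by (simp_all add: ph)
    then have "f h = s [^] (- n) \<otimes> k \<otimes> inv (s [^] (- n))"
      using Kc[OF k] s by (simp add: f_def h int_pow_neg m_assoc)
    then have "f h \<in> ?K" using conj[OF k, of "- n"] by simp
    then have "\<pi> (f h) = f h" using \<pi>(2) by blast
    then have "\<rho> h = s [^] n \<otimes> (s [^] (- n) \<otimes> h \<otimes> t [^] (0::int))"
      using \<open>p h div m = n\<close> \<open>p h mod m = 0\<close> by (simp add: \<rho>_def f_def)
    also have "\<dots> = h" using Kc[OF k] s by (simp add: h int_pow_neg flip: m_assoc)
    finally show "\<rho> h = h" .
  next
    fix y assume y: "y \<in> carrier G"
    \<comment> \<open>Boundedness of the displacement passes to products and inverses, so it suffices to consider elements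
      of the kernel and \<open>t\<close>.\<close>
    define good where "good y \<longleftrightarrow> finite {inv \<rho> g \<otimes> \<rho> (g \<otimes> y) | g. g \<in> carrier G}" for y
    have \<rho>c: "\<rho> g \<in> carrier G" if "g \<in> carrier G" for g
      unfolding \<rho>_def using sc \<pi>c[OF fN[OF that]] by simp
    have good_mult: "good (y \<otimes> y')" if "good y" "good y'" and c: "y \<in> carrier G" "y' \<in> carrier G" for y y'
    proof -
      let ?D = "\<lambda>y. {inv \<rho> g \<otimes> \<rho> (g \<otimes> y) | g. g \<in> carrier G}"
      have "?D (y \<otimes> y') \<subseteq> (\<lambda>(a, b). a \<otimes> b) ` (?D y \<times> ?D y')"
      proof clarify
        fix g assume g: "g \<in> carrier G"
        have "inv \<rho> g \<otimes> \<rho> (g \<otimes> (y \<otimes> y'))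
            = (inv \<rho> g \<otimes> \<rho> (g \<otimes> y)) \<otimes> (inv \<rho> (g \<otimes> y) \<otimes> \<rho> (g \<otimes> y \<otimes> y'))"
          using g c \<rho>c by (simp add: m_assoc inv_mult_cancel)
        moreover have "inv \<rho> g \<otimes> \<rho> (g \<otimes> y) \<in> ?D y" "inv \<rho> (g \<otimes> y) \<otimes> \<rho> (g \<otimes> y \<otimes> y') \<in> ?D y'"
          using g c by blast+
        ultimately show "inv \<rho> g \<otimes> \<rho> (g \<otimes> (y \<otimes> y')) \<in> (\<lambda>(a, b). a \<otimes> b) ` (?D y \<times> ?D y')"
          by (intro image_eqI[where x = "(inv \<rho> g \<otimes> \<rho> (g \<otimes> y), inv \<rho> (g \<otimes> y) \<otimes> \<rho> (g \<otimes> y \<otimes> y'))"]) simp_all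
      qed
      then show ?thesis
        using that unfolding good_def by (elim finite_subset) (intro finite_imageI finite_cartesian_product)
    qed
    have good_inv: "good (inv y)" if "good y" and c: "y \<in> carrier G" for y
    proof -
      let ?D = "\<lambda>y. {inv \<rho> g \<otimes> \<rho> (g \<otimes> y) | g. g \<in> carrier G}"
      have "?D (inv y) \<subseteq> m_inv G ` ?D y"
      proof clarify
        fix g assume g: "g \<in> carrier G"
        let ?g = "g \<otimes> inv y"
        have "inv \<rho> g \<otimes> \<rho> ?g = inv (inv \<rho> ?g \<otimes> \<rho> (?g \<otimes> y))"
          using g c \<rho>c by (simp add: m_assoc inv_mult_group)
        moreover have "inv \<rho> ?g \<otimes> \<rho> (?g \<otimes> y) \<in> ?D y" using g c by (intro CollectI exI[of _ ?g]) simp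
        ultimately show "inv \<rho> g \<otimes> \<rho> ?g \<in> m_inv G ` ?D y" by (rule image_eqI)
      qed
      then show ?thesis using that unfolding good_def by (elim finite_subset) (rule finite_imageI)
    qed
    have good_N: "good y" if y: "y \<in> ?N" for y
    proof -
      let ?E = "\<lambda>z. {inv (\<one> \<otimes> \<pi> f \<otimes> inv \<one>) \<otimes> \<pi> (\<one> \<otimes> f \<otimes> inv \<one> \<otimes> z) | f. f \<in> ?N}"
      let ?z = "\<lambda>i::int. t [^] i \<otimes> y \<otimes> inv (t [^] i)"
      have zN: "?z i \<in> ?N" for i :: int using normal tc y by blast
      have finE: "finite (?E (?z i))" for i :: int
        using fin[rule_format, OF one_closed _ zN] Kc by simp
      have "{inv \<rho> g \<otimes> \<rho> (g \<otimes> y) | g. g \<in> carrier G} \<subseteq> (\<Union>i\<in>{0..<m}. ?E (?z i))"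
      proof clarify
        fix g assume g: "g \<in> carrier G"
        let ?i = "p g mod m"
        note c = Nc[OF y] fN[OF g] Nc[OF fN[OF g]] \<pi>c[OF fN[OF g]] Nc[OF zN[of ?i]]
        have py: "p y = 0" using y ker by blast
        have pgy: "p (g \<otimes> y) = p g" using g c py by simp
        have fgy: "f (g \<otimes> y) = f g \<otimes> ?z ?i"
          unfolding f_def pgy using g c(1) s(1) t(1)
          by (simp add: m_assoc int_pow_neg inv_mult_cancel)
        have "inv \<rho> g \<otimes> \<rho> (g \<otimes> y) = inv \<pi> (f g) \<otimes> \<pi> (f g \<otimes> ?z ?i)"
          unfolding \<rho>_def fgy pgy using g sc c \<pi>c[OF subgroup.m_closed[OF N c(2) zN]]
          by (simp add: inv_mult_group m_assoc inv_mult_cancel)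
        also have "\<dots> = inv (\<one> \<otimes> \<pi> (f g) \<otimes> inv \<one>) \<otimes> \<pi> (\<one> \<otimes> f g \<otimes> inv \<one> \<otimes> ?z ?i)"
          using c by simp
        also have "\<dots> \<in> ?E (?z ?i)" using c(2) by blast
        finally show "inv \<rho> g \<otimes> \<rho> (g \<otimes> y) \<in> (\<Union>i\<in>{0..<m}. ?E (?z i))"
          using s(3) by (intro UN_I[of ?i]) auto
      qed
      then show ?thesis unfolding good_def using finE by (elim finite_subset) auto
    qed
    have good_t: "good t"
    proof -
      let ?c = "inv s"
      let ?z = "inv s \<otimes> t [^] m"
      have zN: "?z \<in> ?N" using s t by (simp add: ker psn p.hom_inv)
      let ?E = "{inv (?c \<otimes> \<pi> f \<otimes> inv ?c) \<otimes> \<pi> (?c \<otimes> f \<otimes> inv ?c \<otimes> ?z) | f. f \<in> ?N}"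
      have "\<forall>k\<in>?K. ?c \<otimes> k \<otimes> inv ?c \<in> ?K \<and> inv ?c \<otimes> k \<otimes> ?c \<in> ?K"
        using conj[of _ 1] conj[of _ "- 1"] s by (simp add: int_pow_neg)
      then have finE: "finite ?E" using fin[rule_format, OF _ _ zN, of ?c] s by simp
      have "{inv \<rho> g \<otimes> \<rho> (g \<otimes> t) | g. g \<in> carrier G} \<subseteq> {\<one>} \<union> (\<lambda>x. s \<otimes> x) ` ?E"
      proof clarify
        fix g assume g: "g \<in> carrier G" and not: "inv \<rho> g \<otimes> \<rho> (g \<otimes> t) \<notin> (\<lambda>x. s \<otimes> x) ` ?E"
        note c = fN[OF g] Nc[OF fN[OF g]] \<pi>c[OF fN[OF g]]
        have pgt: "p (g \<otimes> t) = p g + 1" using g t by simp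
        show "inv \<rho> g \<otimes> \<rho> (g \<otimes> t) = \<one>"
        proof (cases "p g mod m = m - 1")
          case False
          then have lt: "p g mod m + 1 < m" using pos_mod_bound[of m "p g"] s(3) by linarith
          have eq: "p g + 1 = m * (p g div m) + (p g mod m + 1)" by simp
          have nn: "0 \<le> p g mod m + 1" using pos_mod_sign[of m "p g"] s(3) by linarith
          have dm: "(p g + 1) div m = p g div m" "(p g + 1) mod m = p g mod m + 1"
            using int_div_pos_eq[OF eq nn lt] int_mod_pos_eq[OF eq nn lt] by auto
          have "t \<otimes> t [^] (- (p g mod m + 1)) = t [^] (- (p g mod m))"
            using t int_pow_mult[of t 1 "- (p g mod m + 1)"] by simp
          then have "f (g \<otimes> t) = f g"
            unfolding f_def pgt dm using g t sc tc by (simp only: m_assoc m_closed)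
          then show ?thesis unfolding \<rho>_def pgt dm using c sc by simp
        next
          case True
          moreover have "m * (p g div m + 1) = m * (p g div m) + m" by (simp add: distrib_left)
          ultimately have "p g + 1 = m * (p g div m + 1)"
            using mult_div_mod_eq[of m "p g"] by linarith
          then have dm: "(p g + 1) div m = p g div m + 1" "(p g + 1) mod m = 0" using s(3) by simp_all
          have tt: "t [^] (- (m - 1)) \<otimes> t [^] m = t"
            using t int_pow_mult[of t "- (m - 1)" m] by simp
          have ss: "s [^] (- (p g div m + 1)) = ?c \<otimes> s [^] (- (p g div m))"
          proof -
            have e: "- (p g div m + 1) = - 1 + - (p g div m)" by simp
            show ?thesis unfolding e using s(1) by (simp only: int_pow_mult int_pow_neg int_pow_1)
          qed
          have "?c \<otimes> f g \<otimes> inv ?c \<otimes> ?z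
              = ?c \<otimes> s [^] (- (p g div m)) \<otimes> g \<otimes> (t [^] (- (m - 1)) \<otimes> t [^] m)"
            unfolding f_def True using g s(1) sc tc
            by (simp add: m_assoc inv_mult_cancel del: minus_diff_eq)
          also have "\<dots> = f (g \<otimes> t)"
            unfolding f_def pgt dm tt ss using g t s sc by (simp add: m_assoc)
          finally have fgt: "f (g \<otimes> t) = ?c \<otimes> f g \<otimes> inv ?c \<otimes> ?z" ..
          have sq: "s [^] (p g div m + 1) = s [^] (p g div m) \<otimes> s"
            using s(1) by (simp only: int_pow_mult int_pow_1)
          have "inv \<rho> g \<otimes> \<rho> (g \<otimes> t)
              = s \<otimes> (inv (?c \<otimes> \<pi> (f g) \<otimes> inv ?c) \<otimes> \<pi> (f (g \<otimes> t)))"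
            unfolding \<rho>_def pgt dm sq using c s(1) sc \<pi>c[OF fN[OF m_closed[OF g t(1)]]]
            by (simp add: m_assoc inv_mult_group inv_mult_cancel)
          also have "\<dots> = s \<otimes> (inv (?c \<otimes> \<pi> (f g) \<otimes> inv ?c) \<otimes>
              \<pi> (?c \<otimes> f g \<otimes> inv ?c \<otimes> ?z))"
            by (simp only: fgt)
          finally have "inv \<rho> g \<otimes> \<rho> (g \<otimes> t) = \<dots>" .
          then show ?thesis using not c(1) by blast
        qed
      qed
      then show ?thesis unfolding good_def using finE by (elim finite_subset) auto
    qed
    have good_pow: "good (t [^] n)" for n :: nat
    proof (induction n)
      case 0
      have "\<one> \<in> ?N" using subgroup.one_closed[OF N] .
      then show ?case using good_N by simp
    next
      case (Suc n)
      then show ?case using good_mult good_t t by simp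
    qed
    have good_int_pow: "good (t [^] n)" for n :: int
      using good_pow good_inv[OF good_pow nat_pow_closed[OF t(1)]] t(1)
      by (cases n rule: int_cases2) (simp_all only: int_pow_int int_pow_neg_int)
    have yN: "y \<otimes> t [^] (- p y) \<in> ?N" using y tc by (simp add: ker psn)
    have "y = (y \<otimes> t [^] (- p y)) \<otimes> t [^] p y" using y t by (simp add: m_assoc int_pow_neg)
    then show "finite {inv \<rho> g \<otimes> \<rho> (g \<otimes> y) | g. g \<in> carrier G}"
      using good_mult[OF good_N[OF yN] good_int_pow[of "p y"] Nc[OF yN] tc] by (simp add: good_def)
  qed
qed

section \<open>The dichotomy for two-generator subgroups\<close>

text \<open>
  The action of \<open>\<int>\<close> is conjugation by powers of \<open>s\<close>, read in the coordinates that the basis \<open>f\<close> provides;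
  the homomorphism \<open>p\<close> makes the exponent of \<open>s\<close> in \<open>v s\<^sup>n\<close> unique.
\<close>

lemma (in group) fg_free_by_cyclic_if_split:
  fixes k :: nat
  assumes p: "p \<in> hom G integer_group" and s: "s \<in> carrier G" "p s \<noteq> 0"
    and f: "free_family G {..<k} f" "\<And>i. i < k \<Longrightarrow> p (f i) = 0"
    and conj: "\<And>(n::int) v. v \<in> generate G (f ` {..<k}) \<Longrightarrow>
      s [^] n \<otimes> v \<otimes> inv (s [^] n) \<in> generate G (f ` {..<k})"
    and H: "subgroup H G"
      "H = {v \<otimes> s [^] n | v n. v \<in> generate G (f ` {..<k}) \<and> n \<in> (UNIV :: int set)}"
  shows "fg_free_by_cyclic (G\<lparr>carrier := H\<rparr>)"
proof -
  interpret p: group_hom G integer_group p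
    using p by (simp add: group_hom_def group_hom_axioms_def is_group)
  let ?R = "free_group {..<k}" and ?K = "generate G (f ` {..<k})" and ?e = "eval_word G f"
  note [simp del] = mult_free_group in_carrier_free_group
  interpret R: group ?R by (rule group_free_group)
  have fc: "f \<in> {..<k} \<rightarrow> carrier G" and inj: "inj_on ?e (carrier ?R)"
    using f(1) by (auto simp: free_family_def)
  interpret e: group_hom ?R G ?e using eval_word_hom[OF fc] by unfold_locales
  have eK: "?e ` carrier ?R = ?K" by (rule eval_word_image[OF fc])
  define i where "i = inv_into (carrier ?R) ?e"
  have i: "i v \<in> carrier ?R" "?e (i v) = v" if "v \<in> ?K" for v
    using that unfolding eK[symmetric] i_def by (auto intro: inv_into_into f_inv_into_f)
  have ie: "i (?e w) = w" if "w \<in> carrier ?R" for w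
    using that inj unfolding i_def by simp
  have eK': "?e w \<in> ?K" if "w \<in> carrier ?R" for w using that eK by blast
  have sc: "s [^] n \<in> carrier G" for n :: int using s by simp
  define \<theta> where "\<theta> n = (\<lambda>w\<in>carrier ?R. i (s [^] n \<otimes> ?e w \<otimes> inv (s [^] n)))" for n :: int
  have \<theta>: "\<theta> n w \<in> carrier ?R" "?e (\<theta> n w) = s [^] n \<otimes> ?e w \<otimes> inv (s [^] n)"
    if "w \<in> carrier ?R" for n w
    using that i[OF conj[OF eK'[OF that]]] by (simp_all add: \<theta>_def)
  have eqI: "u = v" if "u \<in> carrier ?R" "v \<in> carrier ?R" "?e u = ?e v" for u v
    using inj that by (auto dest: inj_onD)
  have \<theta>_add: "\<theta> (n + n') w = \<theta> n (\<theta> n' w)" if w: "w \<in> carrier ?R" for n n' w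
    by (rule eqI) (use w s in \<open>simp_all add: \<theta> int_pow_mult inv_mult_group m_assoc\<close>)
  have \<theta>_0: "\<theta> 0 w = w" if w: "w \<in> carrier ?R" for w
    by (rule eqI) (use w in \<open>simp_all add: \<theta>\<close>)
  have \<theta>_mult: "\<theta> n (u \<otimes>\<^bsub>?R\<^esub> v) = \<theta> n u \<otimes>\<^bsub>?R\<^esub> \<theta> n v" if "u \<in> carrier ?R" "v \<in> carrier ?R" for n u v
    by (rule eqI) (use that s in \<open>simp_all add: \<theta> m_assoc inv_mult_cancel\<close>)
  have \<theta>_bij: "bij_betw (\<theta> n) (carrier ?R) (carrier ?R)" for n
    by (rule bij_betwI[where g = "\<theta> (- n)"]) (use \<theta> \<theta>_add[of _ n "- n"] \<theta>_add[of _ "- n" n] \<theta>_0 in auto)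
  have \<theta>_auto: "\<theta> n \<in> auto ?R" for n
    using \<theta>_bij[of n] \<theta> \<theta>_mult by (auto simp: auto_def Bij_def hom_def) (simp add: \<theta>_def)
  interpret A: group "AutoGroup ?R" by (rule R.AutoGroup)
  have \<theta>_hom: "\<theta> \<in> hom integer_group (AutoGroup ?R)"
  proof (rule homI)
    fix n n' :: int
    have "\<theta> (n + n') = compose (carrier ?R) (\<theta> n) (\<theta> n')"
    proof
      fix w
      show "\<theta> (n + n') w = compose (carrier ?R) (\<theta> n) (\<theta> n') w"
        by (cases "w \<in> carrier ?R") (simp_all add: \<theta>_add compose_def, simp add: \<theta>_def)
    qed
    then show "\<theta> (n \<otimes>\<^bsub>integer_group\<^esub> n') = \<theta> n \<otimes>\<^bsub>AutoGroup ?R\<^esub> \<theta> n'"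
      using \<theta>_auto[of n] \<theta>_auto[of n'] by (simp add: AutoGroup_def BijGroup_def auto_def)
  qed (use \<theta>_auto in \<open>simp add: carrier_AutoGroup\<close>)
  let ?P = "semidirect_product ?R integer_group \<theta>"
  interpret P: group ?P by (rule group_semidirect_product[OF R.is_group group_integer_group \<theta>_hom])
  define \<Phi> where "\<Phi> = (\<lambda>(w, n). ?e w \<otimes> s [^] (n::int))"
  have "\<Phi> \<in> iso ?P (G\<lparr>carrier := H\<rparr>)"
  proof (rule isoI)
    show "\<Phi> \<in> hom ?P (G\<lparr>carrier := H\<rparr>)"
    proof (rule homI)
      fix x assume "x \<in> carrier ?P"
      then show "\<Phi> x \<in> carrier (G\<lparr>carrier := H\<rparr>)"
        using eK' by (auto simp: \<Phi>_def semidirect_product_def H(2))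
    next
      fix x y assume "x \<in> carrier ?P" "y \<in> carrier ?P"
      then obtain u v m n where xy: "x = (u, m)" "y = (v, n)" "u \<in> carrier ?R" "v \<in> carrier ?R"
        by (auto simp: semidirect_product_def)
      show "\<Phi> (x \<otimes>\<^bsub>?P\<^esub> y) = \<Phi> x \<otimes>\<^bsub>G\<lparr>carrier := H\<rparr>\<^esub> \<Phi> y"
        using xy(3,4) s
        by (simp add: \<Phi>_def xy(1,2) semidirect_product_def \<theta> m_assoc int_pow_mult inv_mult_cancel)
    qed
    show "bij_betw \<Phi> (carrier ?P) (carrier (G\<lparr>carrier := H\<rparr>))"
      unfolding bij_betw_def
    proof (intro conjI inj_onI)
      fix x y assume "x \<in> carrier ?P" "y \<in> carrier ?P" and eq: "\<Phi> x = \<Phi> y"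
      then obtain u v m n where xy: "x = (u, m)" "y = (v, n)" "u \<in> carrier ?R" "v \<in> carrier ?R"
        by (auto simp: semidirect_product_def)
      have pK: "p v = 0" if "v \<in> ?K" for v
      proof -
        have "f ` {..<k} \<subseteq> kernel G integer_group p" using f(2) fc by (auto simp: kernel_def)
        then have "?K \<subseteq> kernel G integer_group p" by (rule generate_subgroup_incl[OF _ p.subgroup_kernel])
        then show ?thesis using that by (auto simp: kernel_def)
      qed
      have eq': "?e u \<otimes> s [^] m = ?e v \<otimes> s [^] n" using eq by (simp add: \<Phi>_def xy)
      have "p (?e u \<otimes> s [^] m) = m * p s" "p (?e v \<otimes> s [^] n) = n * p s"
        using xy(3,4) s pK[OF eK'] by (simp_all add: p.hom_int_pow)
      then have "m = n" using eq' s(2) by simp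
      moreover have "?e u = ?e v" using eq' xy(3,4) s by (simp add: \<open>m = n\<close>)
      ultimately show "x = y" using eqI[OF xy(3,4)] xy by simp
    next
      show "\<Phi> ` carrier ?P = carrier (G\<lparr>carrier := H\<rparr>)"
        unfolding H(2) eK[symmetric] by (auto simp: \<Phi>_def semidirect_product_def image_iff)
    qed
  qed
  then have "G\<lparr>carrier := H\<rparr> \<cong> ?P" using P.iso_sym is_isoI by blast
  then show ?thesis
    unfolding fg_free_by_cyclic_def using subgroup_imp_group[OF H(1)] \<theta>_hom by blast
qed

lemma (in group) cyclic_group_generate_singleton:
  assumes "c \<in> carrier G"
  shows "cyclic_group (G\<lparr>carrier := generate G {c}\<rparr>)"
proof -
  have C: "subgroup (generate G {c}) G" using assms by (intro generate_is_subgroup) simp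
  interpret C: group "G\<lparr>carrier := generate G {c}\<rparr>" by (rule subgroup_imp_group[OF C])
  have c: "c \<in> generate G {c}" by (simp add: generate.incl)
  have "generate G {c} = range (\<lambda>n::int. c [^] n)" using generate_pow[OF assms] by auto
  also have "\<dots> = range (\<lambda>n::int. c [^]\<^bsub>G\<lparr>carrier := generate G {c}\<rparr>\<^esub> n)"
    using int_pow_consistent[OF C c] by simp
  finally show ?thesis unfolding C.cyclic_group using c by auto
qed

lemma (in group) free_family_lessThan:
  assumes "free_family G I f" "finite I"
  shows "\<exists>f'. free_family G {..<card I} f' \<and> f' ` {..<card I} = f ` I"
proof -
  obtain \<pi> where \<pi>: "bij_betw \<pi> {..<card I} I"
    using ex_bij_betw_nat_finite[OF assms(2)] by (auto simp: atLeast0LessThan)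
  then have "free_family G {..<card I} (\<lambda>i. f (\<pi> i))"
    by (intro free_family_reindex[OF assms(1)]) (auto simp: bij_betw_def)
  moreover have "(\<lambda>i. f (\<pi> i)) ` {..<card I} = f ` I"
    using \<pi> by (auto simp: bij_betw_def image_image[symmetric])
  ultimately show ?thesis by blast
qed

lemma (in group) two_generator_subgroup_of_free:
  assumes "a \<in> carrier G" "b \<in> carrier G"
    and f: "free_family G I f" "generate G (f ` I) = generate G {a, b}"
    and nc: "\<not> cyclic_group (G\<lparr>carrier := generate G {a, b}\<rparr>)"
  shows "free_of_rank (G\<lparr>carrier := generate G {a, b}\<rparr>) 2"
proof -
  let ?y = "\<lambda>i::nat. if i = 0 then a else b"
  have "{..<2::nat} = {0, 1}" by auto
  then have y: "?y \<in> {..<2} \<rightarrow> carrier G" "?y ` {..<2} = {a, b}" using assms(1,2) by auto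
  have le: "card I\<^sub>0 \<le> 2" if "I\<^sub>0 \<subseteq> I" "finite I\<^sub>0" for I\<^sub>0
    using free_family_card_le[OF f(1) y(1) _ _ that] f(2) y(2) by simp
  have fin: "finite I"
  proof (rule ccontr)
    assume "infinite I"
    then obtain I0 where "I0 \<subseteq> I" "finite I0" "card I0 = 3" using infinite_arbitrarily_large by blast
    then show False using le[of I0] by simp
  qed
  have "\<not> card I \<le> 1"
  proof
    assume "card I \<le> 1"
    then consider "I = {}" | i where "I = {i}"
      using fin by (metis One_nat_def card_0_eq card_1_singletonE le_Suc_eq le_zero_eq)
    then show False
    proof cases
      case 1
      then have "generate G {a, b} = generate G {\<one>}" using f(2) generate_empty generate_one by simp
      then show False using nc cyclic_group_generate_singleton[OF one_closed] by simp
    next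
      case 2
      then have "f i \<in> carrier G" using f(1) by (auto simp: free_family_def)
      then show False using nc cyclic_group_generate_singleton[of "f i"] f(2) 2 by simp
    qed
  qed
  then have "card I = 2" using le[OF order_refl fin] by simp
  then obtain f' where "free_family G {..<2::nat} f'" "f' ` {..<2::nat} = f ` I"
    using free_family_lessThan[OF f(1) fin] by auto
  then show ?thesis using free_family_free_of_rank[of 2 f'] f(2) by simp
qed

text \<open>
  The theorem for any group \<open>G\<close> with a split homomorphism \<open>p\<close> to \<open>\<int>\<close> whose kernel is free of finite rank;
  the embedding \<open>j\<close> supplies a basis of the kernel.
\<close>

lemma (in group) two_generator_dichotomy:
  fixes j :: "(nat \<times> bool) list \<Rightarrow> 'a"
  assumes S: "finite S" and j: "j \<in> hom (free_group S) G" "inj_on j (carrier (free_group S))"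
    and p: "p \<in> hom G integer_group" and ker: "j ` carrier (free_group S) = {g \<in> carrier G. p g = 0}"
    and t: "t \<in> carrier G" "p t = 1" and fgG: "finitely_generated G"
    and ab: "a \<in> carrier G" "b \<in> carrier G" and H: "H = generate G {a, b}"
    and nc: "\<not> cyclic_group (G\<lparr>carrier := H\<rparr>)"
  shows "free_of_rank (G\<lparr>carrier := H\<rparr>) 2 \<or>
    (undistorted H G \<and> fg_free_by_cyclic (G\<lparr>carrier := H\<rparr>) \<and>
     (\<exists>s\<in>carrier G. p s \<ge> 1 \<and> (\<exists>B. finite B \<and> generate G B \<noteq> {\<one>} \<and>
        generate G B \<subseteq> {g \<in> carrier G. p g = 0} \<and> B \<subseteq> carrier G \<and>
        H = generate G (insert s (generate G B)) \<and>
        (\<forall>k\<in>generate G B. s \<otimes> k \<otimes> inv s \<in> generate G B))))"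
proof -
  interpret p: group_hom G integer_group p
    using p by (simp add: group_hom_def group_hom_axioms_def is_group)
  have N: "subgroup (j ` carrier (free_group S)) G"
    using p.subgroup_kernel by (simp add: ker kernel_def)
  obtain s x where s: "s \<in> carrier G" "p s \<ge> 0" and x: "x \<in> carrier G" "p x = 0"
    and gen: "generate G {a, b} = generate G {s, x}"
    using euclid_on_generating_pair[OF p ab] by blast
  have Hsx: "H = generate G {s, x}" using gen H by simp
  have subH: "subgroup H G" unfolding H using ab by (intro generate_is_subgroup) auto
  have fgH: "finitely_generated (G\<lparr>carrier := H\<rparr>)"
    unfolding finitely_generated_def
  proof (intro exI[of _ "{a, b}"] conjI)
    show ab': "{a, b} \<subseteq> carrier (G\<lparr>carrier := H\<rparr>)" unfolding H by (auto intro: generate.incl)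
    show "generate (G\<lparr>carrier := H\<rparr>) {a, b} = carrier (G\<lparr>carrier := H\<rparr>)"
      using generate_consistent[OF _ subH, of "{a, b}"] ab' H by simp
  qed simp
  have x1: "x \<noteq> \<one>"
  proof
    assume "x = \<one>"
    have "generate G {s, x} = generate G {s}"
    proof (rule equalityI)
      have "subgroup (generate G {s}) G" using s by (intro generate_is_subgroup) simp
      then show "generate G {s, x} \<subseteq> generate G {s}"
        by (rule generate_subgroup_incl[rotated]) (auto simp: \<open>x = \<one>\<close> intro: generate.incl generate.one)
    qed (rule mono_generate, simp)
    then show False using nc cyclic_group_generate_singleton[OF s(1)] Hsx by simp
  qed
  show ?thesis
  proof (cases "p s = 0")
    case True
    have "H \<subseteq> j ` carrier (free_group S)"
      unfolding Hsx by (rule generate_subgroup_incl[OF _ N]) (use s x True ker in auto)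
    from subgroups_of_embedded_free_group[OF j subH this]
    obtain I :: "((nat \<times> bool) list \<times> nat) set" and f
      where "free_family G I f" "generate G (f ` I) = H" by blast
    then show ?thesis using two_generator_subgroup_of_free[OF ab, of I f] nc H by simp
  next
    case False
    then have m: "p s \<ge> 1" using s by simp
    define y where "y i = s [^] i \<otimes> x \<otimes> inv (s [^] i)" for i :: int
    let ?K = "generate G (range y)"
    have y: "y \<in> UNIV \<rightarrow> carrier G" "range y \<subseteq> carrier G" using s x by (auto simp: y_def)
    have "y 0 = x" using x by (simp add: y_def)
    then have xK: "x \<in> ?K" using generate.incl[OF rangeI[of y 0], of G] by simp
    have py: "p (y i) = 0" for i
      using s x by (simp add: y_def p.hom_int_pow p.hom_inv)
    have yN: "range y \<subseteq> j ` carrier (free_group S)" using y py ker by auto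
    have KN: "?K \<subseteq> j ` carrier (free_group S)" by (rule generate_subgroup_incl[OF yN N])
    have K: "subgroup ?K G" by (rule generate_is_subgroup[OF y(2)])
    have conj: "s [^] n \<otimes> k \<otimes> inv (s [^] n) \<in> ?K" if "k \<in> ?K" for k and n :: int
      using conj_generate_translates[OF s(1) x(1), of k n] that by (simp add: y_def)
    have HK: "H = {k \<otimes> s [^] n | k n. k \<in> ?K \<and> n \<in> (UNIV :: int set)}"
      using generate_pair_normal_form[OF s(1) x(1)] Hsx by (simp add: y_def)
    obtain I :: "((nat \<times> bool) list \<times> nat) set" and f
      where f: "free_family G I f" "generate G (f ` I) = ?K"
      using subgroups_of_embedded_free_group[OF j K KN] by blast
    show ?thesis
    proof (cases "finite I")
      case False
      have "free_family G UNIV y"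
      proof (rule translates_free_if_infinite_rank[OF y(1) _ _ f False])
        fix n :: int
        show "\<exists>\<sigma>\<in>hom (G\<lparr>carrier := ?K\<rparr>) (G\<lparr>carrier := ?K\<rparr>). \<forall>i. \<sigma> (y i) = y (i + n)"
          using conjugation_shifts_translates[OF s(1) x(1)] by (simp add: y_def)
      next
        fix L assume "subgroup L G" "L \<subseteq> ?K"
        then show "\<exists>(I :: ((nat \<times> bool) list \<times> nat) set) f. free_family G I f \<and> generate G (f ` I) = L"
          using subgroups_of_embedded_free_group[OF j] KN by blast
      qed
      then have "free_family G {..<2::nat} (\<lambda>i. if i = 0 then s else x)"
        using free_pair_of_free_translates[OF s(1) x(1) p x(2)] m unfolding y_def by simp
      from free_family_free_of_rank[OF this]
      have "free_of_rank (G\<lparr>carrier := generate G ((\<lambda>i. if i = 0 then s else x) ` {..<2::nat})\<rparr>) 2" .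
      moreover have "(\<lambda>i. if i = 0 then s else x) ` {..<2::nat} = {s, x}"
      proof -
        have "{..<2::nat} = {0, 1}" by auto
        then show ?thesis by auto
      qed
      ultimately show ?thesis using Hsx by simp
    next
      case True
      have fc: "f ` I \<subseteq> carrier G" using f(1) by (auto simp: free_family_def)
      have fK: "f ` I \<subseteq> ?K" unfolding f(2)[symmetric] by (auto intro: generate.incl)
      have pf: "p v = 0" if "v \<in> ?K" for v using that KN ker by blast
      have "undistorted H G"
      proof (rule fibred_subgroup_undistorted[OF S j p ker t s(1) refl m _ _ _ _ subH fgH _ fgG])
        show "finite (f ` I)" using True by simp
        show "p b = 0" if "b \<in> f ` I" for b using that fK pf by blast
        show "s [^] n \<otimes> k \<otimes> inv (s [^] n) \<in> generate G (f ` I)" if "k \<in> generate G (f ` I)"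
          for k and n :: int
          using conj that unfolding f(2) .
        show "H = {k \<otimes> s [^] n | k n. k \<in> generate G (f ` I) \<and> n \<in> (UNIV :: int set)}"
          unfolding f(2) by (rule HK)
      qed (rule fc)
      moreover have "fg_free_by_cyclic (G\<lparr>carrier := H\<rparr>)"
      proof -
        obtain f' where f': "free_family G {..<card I} f'" "f' ` {..<card I} = f ` I"
          using free_family_lessThan[OF f(1) True] by blast
        have pf': "p (f' i) = 0" if "i < card I" for i using that f'(2) fK pf by blast
        show ?thesis
        proof (rule fg_free_by_cyclic_if_split[OF p s(1) False f'(1) pf' _ subH])
          show "s [^] n \<otimes> k \<otimes> inv (s [^] n) \<in> generate G (f' ` {..<card I})"
            if "k \<in> generate G (f' ` {..<card I})" for k and n :: int
            using conj that unfolding f'(2) f(2) .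
          show "H = {k \<otimes> s [^] n | k n. k \<in> generate G (f' ` {..<card I}) \<and> n \<in> (UNIV :: int set)}"
            unfolding f'(2) f(2) by (rule HK)
        qed
      qed
      moreover have "H = generate G (insert s ?K)"
      proof (rule equalityI)
        show "H \<subseteq> generate G (insert s ?K)" unfolding Hsx using xK by (intro mono_generate) auto
        have sH: "s \<in> H" unfolding Hsx by (simp add: generate.incl)
        have "?K \<subseteq> H"
        proof
          fix k assume k: "k \<in> ?K"
          then have "k \<otimes> s [^] (0::int) \<in> H" unfolding HK by blast
          then show "k \<in> H" using subgroup.mem_carrier[OF K k] by simp
        qed
        then show "generate G (insert s ?K) \<subseteq> H" using sH by (intro generate_subgroup_incl[OF _ subH]) auto
      qed
      moreover have "?K \<noteq> {\<one>}" using xK x1 by auto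
      moreover have "s \<otimes> k \<otimes> inv s \<in> ?K" if "k \<in> ?K" for k
        using conj[OF that, of 1] s by simp
      moreover have "?K \<subseteq> {g \<in> carrier G. p g = 0}" using KN unfolding ker .
      ultimately show ?thesis
        using True fc m s(1) f(2)
        by (intro disjI2 conjI bexI[of _ s] exI[of _ "f ` I"]) simp_all
    qed
  qed
qed

section \<open>Mapping tori of free groups\<close>

theorem corollary2:
  fixes F :: "('a, 'b) monoid_scheme" and \<phi> :: "'a \<Rightarrow> 'a" and r :: nat
    and H :: "('a \<times> int) set"
  assumes "free_of_rank F r"
    and "\<phi> \<in> carrier (AutoGroup F)"
    and "two_generator_subgroup H (mapping_torus F \<phi>)"
    and "\<not> cyclic_group (mapping_torus F \<phi> \<lparr>carrier := H\<rparr>)"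
  shows "free_of_rank (mapping_torus F \<phi> \<lparr>carrier := H\<rparr>) 2 \<or>
    (undistorted H (mapping_torus F \<phi>) \<and>
     fg_free_by_cyclic (mapping_torus F \<phi> \<lparr>carrier := H\<rparr>) \<and>
     sub_mapping_torus F \<phi> H)"
proof -
  let ?G = "mapping_torus F \<phi>" and ?R = "free_group {..<r}" and ?t = "stable_letter F"
  note [simp del] = mult_free_group in_carrier_free_group
  have F: "group F" using assms(1) by (simp add: free_of_rank_def)
  interpret F: group F by (rule F)
  interpret R: group ?R by (rule group_free_group)
  interpret G: group ?G by (rule group_mapping_torus[OF F assms(2)])
  have carrG: "carrier ?G = carrier F \<times> UNIV" and oneG: "\<one>\<^bsub>?G\<^esub> = (\<one>\<^bsub>F\<^esub>, 0)"
    and sndG: "snd (g \<otimes>\<^bsub>?G\<^esub> h) = snd g + snd h" for g h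
    by (auto simp: mapping_torus_def semidirect_product_def split: prod.splits)
  have fibre_t: "fibre F u \<otimes>\<^bsub>?G\<^esub> (\<one>\<^bsub>F\<^esub>, n) = (u, n)" if "u \<in> carrier F" for u n
    using that by (simp add: fibre_def mapping_torus_def semidirect_product_def one_AutoGroup_apply)
  have p: "snd \<in> hom ?G integer_group" by (auto simp: hom_def sndG)
  interpret p: group_hom ?G integer_group snd
    using p by (simp add: group_hom_def group_hom_axioms_def G.is_group)
  have t: "?t \<in> carrier ?G" "snd ?t = 1" by (auto simp: carrG stable_letter_def)
  have tpow: "?t [^]\<^bsub>?G\<^esub> n = (\<one>\<^bsub>F\<^esub>, int n)" for n :: nat
  proof (induction n)
    case (Suc n)
    have "(\<phi> [^]\<^bsub>AutoGroup F\<^esub> int n) \<one>\<^bsub>F\<^esub> = \<one>\<^bsub>F\<^esub>"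
    proof -
      interpret A: group "AutoGroup F" by (rule F.AutoGroup)
      have "\<phi> [^]\<^bsub>AutoGroup F\<^esub> int n \<in> auto F"
        using A.int_pow_closed[OF assms(2)] by (simp add: carrier_AutoGroup)
      then show ?thesis using hom_one[OF _ F F] by (simp add: auto_def)
    qed
    then show ?case
      using Suc by (simp add: stable_letter_def mapping_torus_def semidirect_product_def)
  qed (simp add: oneG)
  have fibre: "fibre F \<in> hom F ?G" by (rule fibre_hom[OF F assms(2)])
  interpret fib: group_hom F ?G "fibre F" using fibre by unfold_locales
  obtain j0 where j0: "j0 \<in> iso ?R F"
    using assms(1) F.iso_sym by (auto simp: free_of_rank_def is_iso_def)
  define j where "j w = fibre F (j0 w)" for w
  have j0': "j0 \<in> hom ?R F" "inj_on j0 (carrier ?R)" "j0 ` carrier ?R = carrier F"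
    using j0 by (auto simp: iso_def bij_betw_def)
  have jhom: "j \<in> hom ?R ?G"
    using hom_compose[OF j0'(1) fibre] by (simp add: j_def[abs_def] o_def)
  have jinj: "inj_on j (carrier ?R)" using j0'(2) by (auto simp: inj_on_def j_def fibre_def)
  have ker: "j ` carrier ?R = {g \<in> carrier ?G. snd g = 0}"
  proof -
    have "j ` carrier ?R = fibre F ` carrier F" unfolding j0'(3)[symmetric] by (simp add: j_def image_image)
    also have "\<dots> = {g \<in> carrier ?G. snd g = 0}" by (auto simp: fibre_def carrG)
    finally show ?thesis .
  qed
  have fgG: "finitely_generated ?G"
    unfolding finitely_generated_def
  proof (intro exI[of _ "insert ?t ((\<lambda>i. j [(i, True)]) ` {..<r})"] conjI)
    let ?B = "insert ?t ((\<lambda>i. j [(i, True)]) ` {..<r})"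
    let ?x = "\<lambda>i. [(i, True)]"
    have xc: "?x \<in> {..<r} \<rightarrow> carrier ?R" by (simp add: in_carrier_free_group)
    have jx: "j (?x i) \<in> carrier ?G" if "i < r" for i
      using that xc hom_in_carrier[OF jhom] by auto
    show B: "?B \<subseteq> carrier ?G" using t jx by auto
    have subB: "subgroup (generate ?G ?B) ?G" by (rule G.generate_is_subgroup[OF B])
    have gR: "carrier ?R = generate ?R (?x ` {..<r})"
      unfolding R.eval_word_image[OF xc, symmetric]
      by (rule trans[OF image_ident[symmetric] image_cong[OF refl eval_word_free_group_generators[symmetric]]])
    interpret j: group_hom ?R ?G j using jhom by unfold_locales
    have "?x ` {..<r} \<subseteq> carrier ?R" using xc by auto
    from j.generate_img[OF this] have "j ` carrier ?R = generate ?G (j ` ?x ` {..<r})"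
      unfolding gR[symmetric] by (rule sym)
    also have "\<dots> \<subseteq> generate ?G ?B" by (rule G.mono_generate) auto
    finally have NB: "j ` carrier ?R \<subseteq> generate ?G ?B" .
    have tB: "?t \<in> generate ?G ?B" by (simp add: generate.incl)
    show "generate ?G ?B = carrier ?G"
    proof (rule equalityI[OF G.generate_incl[OF B]], rule subsetI)
      fix g assume g: "g \<in> carrier ?G"
      have tn: "?t [^]\<^bsub>?G\<^esub> n \<in> generate ?G ?B" for n :: int
        using G.subgroup_int_pow_closed[OF subB tB] .
      have "g \<otimes>\<^bsub>?G\<^esub> inv\<^bsub>?G\<^esub> (?t [^]\<^bsub>?G\<^esub> snd g) \<in> j ` carrier ?R"
        using g t by (simp add: ker p.hom_int_pow p.hom_inv)
      from generate.eng[OF subsetD[OF NB this] tn[of "snd g"]]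
      show "g \<in> generate ?G ?B" using g t by (simp add: G.m_assoc)
    qed
  qed simp
  obtain a b where ab: "a \<in> carrier ?G" "b \<in> carrier ?G" and H: "H = generate ?G {a, b}"
    using assms(3) by (auto simp: two_generator_subgroup_def)
  have subH: "subgroup H ?G" unfolding H using ab by (intro G.generate_is_subgroup) auto
  \<comment> \<open>The subgroup \<open>V\<close> of \<open>F\<close> and the element \<open>u\<close> are the first components of \<open>K\<close> and \<open>s\<close>; the exponent \<open>m\<close>
    is the second component of \<open>s\<close>.\<close>
  have "sub_mapping_torus F \<phi> H"
    if und: "undistorted H ?G" and s: "s \<in> carrier ?G" "snd s \<ge> 1"
      and B: "finite B" "B \<subseteq> carrier ?G" "generate ?G B \<noteq> {\<one>\<^bsub>?G\<^esub>}"
        "generate ?G B \<subseteq> {g \<in> carrier ?G. snd g = 0}"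
      and Hs: "H = generate ?G (insert s (generate ?G B))"
      and conj: "\<forall>k\<in>generate ?G B. s \<otimes>\<^bsub>?G\<^esub> k \<otimes>\<^bsub>?G\<^esub> inv\<^bsub>?G\<^esub> s \<in> generate ?G B" for s B
  proof -
    have b: "fst b \<in> carrier F" "fibre F (fst b) = b" if "b \<in> B" for b
    proof -
      have "b \<in> {g \<in> carrier ?G. snd g = 0}" using that B(4) generate.incl[of b B ?G] by blast
      then show "fst b \<in> carrier F" "fibre F (fst b) = b"
        by (simp_all add: carrG fibre_def mem_Times_iff prod_eq_iff)
    qed
    then have B0: "fst ` B \<subseteq> carrier F" "fibre F ` fst ` B = B"
      by (auto simp: image_image)
    let ?V = "generate F (fst ` B)"
    have fibV: "fibre F ` ?V = generate ?G B"
      using fib.generate_img[OF B0(1)] B0(2) by simp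
    have V: "subgroup ?V F" by (rule F.generate_is_subgroup[OF B0(1)])
    have fgV: "finitely_generated (F\<lparr>carrier := ?V\<rparr>)"
      unfolding finitely_generated_def
    proof (intro exI[of _ "fst ` B"] conjI)
      show V': "fst ` B \<subseteq> carrier (F\<lparr>carrier := ?V\<rparr>)" by (auto intro: generate.incl)
      show "generate (F\<lparr>carrier := ?V\<rparr>) (fst ` B) = carrier (F\<lparr>carrier := ?V\<rparr>)"
        using F.generate_consistent[OF _ V, of "fst ` B"] V' by simp
    qed (use B in simp)
    have V1: "?V \<noteq> {\<one>\<^bsub>F\<^esub>}"
    proof
      assume "?V = {\<one>\<^bsub>F\<^esub>}"
      then have "generate ?G B = {\<one>\<^bsub>?G\<^esub>}" using fibV by (simp add: fibre_def oneG)
      then show False using B(3) by simp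
    qed
    have su: "fst s \<in> carrier F" "s = fibre F (fst s) \<otimes>\<^bsub>?G\<^esub> ?t [^]\<^bsub>?G\<^esub> nat (snd s)"
      using s by (auto simp: carrG tpow fibre_t)
    have fgH: "finitely_generated (?G\<lparr>carrier := H\<rparr>)" using und by (simp add: undistorted_def)
    show ?thesis
      unfolding sub_mapping_torus_def Let_def
    proof (intro conjI subH fgH bexI[OF _ su(1)] exI[of _ "nat (snd s)"] exI[of _ ?V] V fgV V1)
      show "1 \<le> nat (snd s)" using s(2) by simp
      show "H = generate ?G (insert (fibre F (fst s) \<otimes>\<^bsub>?G\<^esub> ?t [^]\<^bsub>?G\<^esub> nat (snd s)) (fibre F ` ?V))"
        using Hs su(2) fibV by simp
      show "\<forall>v\<in>?V. fibre F (fst s) \<otimes>\<^bsub>?G\<^esub> ?t [^]\<^bsub>?G\<^esub> nat (snd s) \<otimes>\<^bsub>?G\<^esub> fibre F v \<otimes>\<^bsub>?G\<^esub>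
          inv\<^bsub>?G\<^esub> (fibre F (fst s) \<otimes>\<^bsub>?G\<^esub> ?t [^]\<^bsub>?G\<^esub> nat (snd s)) \<in> fibre F ` ?V"
        unfolding su(2)[symmetric] fibV using conj fibV by blast
    qed
  qed
  then show ?thesis
    using G.two_generator_dichotomy[OF finite_lessThan jhom jinj p ker t fgG ab H assms(4)] by blast
qed

end
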